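(* Let $T\ge 0$, $\mu>0$ and $\lambda>0$ be fixed. For given data $[n_-,u_-]$ with $n_->0$, there exist positive constants $\hat\varepsilon_0$, $\bar C$, $\underline{C}$, $\theta$ and $C_k$ $(k=0,1,\dots)$ such that the following holds. Suppose that $[n_+,u_+]$ satisfies the Rankine–Hugoniot conditions $$-s(n_+-n_-)+n_+u_+-n_-u_-=0,$$ $$-s(n_+u_+-n_-u_-)+n_+u_+^2-n_-u_-^2+(T+1)(n_+-n_-)=0,$$ with speed $s$ of the second family ($s>u_-$), with $n_+<n_-$ and $|n_+-n_-|\le\hat\varepsilon_0$. Put $\phi_\pm=\log n_\pm$. Then the problem $$-s\frac{dn}{d\xi}+\frac{d(nu)}{d\xi}=0,$$ $$-s\frac{d(nu)}{d\xi}+\frac{d(nu^2+Tn)}{d\xi}=\mu\frac{d^2u}{d\xi^2}-n\frac{d\phi}{d\xi},$$ $$-\lambda^2\frac{d^2\phi}{d\xi^2}=n-e^{\phi},$$ in the variable $\xi=x-st$, with $\lim_{\xi\to\pm\infty}[n,u,\phi](\xi)=[n_\pm,u_\pm,\phi_\pm]$, has a smooth traveling wave solution $[\bar n,\bar u,\bar\phi](x-st)$ connecting the far fields $[n_\pm,u_\pm,\phi_\pm]$, which is unique up to a spatial shift and satisfies $$\bar n_x(x-st)=\frac{\bar n^2\,\bar u_x(x-st)}{n_-|u_--s|},\qquad \underline{C}\,\bar n_x\le\bar\phi_x\le\bar C\,\bar n_x<0$$ for any $x\in\mathbb{R}$ and $t>0$, and, for every $k=0,1,\dots$, $$\left|\frac{d^k}{dx^k}\left[\bar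 n-n_\pm,\bar u-u_\pm,\bar\phi-\phi_\pm\right]\right|\le C_k|n_+-n_-|^{k+1}e^{-\theta|n_+-n_-|\cdot|x-st|},$$ where the far field with index $-$ is taken for $x-st<0$ and the one with index $+$ is taken for $x-st>0$.
   Context: The ODE system is the traveling wave system for the one-dimensional Navier–Stokes–Poisson system $$\partial_tn+\partial_x(nu)=0,\quad \partial_t(nu)+\partial_x(nu^2+Tn)=\mu\,\partial_{xx}u-n\,\partial_x\phi,\quad -\lambda^2\partial_{xx}\phi=n-e^{\phi},$$ with $n>0$ the ion density, $u$ the velocity, $\phi$ the electric potential, and constants $T\ge0$ (temperature), $\mu>0$ (viscosity), $\lambda>0$ (Debye length). Traveling waves are smooth solutions depending only on $\xi=x-st$ and connecting constant states satisfying the quasi-neutral condition $\phi_\pm=\log n_\pm$, with first-order derivatives vanishing at $\xi=\pm\infty$. Only 2-shock profiles are considered, i.e. waves of the second characteristic family ($s>u_-$) with $n_+<n_-$. *)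

theory Defs
  imports "HOL-Analysis.Analysis"
begin

definition smooth :: "(real \<Rightarrow> real) \<Rightarrow> bool" where
  "smooth f \<longleftrightarrow> (\<forall>k. (deriv ^^ k) f differentiable_on UNIV)"

text \<open>
  Jump conditions across a front of speed \<open>s\<close> for the quasi-neutral Euler system, obtained by
  putting \<open>\<phi> = ln n\<close>, so that the pressure is \<open>(T + 1) n\<close>. The arguments \<open>nm um\<close> and \<open>np up\<close>
  are the far fields at minus and plus infinity.
\<close>

definition rankine_hugoniot ::
    "real \<Rightarrow> real \<Rightarrow> real \<Rightarrow> real \<Rightarrow> real \<Rightarrow> real \<Rightarrow> bool" where
  "rankine_hugoniot T s nm um np up \<longleftrightarrow>
     - s * (np - nm) + np * up - nm * um = 0 \<and>
     - s * (np * up - nm * um) + np * up\<^sup>2 - nm * um\<^sup>2 + (T + 1) * (np - nm) = 0"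

text \<open>\<open>T\<close>, \<open>\<mu>\<close> and \<open>l\<close> are the temperature, the viscosity and the Debye length.\<close>

definition travelling_wave_ode ::
    "real \<Rightarrow> real \<Rightarrow> real \<Rightarrow> real \<Rightarrow> (real \<Rightarrow> real) \<Rightarrow> (real \<Rightarrow> real) \<Rightarrow> (real \<Rightarrow> real) \<Rightarrow> bool" where
  "travelling_wave_ode T \<mu> l s n u \<phi> \<longleftrightarrow> (\<forall>\<xi>.
     - s * deriv n \<xi> + deriv (\<lambda>y. n y * u y) \<xi> = 0 \<and>
     - s * deriv (\<lambda>y. n y * u y) \<xi> + deriv (\<lambda>y. n y * (u y)\<^sup>2 + T * n y) \<xi>
       = \<mu> * (deriv ^^ 2) u \<xi> - n \<xi> * deriv \<phi> \<xi> \<and>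
     - l\<^sup>2 * (deriv ^^ 2) \<phi> \<xi> = n \<xi> - exp (\<phi> \<xi>))"

definition connects :: "(real \<Rightarrow> real) \<Rightarrow> real \<Rightarrow> real \<Rightarrow> bool" where
  "connects f a b \<longleftrightarrow>
     (f \<longlongrightarrow> a) at_bot \<and> (f \<longlongrightarrow> b) at_top \<and>
     (deriv f \<longlongrightarrow> 0) at_bot \<and> (deriv f \<longlongrightarrow> 0) at_top"

text \<open>
  The potential at the far fields is fixed by quasi-neutrality, so it is not a parameter.
\<close>

definition travelling_wave ::
    "real \<Rightarrow> real \<Rightarrow> real \<Rightarrow> real \<Rightarrow> real \<Rightarrow> real \<Rightarrow> real \<Rightarrow> real \<Rightarrow>
     (real \<Rightarrow> real) \<Rightarrow> (real \<Rightarrow> real) \<Rightarrow> (real \<Rightarrow> real) \<Rightarrow> bool" where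
  "travelling_wave T \<mu> l s nm um np up n u \<phi> \<longleftrightarrow>
     smooth n \<and> smooth u \<and> smooth \<phi> \<and> (\<forall>\<xi>. n \<xi> > 0) \<and>
     travelling_wave_ode T \<mu> l s n u \<phi> \<and>
     connects n nm np \<and> connects u um up \<and> connects \<phi> (ln nm) (ln np)"

text \<open>
  The spatial profile at time \<open>t\<close>. Below, \<open>deriv\<close> applied to it is the derivative in \<open>x\<close>.
\<close>

definition at_time :: "real \<Rightarrow> real \<Rightarrow> (real \<Rightarrow> real) \<Rightarrow> real \<Rightarrow> real" where
  "at_time s t f = (\<lambda>x. f (x - s * t))"

definition deviation_deriv_norm ::
    "nat \<Rightarrow> (real \<Rightarrow> real) \<Rightarrow> (real \<Rightarrow> real) \<Rightarrow> (real \<Rightarrow> real) \<Rightarrow>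
     real \<Rightarrow> real \<Rightarrow> real \<Rightarrow> real \<Rightarrow> real" where
  "deviation_deriv_norm k n u \<phi> n0 u0 \<phi>0 x =
     norm ((deriv ^^ k) (\<lambda>y. n y - n0) x,
           (deriv ^^ k) (\<lambda>y. u y - u0) x,
           (deriv ^^ k) (\<lambda>y. \<phi> y - \<phi>0) x)"

end

theory Submission
  imports Defs
begin

text \<open>
  Write \<open>nm\<close>, \<open>np\<close> for the densities at minus and plus infinity and \<open>\<epsilon> = nm - np\<close>. Conservation of mass
  makes \<open>n (s - u)\<close> a constant, the flux, and the jump conditions force its square to be
  \<open>(T + 1) nm np\<close>; so \<open>u\<close> is a function of \<open>n\<close>. Poisson's equation turns the force \<open>n \<phi>'\<close> into the
  derivative of \<open>P - l\<^sup>2 p\<^sup>2 / 2\<close>, where \<open>P = exp \<phi>\<close> and \<open>p = \<phi>'\<close>, so the momentum equation can be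
  integrated once. A travelling wave is therefore a heteroclinic orbit of an autonomous system of
  first order for \<open>(n, P, p)\<close> in which only \<open>np\<close> remains as a parameter.

  At \<open>\<epsilon> = 0\<close> the linearization at the rest point has the eigenvalues \<open>0\<close>, \<open>r1 > 0\<close> and \<open>r2 < 0\<close>. In
  the corresponding coordinates \<open>(z, g, h)\<close> the nonlinear terms have a Lipschitz constant
  proportional to \<open>\<rho>\<close> on the ball of radius \<open>\<rho>\<close>, for every \<open>\<rho> \<ge> \<epsilon>\<close>. Whatever stays in that ball is
  then controlled by one number, the central coordinate at one time: two such solutions differ at
  time \<open>t\<close> by at most twice the difference of their central coordinates at time \<open>0\<close>, times
  \<open>cosh (const * \<rho> * t)\<close> (\<open>small_solutions_compare\<close>). This comparison does most of the work.
  The Lyapunov-Perron method gives a solution with \<open>z 0 = - \<epsilon> / 2\<close>, and the comparison with the two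
  rest points shows that it stays between them and has size \<open>\<epsilon>\<close> (\<open>small_profile_exists\<close>). Applied to a solution and its translates, it gives a Harnack inequality
  for \<open>z'\<close> and shows that \<open>g'\<close> and \<open>h'\<close> are of size \<open>\<epsilon> |z'|\<close> (\<open>harnack\<close>).

  By this slaving the momentum equation is, up to a small relative error, the viscous Burgers equation
  \<open>- (\<mu> flux / n\<^sup>2) n' = (T + 1) (nm - n) (n - np) / n\<close>. Hence \<open>n\<close> decreases from \<open>nm\<close> to \<open>np\<close>,
  \<open>\<phi>'\<close> is comparable to \<open>n'\<close>, and the profile converges at a rate proportional to \<open>\<epsilon>\<close>
  (\<open>slow_estimate\<close>, \<open>n_p_comparable\<close>, \<open>w_decay\<close>). For higher derivatives all profiles are
  treated as one family: every differentiation costs a factor \<open>\<epsilon>\<close>, and classes of families that are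
  graded by powers of \<open>\<epsilon>\<close> and carry the weight \<open>|z'| / \<epsilon>\<^sup>2\<close> are closed under sums, products and
  inverses (\<open>family_graded\<close>).

  Uniqueness is claimed among all waves, not only small ones. For an arbitrary wave there is a
  functional \<open>L\<close> with \<open>L' = R\<^sup>2 / (\<mu> flux)\<close>, where \<open>R\<close> is the viscous stress, and the limits of \<open>L\<close>
  differ by at most a multiple of \<open>\<epsilon>\<close>. A wide excursion of \<open>n\<close> out of the interval between the far
  fields would need more increase of \<open>L\<close> than there is (\<open>n_upper\<close>, \<open>n_lower\<close>); the maximum principle then
  confines \<open>P\<close>, and \<open>p\<close> follows (\<open>confined\<close>). So every wave is a small solution, and after a shift that
  gives it the same central coordinate at time \<open>0\<close> the comparison identifies it with the profile
  (\<open>unique_up_to_shift\<close>).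
\<close>

section \<open>Growth estimates for linear equations on the line\<close>

lemma has_deriv_nonneg_mono:
  fixes h :: "real \<Rightarrow> real"
  assumes "\<And>t. (h has_real_derivative h' t) (at t)" and "\<And>t. 0 \<le> h' t" and "s \<le> t"
  shows "h s \<le> h t"
  using assms DERIV_nonneg_imp_nondecreasing[of s t h] by blast

lemma abs_sinh_le_cosh: "\<bar>sinh x\<bar> \<le> cosh (x::real)"
  by (rule power2_le_imp_le) (use hyperbolic_pythagoras[of x] in \<open>auto simp: cosh_real_nonneg\<close>)

lemma cosh_le_exp_abs: "cosh x \<le> exp \<bar>x::real\<bar>"
  unfolding cosh_def by (cases "x \<ge> 0") (auto simp: field_simps)

text \<open>
  A solution of an unstable equation is pinned down by its forcing as soon as it grows more slowly
  than \<open>exp (r * t)\<close>: after division by this factor, \<open>g\<close> minus the claimed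
  bound is nondecreasing and lies below a function that tends to \<open>0\<close>, so it is nowhere
  positive. The weight is \<open>cosh\<close> and not the exponential of an absolute value because it
  has to be differentiated.
\<close>

lemma unstable_upper:
  fixes g m :: "real \<Rightarrow> real"
  assumes g: "\<And>t. (g has_real_derivative r * g t + m t) (at t)"
    and m: "\<And>t. \<bar>m t\<bar> \<le> B * cosh (\<eta> * t)"
    and K: "\<And>t. \<bar>g t\<bar> \<le> K * cosh (\<eta> * t)"
    and \<eta>: "0 \<le> \<eta>" "\<eta> < r"
  shows "g t \<le> B / (r - \<eta>) * cosh (\<eta> * t)"
proof -
  define \<beta> where "\<beta> = B / (r - \<eta>)"
  have B0: "0 \<le> B" using m[of 0] by simp
  have \<beta>: "\<beta> * (r - \<eta>) = B" "0 \<le> \<beta>" using \<eta> B0 by (auto simp: \<beta>_def)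
  have K0: "0 \<le> K" using K[of 0] by simp
  define h where "h = (\<lambda>s. (g s - \<beta> * cosh (\<eta> * s)) * exp (- r * s))"
  define h' where "h' = (\<lambda>s. (m s - \<beta> * \<eta> * sinh (\<eta> * s) + r * \<beta> * cosh (\<eta> * s)) * exp (- r * s))"
  have hd: "(h has_real_derivative h' s) (at s)" for s
    unfolding h_def h'_def by (auto intro!: derivative_eq_intros g simp: algebra_simps)
  \<comment> \<open>the constant beta is the one for which the forcing and the derivative of cosh are absorbed\<close>
  have "0 \<le> h' s" for s
  proof -
    have "\<beta> * \<eta> * sinh (\<eta> * s) \<le> \<beta> * \<eta> * cosh (\<eta> * s)"
      using abs_sinh_le_cosh[of "\<eta> * s"] \<beta> \<eta> by (intro mult_left_mono) auto
    moreover have "- m s \<le> \<beta> * (r - \<eta>) * cosh (\<eta> * s)" using m[of s] \<beta> by simp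
    ultimately have "0 \<le> m s - \<beta> * \<eta> * sinh (\<eta> * s) + r * \<beta> * cosh (\<eta> * s)" by (simp add: algebra_simps)
    then show ?thesis unfolding h'_def by simp
  qed
  then have mono: "h t \<le> h s" if "t \<le> s" for s using has_deriv_nonneg_mono hd that by blast
  have lim: "((\<lambda>s. (K + \<beta>) * exp ((\<eta> - r) * s)) \<longlongrightarrow> (K + \<beta>) * 0) at_top"
  proof (intro tendsto_mult_left)
    have "filterlim (\<lambda>s. (\<eta> - r) * s) at_bot at_top"
      using \<eta> by (intro filterlim_tendsto_neg_mult_at_bot[OF tendsto_const _ filterlim_ident]) auto
    then show "((\<lambda>s. exp ((\<eta> - r) * s)) \<longlongrightarrow> 0) at_top"
      by (rule filterlim_compose[OF exp_at_bot])
  qed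
  have "h s \<le> (K + \<beta>) * exp ((\<eta> - r) * s)" if "0 \<le> s" for s
  proof -
    have "g s - \<beta> * cosh (\<eta> * s) \<le> K * cosh (\<eta> * s) + \<beta> * cosh (\<eta> * s)"
      using K[of s] mult_nonneg_nonneg[OF \<beta>(2) cosh_real_nonneg[of "\<eta> * s"]] by linarith
    also have "\<dots> \<le> (K + \<beta>) * exp (\<eta> * s)"
      using cosh_le_exp_abs[of "\<eta> * s"] that \<eta> K0 \<beta>
      by (simp add: distrib_right[symmetric] mult_left_mono)
    finally have "h s \<le> (K + \<beta>) * exp (\<eta> * s) * exp (- r * s)" unfolding h_def
      by (intro mult_right_mono) auto
    also have "\<dots> = (K + \<beta>) * exp ((\<eta> - r) * s)" by (simp add: mult_exp_exp algebra_simps)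
    finally show ?thesis .
  qed
  then have "eventually (\<lambda>s. h t \<le> (K + \<beta>) * exp ((\<eta> - r) * s)) at_top"
    using mono eventually_ge_at_top[of "max 0 t"] by (auto elim!: eventually_mono intro: order_trans)
  from tendsto_lowerbound[OF lim this] have "h t \<le> 0" by simp
  then show ?thesis unfolding h_def \<beta>_def by (simp add: mult_le_0_iff)
qed

lemma unstable_bound:
  fixes g m :: "real \<Rightarrow> real"
  assumes g: "\<And>t. (g has_real_derivative r * g t + m t) (at t)"
    and m: "\<And>t. \<bar>m t\<bar> \<le> B * cosh (\<eta> * t)"
    and K: "\<And>t. \<bar>g t\<bar> \<le> K * cosh (\<eta> * t)"
    and \<eta>: "0 \<le> \<eta>" "\<eta> < r"
  shows "\<bar>g t\<bar> \<le> B / (r - \<eta>) * cosh (\<eta> * t)"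
proof -
  have "g t \<le> B / (r - \<eta>) * cosh (\<eta> * t)"
    by (rule unstable_upper[OF g m K \<eta>])
  moreover have "- g t \<le> B / (r - \<eta>) * cosh (\<eta> * t)"
    by (rule unstable_upper[where g = "\<lambda>t. - g t" and m = "\<lambda>t. - m t" and K = K])
       (use m K \<eta> in \<open>auto intro!: derivative_eq_intros g simp: algebra_simps\<close>)
  ultimately show ?thesis by linarith
qed

text \<open>Reversal of time exchanges the unstable and the stable case.\<close>

lemma hyperbolic_bound:
  fixes g m :: "real \<Rightarrow> real"
  assumes g: "\<And>t. (g has_real_derivative r * g t + m t) (at t)"
    and m: "\<And>t. \<bar>m t\<bar> \<le> B * cosh (\<eta> * t)"
    and K: "\<And>t. \<bar>g t\<bar> \<le> K * cosh (\<eta> * t)"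
    and \<eta>: "0 \<le> \<eta>" "\<eta> < \<bar>r\<bar>"
  shows "\<bar>g t\<bar> \<le> B / (\<bar>r\<bar> - \<eta>) * cosh (\<eta> * t)"
proof (cases "r > 0")
  case True
  then show ?thesis using unstable_bound[OF g m K] \<eta> by simp
next
  case False
  have "((\<lambda>t. g (- t)) has_real_derivative (- r) * g (- t) + (- m (- t))) (at t)" for t
    using DERIV_chain'[OF DERIV_minus[OF DERIV_ident] g, of t] by simp
  then have "\<bar>g (- (- t))\<bar> \<le> B / (- r - \<eta>) * cosh (\<eta> * - t)"
    by (rule unstable_bound) (use m[of "- t" for t] K[of "- t" for t] \<eta> False in auto)
  then show ?thesis using False by simp
qed

text \<open>
  With rate \<open>0\<close> the initial value is free and the forcing accumulates, whence the loss of
  a factor \<open>1 / \<eta>\<close> and the need for a growing weight.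
\<close>

lemma central_bound:
  fixes z m :: "real \<Rightarrow> real"
  assumes z: "\<And>t. (z has_real_derivative m t) (at t)"
    and m: "\<And>t. \<bar>m t\<bar> \<le> B * cosh (\<eta> * t)" and \<eta>: "0 < \<eta>"
  shows "\<bar>z t\<bar> \<le> \<bar>z 0\<bar> + B / \<eta> * cosh (\<eta> * t)"
proof -
  have 1: "((\<lambda>t. z t + B / \<eta> * sinh (\<eta> * t)) has_real_derivative m t + B * cosh (\<eta> * t)) (at t)" for t
    using \<eta> by (auto intro!: derivative_eq_intros z)
  have 2: "((\<lambda>t. B / \<eta> * sinh (\<eta> * t) - z t) has_real_derivative B * cosh (\<eta> * t) - m t) (at t)" for t
    using \<eta> by (auto intro!: derivative_eq_intros z)
  have p: "0 \<le> m t + B * cosh (\<eta> * t)" "0 \<le> B * cosh (\<eta> * t) - m t" for t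
    using m[of t] by auto
  have B0: "0 \<le> B / \<eta>" using m[of 0] \<eta> by simp
  have ss: "\<bar>B / \<eta> * sinh (\<eta> * t)\<bar> \<le> B / \<eta> * cosh (\<eta> * t)"
    using mult_left_mono[OF abs_sinh_le_cosh[of "\<eta> * t"] B0] B0 by (simp only: abs_mult abs_of_nonneg)
  show ?thesis
  proof (cases "0 \<le> t")
    case True
    from has_deriv_nonneg_mono[OF 1 p(1) True] has_deriv_nonneg_mono[OF 2 p(2) True]
    have "z 0 \<le> z t + B / \<eta> * sinh (\<eta> * t)" "- z 0 \<le> B / \<eta> * sinh (\<eta> * t) - z t" by simp_all
    then show ?thesis using ss by linarith
  next
    case False
    then have "t \<le> 0" by simp
    from has_deriv_nonneg_mono[OF 1 p(1) this] has_deriv_nonneg_mono[OF 2 p(2) this]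
    have "z t + B / \<eta> * sinh (\<eta> * t) \<le> z 0" "B / \<eta> * sinh (\<eta> * t) - z t \<le> - z 0" by simp_all
    then show ?thesis using ss by linarith
  qed
qed

text \<open>
  The difference of two solutions of the nonlinear system satisfies these hypotheses,
  \<open>\<Lambda>\<close> being the Lipschitz constant. The crude bound \<open>K\<close> enters only
  to make the best constant \<open>k\<close> finite; the smallness condition gives \<open>k \<le> |z
  0| + k / 2\<close>, so everything is controlled by \<open>z 0\<close>. The hyperbolic components
  gain the extra factor \<open>\<Lambda>\<close>.
\<close>

lemma center_saddle_bound:
  fixes z g h m0 m1 m2 :: "real \<Rightarrow> real"
  defines "S \<equiv> \<lambda>t. \<bar>z t\<bar> + \<bar>g t\<bar> + \<bar>h t\<bar>"
  assumes z: "\<And>t. (z has_real_derivative m0 t) (at t)"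
    and g: "\<And>t. (g has_real_derivative r1 * g t + m1 t) (at t)"
    and h: "\<And>t. (h has_real_derivative r2 * h t + m2 t) (at t)"
    and m: "\<And>t. \<bar>m0 t\<bar> \<le> \<Lambda> * S t" "\<And>t. \<bar>m1 t\<bar> \<le> \<Lambda> * S t" "\<And>t. \<bar>m2 t\<bar> \<le> \<Lambda> * S t"
    and K: "\<And>t. S t \<le> K * cosh (\<eta> * t)"
    and \<eta>: "0 < \<eta>" "\<eta> < \<bar>r1\<bar>" "\<eta> < \<bar>r2\<bar>" and \<Lambda>: "0 \<le> \<Lambda>"
    and small: "\<Lambda> * (1 / \<eta> + 1 / (\<bar>r1\<bar> - \<eta>) + 1 / (\<bar>r2\<bar> - \<eta>)) \<le> 1/2"
  shows "S t \<le> 2 * \<bar>z 0\<bar> * cosh (\<eta> * t)"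
    and "\<bar>g t\<bar> \<le> \<Lambda> * (2 * \<bar>z 0\<bar>) / (\<bar>r1\<bar> - \<eta>) * cosh (\<eta> * t)"
    and "\<bar>h t\<bar> \<le> \<Lambda> * (2 * \<bar>z 0\<bar>) / (\<bar>r2\<bar> - \<eta>) * cosh (\<eta> * t)"
proof -
  have step: "\<bar>g t\<bar> \<le> \<Lambda> * k / (\<bar>r1\<bar> - \<eta>) * cosh (\<eta> * t) \<and> \<bar>h t\<bar> \<le> \<Lambda> * k / (\<bar>r2\<bar> - \<eta>) * cosh (\<eta> * t)
      \<and> S t \<le> (\<bar>z 0\<bar> + k / 2) * cosh (\<eta> * t)"
    if k: "\<And>t. S t \<le> k * cosh (\<eta> * t)" for k t
  proof -
    have k0: "0 \<le> k" using k[of 0] by (auto simp: S_def)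
    have M: "\<Lambda> * S t \<le> \<Lambda> * k * cosh (\<eta> * t)" for t
      using mult_left_mono[OF k[of t] \<Lambda>] by (simp add: mult.assoc)
    have gk: "\<bar>g t\<bar> \<le> k * cosh (\<eta> * t)" "\<bar>h t\<bar> \<le> k * cosh (\<eta> * t)" for t
      using k[of t] unfolding S_def by auto
    have 1: "\<bar>g t\<bar> \<le> \<Lambda> * k / (\<bar>r1\<bar> - \<eta>) * cosh (\<eta> * t)"
      by (rule hyperbolic_bound[OF g order_trans[OF m(2) M] gk(1)]) (use \<eta> in auto)
    have 2: "\<bar>h t\<bar> \<le> \<Lambda> * k / (\<bar>r2\<bar> - \<eta>) * cosh (\<eta> * t)"
      by (rule hyperbolic_bound[OF h order_trans[OF m(3) M] gk(2)]) (use \<eta> in auto)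
    have 3: "\<bar>z t\<bar> \<le> \<bar>z 0\<bar> + \<Lambda> * k / \<eta> * cosh (\<eta> * t)"
      by (rule central_bound[OF z order_trans[OF m(1) M] \<eta>(1)])
    have "S t \<le> \<bar>z 0\<bar> + k * (\<Lambda> * (1 / \<eta> + 1 / (\<bar>r1\<bar> - \<eta>) + 1 / (\<bar>r2\<bar> - \<eta>))) * cosh (\<eta> * t)"
      using 1 2 3 unfolding S_def by (simp add: algebra_simps)
    also have "\<dots> \<le> \<bar>z 0\<bar> * cosh (\<eta> * t) + k * (1/2) * cosh (\<eta> * t)"
      using mult_left_mono[OF cosh_real_ge_1[of "\<eta> * t"], of "\<bar>z 0\<bar>"] small k0
      by (intro add_mono mult_right_mono mult_left_mono) (auto simp: cosh_real_nonneg)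
    finally show ?thesis using 1 2 by (simp add: algebra_simps)
  qed
  define k where "k = (SUP t. S t / cosh (\<eta> * t))"
  have bdd: "bdd_above (range (\<lambda>t. S t / cosh (\<eta> * t)))"
    using K by (auto intro!: bdd_aboveI[of _ K] simp: divide_le_eq)
  have k: "S t \<le> k * cosh (\<eta> * t)" for t
    using cSUP_upper[OF _ bdd, of t] unfolding k_def by (simp add: divide_le_eq)
  have "S t / cosh (\<eta> * t) \<le> \<bar>z 0\<bar> + k / 2" for t
    using step[OF k] by (simp add: divide_le_eq)
  then have "k \<le> \<bar>z 0\<bar> + k / 2" unfolding k_def[symmetric] by (subst k_def) (rule cSUP_least, auto)
  then have k2: "k \<le> 2 * \<bar>z 0\<bar>" by simp
  have k': "S t \<le> (2 * \<bar>z 0\<bar>) * cosh (\<eta> * t)" for t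
    using k[of t] mult_right_mono[OF k2 cosh_real_nonneg] by (rule order_trans)
  show "S t \<le> 2 * \<bar>z 0\<bar> * cosh (\<eta> * t)" using k' .
  show "\<bar>g t\<bar> \<le> \<Lambda> * (2 * \<bar>z 0\<bar>) / (\<bar>r1\<bar> - \<eta>) * cosh (\<eta> * t)"
    "\<bar>h t\<bar> \<le> \<Lambda> * (2 * \<bar>z 0\<bar>) / (\<bar>r2\<bar> - \<eta>) * cosh (\<eta> * t)"
    using step[OF k'] by auto
qed

lemma continuous_has_antiderivative:
  fixes f :: "real \<Rightarrow> real"
  assumes "continuous_on UNIV f"
  obtains F where "\<And>t. (F has_real_derivative f t) (at t)"
proof -
  have "\<exists>F. \<forall>x. -\<infinity> < ereal x \<longrightarrow> ereal x < \<infinity> \<longrightarrow> (F has_vector_derivative f x) (at x)"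
    by (rule einterval_antiderivative) (use assms in \<open>auto simp: continuous_on_eq_continuous_at\<close>)
  then show ?thesis using that by (auto simp: has_real_derivative_iff_has_vector_derivative)
qed

text \<open>
  This is the solution \<open>- \<integral> exp (r * (t - s)) * m s ds\<close> over \<open>s \<ge>
  t\<close>. The improper integral is avoided: with an antiderivative \<open>F\<close> of \<open>exp
  (- r * t) * m t\<close>, its value is replaced by the number \<open>l\<close> squeezed between
  \<open>F - w\<close> and \<open>F + w\<close>, the first nondecreasing and the second nonincreasing.
\<close>

lemma unstable_solution_exists:
  fixes m :: "real \<Rightarrow> real"
  assumes m: "continuous_on UNIV m" "\<And>t. \<bar>m t\<bar> \<le> B" and r: "0 < r"
  obtains g where "\<And>t. (g has_real_derivative r * g t + m t) (at t)" "\<And>t. \<bar>g t\<bar> \<le> B / r"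
proof -
  obtain F where F: "\<And>t. (F has_real_derivative exp (- r * t) * m t) (at t)"
    by (rule continuous_has_antiderivative[of "\<lambda>t. exp (- r * t) * m t"])
      (auto intro!: continuous_intros m)
  define w where "w = (\<lambda>t. B / r * exp (- r * t))"
  have up: "F s - w s \<le> F t - w t" if "s \<le> t" for s t
  proof (rule has_deriv_nonneg_mono[OF _ _ that])
    show "((\<lambda>t. F t - w t) has_real_derivative exp (- r * t) * (m t + B)) (at t)" for t
      unfolding w_def using r by (auto intro!: derivative_eq_intros F simp: algebra_simps)
    show "0 \<le> exp (- r * t) * (m t + B)" for t using m(2)[of t] by simp
  qed
  have down: "- F s - w s \<le> - F t - w t" if "s \<le> t" for s t
  proof (rule has_deriv_nonneg_mono[OF _ _ that])
    show "((\<lambda>t. - F t - w t) has_real_derivative exp (- r * t) * (B - m t)) (at t)" for t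
      unfolding w_def using r by (auto intro!: derivative_eq_intros F simp: algebra_simps)
    show "0 \<le> exp (- r * t) * (B - m t)" for t using m(2)[of t] by simp
  qed
  have w0: "0 \<le> w t" for t unfolding w_def using m(2)[of 0] r by simp
  have cross: "F s - w s \<le> F t + w t" for s t
    using up[of s "max s t"] down[of t "max s t"] w0[of "max s t"] by simp
  define l where "l = (SUP s. F s - w s)"
  have bdd: "bdd_above (range (\<lambda>s. F s - w s))" using cross[of _ 0] by (auto intro!: bdd_aboveI)
  have l1: "F t - w t \<le> l" for t unfolding l_def by (rule cSUP_upper[OF _ bdd]) auto
  have l2: "l \<le> F t + w t" for t unfolding l_def by (rule cSUP_least) (use cross in auto)
  define g where "g = (\<lambda>t. exp (r * t) * (F t - l))"
  have "(g has_real_derivative r * g t + m t) (at t)" for t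
    unfolding g_def by (auto intro!: derivative_eq_intros F simp: algebra_simps exp_minus field_simps)
  moreover have "\<bar>g t\<bar> \<le> B / r" for t
  proof -
    have "\<bar>F t - l\<bar> \<le> w t" using l1[of t] l2[of t] by linarith
    then have "exp (r * t) * \<bar>F t - l\<bar> \<le> exp (r * t) * w t" by (intro mult_left_mono) auto
    also have "\<dots> = B / r" unfolding w_def by (simp add: exp_minus)
    finally show ?thesis unfolding g_def by (simp add: abs_mult)
  qed
  ultimately show ?thesis using that by blast
qed

lemma hyperbolic_solution_exists:
  fixes m :: "real \<Rightarrow> real"
  assumes m: "continuous_on UNIV m" "\<And>t. \<bar>m t\<bar> \<le> B" and r: "r \<noteq> 0"
  obtains g where "\<And>t. (g has_real_derivative r * g t + m t) (at t)" "\<And>t. \<bar>g t\<bar> \<le> B / \<bar>r\<bar>"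
proof (cases "r > 0")
  case True
  then show ?thesis using unstable_solution_exists[OF m, of r] that by auto
next
  case False
  have "continuous_on UNIV (\<lambda>t. - m (- t))"
    by (intro continuous_intros continuous_on_compose2[OF m(1)]) auto
  from unstable_solution_exists[OF this, of B "- r"] False r m(2)
  obtain g where g: "\<And>t. (g has_real_derivative (- r) * g t + (- m (- t))) (at t)" 
     "\<And>t. \<bar>g t\<bar> \<le> B / (- r)" by auto
  have "((\<lambda>t. g (- t)) has_real_derivative r * g (- t) + m t) (at t)" for t
    using DERIV_chain'[OF DERIV_minus[OF DERIV_ident] g(1), of t] by (simp add: algebra_simps)
  then show ?thesis using that[of "\<lambda>t. g (- t)"] g(2) False r by auto
qed

section \<open>Bounded solutions of a perturbed saddle with a central direction\<close>

lemma le_mult_cosh: "0 \<le> x \<Longrightarrow> x \<le> x * cosh (y::real)"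
  using mult_left_mono[OF cosh_real_ge_1, of x y] by simp

lemma triple_component_le_norm:
  fixes p :: "real \<times> real \<times> real"
  shows "\<bar>fst p\<bar> \<le> norm p" "\<bar>fst (snd p)\<bar> \<le> norm p" "\<bar>snd (snd p)\<bar> \<le> norm p"
proof -
  obtain x y w where p: "p = (x, y, w)" by (cases p) auto
  show "\<bar>fst p\<bar> \<le> norm p" "\<bar>fst (snd p)\<bar> \<le> norm p" "\<bar>snd (snd p)\<bar> \<le> norm p"
    using norm_fst_le[of x "(y, w)"] norm_snd_le[of "(y, w)" x] norm_fst_le[of y w] norm_snd_le[of w y]
    unfolding p by auto
qed

text \<open>
  Lyapunov-Perron method. Given a triple of functions, insert it into the nonlinear terms and solve
  the three linear equations, choosing the bounded solution in the hyperbolic directions and the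
  initial value \<open>z0\<close> in the central one. This map is a contraction in the space of
  continuous triples that are bounded relative to \<open>cosh (\<eta> * t)\<close>; bounded functions
  alone would not do, since the central component may grow.
\<close>

lemma lyapunov_perron:
  fixes f0 f :: "real \<Rightarrow> real \<Rightarrow> real \<Rightarrow> real"
  assumes lip0: "\<And>x y w x' y' w'. \<bar>f0 x y w - f0 x' y' w'\<bar> \<le> \<Lambda> * (\<bar>x - x'\<bar> + \<bar>y - y'\<bar> + \<bar>w - w'\<bar>)"
    and lip: "\<And>x y w x' y' w'. \<bar>f x y w - f x' y' w'\<bar> \<le> \<Lambda> * (\<bar>x - x'\<bar> + \<bar>y - y'\<bar> + \<bar>w - w'\<bar>)"
    and bnd: "\<And>x y w. \<bar>f0 x y w\<bar> \<le> B" "\<And>x y w. \<bar>f x y w\<bar> \<le> B"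
    and \<eta>: "0 < \<eta>" "\<eta> < \<bar>r1\<bar>" "\<eta> < \<bar>r2\<bar>" and \<Lambda>: "0 \<le> \<Lambda>"
    and small: "\<Lambda> * (1 / \<eta> + 1 / (\<bar>r1\<bar> - \<eta>) + 1 / (\<bar>r2\<bar> - \<eta>)) \<le> 1/6"
  obtains z g h where "z 0 = z0"
    "\<And>t. (z has_real_derivative f0 (z t) (g t) (h t)) (at t)"
    "\<And>t. (g has_real_derivative r1 * g t + f (z t) (g t) (h t)) (at t)"
    "\<And>t. (h has_real_derivative r2 * h t + f (z t) (g t) (h t)) (at t)"
    "\<And>t. \<bar>g t\<bar> \<le> B / \<bar>r1\<bar>" "\<And>t. \<bar>h t\<bar> \<le> B / \<bar>r2\<bar>"
proof -
  \<comment> \<open>ev undoes the normalization by the weight, so that the bounded continuous triples serve as the Banach space\<close>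
  define ev :: "(real \<Rightarrow>\<^sub>C (real \<times> real \<times> real)) \<Rightarrow> real \<Rightarrow> real \<times> real \<times> real"
    where "ev = (\<lambda>Y t. cosh (\<eta> * t) *\<^sub>R apply_bcontfun Y t)"
  define c0 where "c0 = (\<lambda>Y t. fst (ev Y t))"
  define c1 where "c1 = (\<lambda>Y t. fst (snd (ev Y t)))"
  define c2 where "c2 = (\<lambda>Y t. snd (snd (ev Y t)))"
  define P where "P = (\<lambda>Y Y'. c0 Y' 0 = z0 \<and>
     (\<forall>t. (c0 Y' has_real_derivative f0 (c0 Y t) (c1 Y t) (c2 Y t)) (at t)) \<and>
     (\<forall>t. (c1 Y' has_real_derivative r1 * c1 Y' t + f (c0 Y t) (c1 Y t) (c2 Y t)) (at t)) \<and>
     (\<forall>t. (c2 Y' has_real_derivative r2 * c2 Y' t + f (c0 Y t) (c1 Y t) (c2 Y t)) (at t)) \<and>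
     (\<forall>t. \<bar>c1 Y' t\<bar> \<le> B / \<bar>r1\<bar>) \<and> (\<forall>t. \<bar>c2 Y' t\<bar> \<le> B / \<bar>r2\<bar>))"
  have B0: "0 \<le> B" using bnd(1)[of 0 0 0] by linarith
  have contL: "continuous_on UNIV (\<lambda>t. F (a t) (b t) (c t))"
    if F: "\<And>x y w x' y' w'. \<bar>F x y w - F x' y' w'\<bar> \<le> \<Lambda> * (\<bar>x - x'\<bar> + \<bar>y - y'\<bar> + \<bar>w - w'\<bar>)"
    and c: "continuous_on UNIV a" "continuous_on UNIV b" "continuous_on UNIV c"
    for F :: "real \<Rightarrow> real \<Rightarrow> real \<Rightarrow> real" and a b c :: "real \<Rightarrow> real"
  proof -
    have "((\<lambda>s. F (a s) (b s) (c s)) \<longlongrightarrow> F (a t) (b t) (c t)) (at t)" for t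
    proof -
      have cc: "(a \<longlongrightarrow> a t) (at t)" "(b \<longlongrightarrow> b t) (at t)" "(c \<longlongrightarrow> c t) (at t)"
        using c by (auto simp: continuous_on_eq_continuous_at isCont_def)
      have l0: "((\<lambda>s. \<Lambda> * (\<bar>a s - a t\<bar> + \<bar>b s - b t\<bar> + \<bar>c s - c t\<bar>)) \<longlongrightarrow> \<Lambda> * (\<bar>a t - a t\<bar> + \<bar>b t - b t\<bar> + \<bar>c t - c t\<bar>)) (at t)"
        by (intro tendsto_intros cc)
      have "((\<lambda>s. F (a s) (b s) (c s) - F (a t) (b t) (c t)) \<longlongrightarrow> 0) (at t)"
      proof (rule Lim_null_comparison)
        show "\<forall>\<^sub>F s in at t. norm (F (a s) (b s) (c s) - F (a t) (b t) (c t))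
            \<le> \<Lambda> * (\<bar>a s - a t\<bar> + \<bar>b s - b t\<bar> + \<bar>c s - c t\<bar>)"
          unfolding real_norm_def by (intro always_eventually allI F)
      qed (use l0 in simp)
      then show ?thesis by (simp add: LIM_zero_iff)
    qed
    then show ?thesis by (simp add: continuous_on_eq_continuous_at isCont_def)
  qed
  have "\<exists>Y'. P Y Y'" for Y
  proof -
    have ce: "continuous_on UNIV (ev Y)" unfolding ev_def by (intro continuous_intros) auto
    have cc: "continuous_on UNIV (c0 Y)" "continuous_on UNIV (c1 Y)" "continuous_on UNIV (c2 Y)"
      unfolding c0_def c1_def c2_def by (intro continuous_intros ce)+
    note cf = contL[OF lip cc] and cf0 = contL[OF lip0 cc]
    obtain g where g: "\<And>t. (g has_real_derivative r1 * g t + f (c0 Y t) (c1 Y t) (c2 Y t)) (at t)"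
        "\<And>t. \<bar>g t\<bar> \<le> B / \<bar>r1\<bar>"
      by (rule hyperbolic_solution_exists[OF cf bnd(2), of r1]) (use \<eta> in auto)
    obtain h where h: "\<And>t. (h has_real_derivative r2 * h t + f (c0 Y t) (c1 Y t) (c2 Y t)) (at t)"
        "\<And>t. \<bar>h t\<bar> \<le> B / \<bar>r2\<bar>"
      by (rule hyperbolic_solution_exists[OF cf bnd(2), of r2]) (use \<eta> in auto)
    obtain F where F: "\<And>t. (F has_real_derivative f0 (c0 Y t) (c1 Y t) (c2 Y t)) (at t)"
      using continuous_has_antiderivative[OF cf0] by blast
    define z where "z = (\<lambda>t. z0 + (F t - F 0))"
    have z: "(z has_real_derivative f0 (c0 Y t) (c1 Y t) (c2 Y t)) (at t)" for t
      unfolding z_def by (auto intro!: derivative_eq_intros F)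
    have B1: "\<bar>f0 (c0 Y t) (c1 Y t) (c2 Y t)\<bar> \<le> B * cosh (\<eta> * t)" for t
      using bnd(1)[of "c0 Y t" "c1 Y t" "c2 Y t"] mult_left_mono[OF cosh_real_ge_1 B0, of "\<eta> * t"] by simp
    have zb: "\<bar>z t\<bar> \<le> \<bar>z0\<bar> + B / \<eta> * cosh (\<eta> * t)" for t
      using central_bound[OF z B1 \<eta>(1)] by (simp add: z_def)
    define X where "X = (\<lambda>t. (1 / cosh (\<eta> * t)) *\<^sub>R (z t, g t, h t))"
    have cX: "continuous_on UNIV X"
    proof -
      have "continuous_on UNIV z" "continuous_on UNIV g" "continuous_on UNIV h"
        using z g(1) h(1) DERIV_isCont by (auto simp: continuous_on_eq_continuous_at; blast)+
      then show ?thesis unfolding X_def by (intro continuous_intros) auto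
    qed
    have bX: "norm (X t) \<le> (\<bar>z0\<bar> + B / \<eta>) + B / \<bar>r1\<bar> + B / \<bar>r2\<bar>" for t
    proof -
      have "norm (z t, g t, h t) \<le> \<bar>z t\<bar> + (\<bar>g t\<bar> + \<bar>h t\<bar>)"
        using norm_Pair_le[of "z t" "(g t, h t)"] norm_Pair_le[of "g t" "h t"] by simp
      also have "\<dots> \<le> \<bar>z0\<bar> + B / \<eta> * cosh (\<eta> * t) + (B / \<bar>r1\<bar> + B / \<bar>r2\<bar>)"
        using zb[of t] g(2)[of t] h(2)[of t] by simp
      also have "\<dots> \<le> \<bar>z0\<bar> * cosh (\<eta> * t) + B / \<eta> * cosh (\<eta> * t) + (B / \<bar>r1\<bar> + B / \<bar>r2\<bar>) * cosh (\<eta> * t)"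
        using B0 by (intro add_mono le_mult_cosh) auto
      finally have "norm (z t, g t, h t) \<le> (\<bar>z0\<bar> + B / \<eta> + B / \<bar>r1\<bar> + B / \<bar>r2\<bar>) * cosh (\<eta> * t)"
        by (simp only: distrib_right add.assoc)
      moreover have "norm (X t) = norm (z t, g t, h t) / cosh (\<eta> * t)"
        unfolding X_def norm_scaleR by simp
      ultimately show ?thesis by (simp add: divide_le_eq)
    qed
    have X: "X \<in> bcontfun" using cX bX
      by (auto simp: bcontfun_def bounded_iff)
    have "ev (Bcontfun X) = (\<lambda>t. (z t, g t, h t))"
      unfolding ev_def by (simp add: Bcontfun_inverse[OF X]) (simp add: X_def)
    then have "c0 (Bcontfun X) = z" "c1 (Bcontfun X) = g" "c2 (Bcontfun X) = h"
      by (simp_all add: c0_def c1_def c2_def fun_eq_iff)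
    moreover have "z 0 = z0" by (simp add: z_def)
    ultimately have "P Y (Bcontfun X)" unfolding P_def using z g h by simp
    then show ?thesis by blast
  qed
  then obtain \<Phi> where \<Phi>: "\<And>Y. P Y (\<Phi> Y)" by metis
  \<comment> \<open>the constant 1/6 in the hypothesis is 1/2 divided by 3, the loss from estimating a sum of three components by the norm\<close>
  have "dist (\<Phi> Y1) (\<Phi> Y2) \<le> 1/2 * dist Y1 Y2" for Y1 Y2
  proof (rule dist_bound)
    fix t
    define k where "k = 3 * \<Lambda> * dist Y1 Y2"
    have S: "\<Lambda> * (\<bar>c0 Y1 t - c0 Y2 t\<bar> + \<bar>c1 Y1 t - c1 Y2 t\<bar> + \<bar>c2 Y1 t - c2 Y2 t\<bar>) \<le> k * cosh (\<eta> * t)" for t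
    proof -
      let ?d = "apply_bcontfun Y1 t - apply_bcontfun Y2 t"
      have d: "norm ?d \<le> dist Y1 Y2" using dist_bounded[of Y1 t Y2] by (simp add: dist_norm)
      have e: "ev Y1 t - ev Y2 t = cosh (\<eta> * t) *\<^sub>R ?d" unfolding ev_def by (simp add: algebra_simps)
      have n: "norm (ev Y1 t - ev Y2 t) \<le> cosh (\<eta> * t) * dist Y1 Y2"
        unfolding e using d by (simp add: mult_left_mono)
      have "\<bar>c0 Y1 t - c0 Y2 t\<bar> \<le> norm (ev Y1 t - ev Y2 t)"
        "\<bar>c1 Y1 t - c1 Y2 t\<bar> \<le> norm (ev Y1 t - ev Y2 t)" "\<bar>c2 Y1 t - c2 Y2 t\<bar> \<le> norm (ev Y1 t - ev Y2 t)"
        using triple_component_le_norm[of "ev Y1 t - ev Y2 t"] unfolding c0_def c1_def c2_def by auto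
      then have "\<bar>c0 Y1 t - c0 Y2 t\<bar> + \<bar>c1 Y1 t - c1 Y2 t\<bar> + \<bar>c2 Y1 t - c2 Y2 t\<bar> \<le> 3 * (cosh (\<eta> * t) * dist Y1 Y2)"
        using n by linarith
      from mult_left_mono[OF this \<Lambda>] show ?thesis unfolding k_def by (simp add: algebra_simps)
    qed
    define F0 where "F0 = (\<lambda>t. f0 (c0 Y1 t) (c1 Y1 t) (c2 Y1 t) - f0 (c0 Y2 t) (c1 Y2 t) (c2 Y2 t))"
    define F1 where "F1 = (\<lambda>t. f (c0 Y1 t) (c1 Y1 t) (c2 Y1 t) - f (c0 Y2 t) (c1 Y2 t) (c2 Y2 t))"
    define U where "U = (\<lambda>t. c0 (\<Phi> Y1) t - c0 (\<Phi> Y2) t)"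
    define V where "V = (\<lambda>t. c1 (\<Phi> Y1) t - c1 (\<Phi> Y2) t)"
    define W where "W = (\<lambda>t. c2 (\<Phi> Y1) t - c2 (\<Phi> Y2) t)"
    have F: "\<bar>F0 t\<bar> \<le> k * cosh (\<eta> * t)" "\<bar>F1 t\<bar> \<le> k * cosh (\<eta> * t)" for t
      unfolding F0_def F1_def using S[of t] lip lip0 by (blast intro: order_trans)+
    note P1 = \<Phi>[of Y1, unfolded P_def] and P2 = \<Phi>[of Y2, unfolded P_def]
    have U: "(U has_real_derivative F0 t) (at t)" for t
      unfolding U_def F0_def using P1 P2 by (auto intro!: derivative_eq_intros)
    have V: "(V has_real_derivative r1 * V t + F1 t) (at t)" for t
      unfolding V_def F1_def using P1 P2 by (auto intro!: derivative_eq_intros simp: algebra_simps)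
    have W: "(W has_real_derivative r2 * W t + F1 t) (at t)" for t
      unfolding W_def F1_def using P1 P2 by (auto intro!: derivative_eq_intros simp: algebra_simps)
    have Vb: "\<bar>V t\<bar> \<le> 2 * (B / \<bar>r1\<bar>) * cosh (\<eta> * t)" "\<bar>W t\<bar> \<le> 2 * (B / \<bar>r2\<bar>) * cosh (\<eta> * t)" for t
    proof -
      have "\<bar>c1 (\<Phi> Y1) t\<bar> \<le> B / \<bar>r1\<bar>" "\<bar>c1 (\<Phi> Y2) t\<bar> \<le> B / \<bar>r1\<bar>" using P1 P2 by blast+
      then have "\<bar>V t\<bar> \<le> 2 * (B / \<bar>r1\<bar>)" unfolding V_def by linarith
      also have "\<dots> \<le> 2 * (B / \<bar>r1\<bar>) * cosh (\<eta> * t)" using B0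
        by (intro le_mult_cosh) auto
      finally show "\<bar>V t\<bar> \<le> 2 * (B / \<bar>r1\<bar>) * cosh (\<eta> * t)" .
      have "\<bar>c2 (\<Phi> Y1) t\<bar> \<le> B / \<bar>r2\<bar>" "\<bar>c2 (\<Phi> Y2) t\<bar> \<le> B / \<bar>r2\<bar>" using P1 P2 by blast+
      then have "\<bar>W t\<bar> \<le> 2 * (B / \<bar>r2\<bar>)" unfolding W_def by linarith
      also have "\<dots> \<le> 2 * (B / \<bar>r2\<bar>) * cosh (\<eta> * t)" using B0
        by (intro le_mult_cosh) auto
      finally show "\<bar>W t\<bar> \<le> 2 * (B / \<bar>r2\<bar>) * cosh (\<eta> * t)" .
    qed
    have 1: "\<bar>V t\<bar> \<le> k / (\<bar>r1\<bar> - \<eta>) * cosh (\<eta> * t)"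
      by (rule hyperbolic_bound[OF V F(2) Vb(1)]) (use \<eta> in auto)
    have 2: "\<bar>W t\<bar> \<le> k / (\<bar>r2\<bar> - \<eta>) * cosh (\<eta> * t)"
      by (rule hyperbolic_bound[OF W F(2) Vb(2)]) (use \<eta> in auto)
    have "U 0 = 0" unfolding U_def using P1 P2 by simp
    then have 3: "\<bar>U t\<bar> \<le> k / \<eta> * cosh (\<eta> * t)"
      using central_bound[OF U F(1) \<eta>(1), of t] by simp
    have "ev (\<Phi> Y1) t - ev (\<Phi> Y2) t = (U t, V t, W t)"
      unfolding U_def V_def W_def c0_def c1_def c2_def by (simp add: prod_eq_iff)
    moreover have "ev (\<Phi> Y1) t - ev (\<Phi> Y2) t = cosh (\<eta> * t) *\<^sub>R (apply_bcontfun (\<Phi> Y1) t - apply_bcontfun (\<Phi> Y2) t)"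
      unfolding ev_def by (simp add: algebra_simps)
    ultimately have "cosh (\<eta> * t) * dist (apply_bcontfun (\<Phi> Y1) t) (apply_bcontfun (\<Phi> Y2) t) = norm (U t, V t, W t)"
      by (metis dist_norm norm_scaleR cosh_real_nonneg abs_of_nonneg)
    also have "\<dots> \<le> \<bar>U t\<bar> + (\<bar>V t\<bar> + \<bar>W t\<bar>)"
      using norm_Pair_le[of "U t" "(V t, W t)"] norm_Pair_le[of "V t" "W t"] by simp
    also have "\<dots> \<le> 3 * dist Y1 Y2 * (\<Lambda> * (1 / \<eta> + 1 / (\<bar>r1\<bar> - \<eta>) + 1 / (\<bar>r2\<bar> - \<eta>))) * cosh (\<eta> * t)"
      using 1 2 3 unfolding k_def by (simp add: algebra_simps)
    also have "\<dots> \<le> 3 * dist Y1 Y2 * (1/6) * cosh (\<eta> * t)"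
      using small by (intro mult_right_mono mult_left_mono) auto
    finally show "dist (apply_bcontfun (\<Phi> Y1) t) (apply_bcontfun (\<Phi> Y2) t) \<le> 1/2 * dist Y1 Y2"
      by (simp add: field_simps)
  qed
  then have "\<exists>!Y. Y \<in> UNIV \<and> \<Phi> Y = Y"
    using banach_fix_type[of "1/2" \<Phi>] by auto
  then obtain Y where "\<Phi> Y = Y" by blast
  then show ?thesis using that[of "c0 Y" "c1 Y" "c2 Y"] \<Phi>[of Y] unfolding P_def by auto
qed

section \<open>Nonlinear terms of a given order\<close>

definition lip_bounded ::
    "real \<Rightarrow> real \<Rightarrow> real \<Rightarrow> (real \<Rightarrow> real \<Rightarrow> real \<Rightarrow> real) \<Rightarrow> bool" where
  "lip_bounded r B K F \<longleftrightarrow>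
     (\<forall>x y w x' y' w'. \<bar>x\<bar> \<le> r \<longrightarrow> \<bar>y\<bar> \<le> r \<longrightarrow> \<bar>w\<bar> \<le> r \<longrightarrow> \<bar>x'\<bar> \<le> r \<longrightarrow> \<bar>y'\<bar> \<le> r \<longrightarrow> \<bar>w'\<bar> \<le> r \<longrightarrow>
        \<bar>F x y w\<bar> \<le> B \<and> \<bar>F x y w - F x' y' w'\<bar> \<le> K * (\<bar>x - x'\<bar> + \<bar>y - y'\<bar> + \<bar>w - w'\<bar>))"

text \<open>
  For a term that vanishes to order \<open>m\<close> at the origin, the size is \<open>r ^ m\<close>
  and the Lipschitz constant \<open>r ^ (m - 1)\<close> where all arguments are at most
  \<open>r\<close>; the quotient \<open>r ^ m / r\<close> also covers \<open>m = 0\<close>. Since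
  \<open>E i \<le> r\<close> is required, the parameter \<open>E i\<close> itself counts as a quantity
  of order \<open>1\<close>. Orders add under multiplication, so the order of a polynomial can be read
  off from its monomials, uniformly in \<open>i\<close>.
\<close>

definition lip_order ::
    "'i set \<Rightarrow> ('i \<Rightarrow> real) \<Rightarrow> nat \<Rightarrow> ('i \<Rightarrow> real \<Rightarrow> real \<Rightarrow> real \<Rightarrow> real) \<Rightarrow> bool" where
  "lip_order I E m F \<longleftrightarrow> (\<exists>C\<ge>0. \<forall>i\<in>I. \<forall>r. E i \<le> r \<longrightarrow> 0 < r \<longrightarrow> r \<le> 1 \<longrightarrow>
     lip_bounded r (C * r ^ m) (C * r ^ m / r) (F i))"

lemma lip_boundedI:
  assumes "\<And>x y w. \<bar>x\<bar> \<le> r \<Longrightarrow> \<bar>y\<bar> \<le> r \<Longrightarrow> \<bar>w\<bar> \<le> r \<Longrightarrow> \<bar>F x y w\<bar> \<le> B"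
    and "\<And>x y w x' y' w'. \<bar>x\<bar> \<le> r \<Longrightarrow> \<bar>y\<bar> \<le> r \<Longrightarrow> \<bar>w\<bar> \<le> r \<Longrightarrow> \<bar>x'\<bar> \<le> r \<Longrightarrow> \<bar>y'\<bar> \<le> r \<Longrightarrow> \<bar>w'\<bar> \<le> r \<Longrightarrow>
       \<bar>F x y w - F x' y' w'\<bar> \<le> K * (\<bar>x - x'\<bar> + \<bar>y - y'\<bar> + \<bar>w - w'\<bar>)"
  shows "lip_bounded r B K F"
  unfolding lip_bounded_def by (intro allI impI conjI assms)

lemma lip_boundedD:
  assumes "lip_bounded r B K F" "\<bar>x\<bar> \<le> r" "\<bar>y\<bar> \<le> r" "\<bar>w\<bar> \<le> r"
  shows "\<bar>F x y w\<bar> \<le> B"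
    and "\<bar>x'\<bar> \<le> r \<Longrightarrow> \<bar>y'\<bar> \<le> r \<Longrightarrow> \<bar>w'\<bar> \<le> r \<Longrightarrow>
      \<bar>F x y w - F x' y' w'\<bar> \<le> K * (\<bar>x - x'\<bar> + \<bar>y - y'\<bar> + \<bar>w - w'\<bar>)"
  using assms(1)[unfolded lip_bounded_def, rule_format, OF assms(2-4)] assms(2-4) by auto

lemma lip_bounded_mono:
  assumes "lip_bounded r B K F" "B \<le> B'" "K \<le> K'"
  shows "lip_bounded r B' K' F"
  by (rule lip_boundedI)
    (rule order_trans[OF lip_boundedD(1)[OF assms(1)] assms(2)]
        order_trans[OF lip_boundedD(2)[OF assms(1)] mult_right_mono[OF assms(3)]]; simp)+

lemma lip_bounded_add:
  assumes F: "lip_bounded r A K F" and G: "lip_bounded r B L G"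
  shows "lip_bounded r (A + B) (K + L) (\<lambda>x y w. F x y w + G x y w)"
proof (rule lip_boundedI)
  fix x y w x' y' w'
  assume a: "\<bar>x\<bar> \<le> r" "\<bar>y\<bar> \<le> r" "\<bar>w\<bar> \<le> r"
  show "\<bar>F x y w + G x y w\<bar> \<le> A + B"
    using lip_boundedD(1)[OF F a] lip_boundedD(1)[OF G a] by linarith
  assume b: "\<bar>x'\<bar> \<le> r" "\<bar>y'\<bar> \<le> r" "\<bar>w'\<bar> \<le> r"
  show "\<bar>F x y w + G x y w - (F x' y' w' + G x' y' w')\<bar> \<le> (K + L) * (\<bar>x - x'\<bar> + \<bar>y - y'\<bar> + \<bar>w - w'\<bar>)"
    using lip_boundedD(2)[OF F a b] lip_boundedD(2)[OF G a b] unfolding distrib_right[of K L] by linarith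
qed

lemma lip_bounded_mult:
  assumes F: "lip_bounded r A K F" and G: "lip_bounded r B L G" and r: "0 \<le> r"
  shows "lip_bounded r (A * B) (A * L + B * K) (\<lambda>x y w. F x y w * G x y w)"
proof (rule lip_boundedI)
  have AB: "0 \<le> A" "0 \<le> B"
    using lip_boundedD(1)[OF F, of 0 0 0] lip_boundedD(1)[OF G, of 0 0 0] r by auto
  fix x y w x' y' w'
  assume a: "\<bar>x\<bar> \<le> r" "\<bar>y\<bar> \<le> r" "\<bar>w\<bar> \<le> r"
  show "\<bar>F x y w * G x y w\<bar> \<le> A * B"
    unfolding abs_mult by (intro mult_mono lip_boundedD(1)[OF F a] lip_boundedD(1)[OF G a] AB) simp
  assume b: "\<bar>x'\<bar> \<le> r" "\<bar>y'\<bar> \<le> r" "\<bar>w'\<bar> \<le> r"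
  define d where "d = \<bar>x - x'\<bar> + \<bar>y - y'\<bar> + \<bar>w - w'\<bar>"
  have "F x y w * G x y w - F x' y' w' * G x' y' w'
      = F x y w * (G x y w - G x' y' w') + G x' y' w' * (F x y w - F x' y' w')"
    by (simp add: algebra_simps)
  then have "\<bar>F x y w * G x y w - F x' y' w' * G x' y' w'\<bar>
      \<le> \<bar>F x y w\<bar> * \<bar>G x y w - G x' y' w'\<bar> + \<bar>G x' y' w'\<bar> * \<bar>F x y w - F x' y' w'\<bar>"
    by (metis abs_mult abs_triangle_ineq)
  also have "\<dots> \<le> A * (L * d) + B * (K * d)"
    unfolding d_def by (intro add_mono mult_mono lip_boundedD(1)[OF F a] lip_boundedD(1)[OF G b]
        lip_boundedD(2)[OF F a b] lip_boundedD(2)[OF G a b] AB) simp_all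
  finally show "\<bar>F x y w * G x y w - F x' y' w' * G x' y' w'\<bar> \<le> (A * L + B * K) * (\<bar>x - x'\<bar> + \<bar>y - y'\<bar> + \<bar>w - w'\<bar>)"
    unfolding d_def by (simp only: distrib_right mult.assoc)
qed

lemma lip_orderI:
  assumes "0 \<le> C" "\<And>i r. i \<in> I \<Longrightarrow> E i \<le> r \<Longrightarrow> 0 < r \<Longrightarrow> r \<le> 1 \<Longrightarrow> lip_bounded r (C * r ^ m) (C * r ^ m / r) (F i)"
  shows "lip_order I E m F"
  unfolding lip_order_def by (intro exI[of _ C] conjI ballI allI impI assms)

lemma lip_orderE:
  assumes "lip_order I E m F"
  obtains C where "0 \<le> C"
    "\<And>i r. i \<in> I \<Longrightarrow> E i \<le> r \<Longrightarrow> 0 < r \<Longrightarrow> r \<le> 1 \<Longrightarrow> lip_bounded r (C * r ^ m) (C * r ^ m / r) (F i)"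
proof -
  obtain C where "0 \<le> C" and C: "\<forall>i\<in>I. \<forall>r. E i \<le> r \<longrightarrow> 0 < r \<longrightarrow> r \<le> 1 \<longrightarrow>
     lip_bounded r (C * r ^ m) (C * r ^ m / r) (F i)"
    using assms unfolding lip_order_def by (elim exE conjE)
  then show ?thesis by (intro that[of C] C[rule_format]) 
qed

lemma lip_order_param:
  assumes "\<And>i. i \<in> I \<Longrightarrow> \<bar>k i\<bar> \<le> B * E i ^ m" "\<And>i. i \<in> I \<Longrightarrow> 0 \<le> E i" "0 \<le> B"
  shows "lip_order I E m (\<lambda>i x y w. k i)"
proof (rule lip_orderI[OF assms(3)])
  fix i r assume i: "i \<in> I" "E i \<le> r" "0 < r"
  then have "B * E i ^ m \<le> B * r ^ m" using assms(2,3) by (intro mult_left_mono power_mono) auto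
  then show "lip_bounded r (B * r ^ m) (B * r ^ m / r) (\<lambda>x y w. k i)"
    using assms(1)[OF i(1)] assms(3) i(3) by (intro lip_boundedI) auto
qed

lemma lip_order_const: "lip_order I E 0 (\<lambda>i x y w. c)"
  by (rule lip_orderI[of "\<bar>c\<bar>"]; simp; rule lip_boundedI; simp)

lemma lip_order_coord:
  "lip_order I E 1 (\<lambda>i x y w. x)" "lip_order I E 1 (\<lambda>i x y w. y)" "lip_order I E 1 (\<lambda>i x y w. w)"
  by (rule lip_orderI[of 1]; simp; rule lip_boundedI; simp)+

lemma lip_order_add:
  assumes "lip_order I E m F" "lip_order I E m G"
  shows "lip_order I E m (\<lambda>i x y w. F i x y w + G i x y w)"
proof -
  obtain C where C: "0 \<le> C"
    "\<And>i r. i \<in> I \<Longrightarrow> E i \<le> r \<Longrightarrow> 0 < r \<Longrightarrow> r \<le> 1 \<Longrightarrow> lip_bounded r (C * r ^ m) (C * r ^ m / r) (F i)"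
    using assms(1) by (rule lip_orderE) (rule that; assumption)
  obtain D where D: "0 \<le> D"
    "\<And>i r. i \<in> I \<Longrightarrow> E i \<le> r \<Longrightarrow> 0 < r \<Longrightarrow> r \<le> 1 \<Longrightarrow> lip_bounded r (D * r ^ m) (D * r ^ m / r) (G i)"
    using assms(2) by (rule lip_orderE) (rule that; assumption)
  show ?thesis
  proof (rule lip_orderI[of "C + D"])
    fix i r assume h: "i \<in> I" "E i \<le> r" "0 < r" "r \<le> 1"
    show "lip_bounded r ((C + D) * r ^ m) ((C + D) * r ^ m / r) (\<lambda>x y w. F i x y w + G i x y w)"
      using lip_bounded_add[OF C(2)[OF h] D(2)[OF h]] by (simp only: distrib_right add_divide_distrib)
  qed (use C D in auto)
qed

lemma lip_order_mult:
  assumes "lip_order I E m F" "lip_order I E k G"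
  shows "lip_order I E (m + k) (\<lambda>i x y w. F i x y w * G i x y w)"
proof -
  obtain C where C: "0 \<le> C"
    "\<And>i r. i \<in> I \<Longrightarrow> E i \<le> r \<Longrightarrow> 0 < r \<Longrightarrow> r \<le> 1 \<Longrightarrow> lip_bounded r (C * r ^ m) (C * r ^ m / r) (F i)"
    using assms(1) by (rule lip_orderE) (rule that; assumption)
  obtain D where D: "0 \<le> D"
    "\<And>i r. i \<in> I \<Longrightarrow> E i \<le> r \<Longrightarrow> 0 < r \<Longrightarrow> r \<le> 1 \<Longrightarrow> lip_bounded r (D * r ^ k) (D * r ^ k / r) (G i)"
    using assms(2) by (rule lip_orderE) (rule that; assumption)
  show ?thesis
  proof (rule lip_orderI[of "2 * C * D"])
    fix i r assume h: "i \<in> I" "E i \<le> r" "0 < r" "r \<le> 1"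
    have "lip_bounded r ((C * r ^ m) * (D * r ^ k)) ((C * r ^ m) * (D * r ^ k / r) + (D * r ^ k) * (C * r ^ m / r))
        (\<lambda>x y w. F i x y w * G i x y w)"
      by (rule lip_bounded_mult[OF C(2)[OF h] D(2)[OF h]]) (use h in simp)
    then show "lip_bounded r (2 * C * D * r ^ (m + k)) (2 * C * D * r ^ (m + k) / r) (\<lambda>x y w. F i x y w * G i x y w)"
      by (rule lip_bounded_mono) (use C(1) D(1) h in \<open>simp_all add: power_add mult_ac\<close>)
  qed (use C D in auto)
qed

lemma lip_order_weaken:
  assumes "lip_order I E k F" "m \<le> k"
  shows "lip_order I E m F"
proof -
  obtain C where C: "0 \<le> C"
    "\<And>i r. i \<in> I \<Longrightarrow> E i \<le> r \<Longrightarrow> 0 < r \<Longrightarrow> r \<le> 1 \<Longrightarrow> lip_bounded r (C * r ^ k) (C * r ^ k / r) (F i)"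
    using assms(1) by (rule lip_orderE) (rule that; assumption)
  show ?thesis
  proof (rule lip_orderI[OF C(1)])
    fix i r assume h: "i \<in> I" "E i \<le> r" "0 < r" "r \<le> 1"
    have le: "C * r ^ k \<le> C * r ^ m"
      using power_decreasing[OF assms(2), of r] h C(1) by (simp add: mult_left_mono)
    show "lip_bounded r (C * r ^ m) (C * r ^ m / r) (F i)"
      by (rule lip_bounded_mono[OF C(2)[OF h] le]) (use le h in \<open>simp add: divide_right_mono\<close>)
  qed
qed

lemma lip_order_uminus:
  assumes "lip_order I E m F" shows "lip_order I E m (\<lambda>i x y w. - F i x y w)"
proof -
  have "lip_order I E (0 + m) (\<lambda>i x y w. (- 1) * F i x y w)"
    by (rule lip_order_mult[OF lip_order_const assms])
  then show ?thesis by simp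
qed

lemma lip_order_diff:
  assumes "lip_order I E m F" "lip_order I E m G"
  shows "lip_order I E m (\<lambda>i x y w. F i x y w - G i x y w)"
  using lip_order_add[OF assms(1) lip_order_uminus[OF assms(2)]] by simp

section \<open>The first-order wave system and its normal form\<close>

locale nsp =
  fixes T \<mu> l nm :: real
  assumes T: "0 \<le> T" and mu: "0 < \<mu>" and l: "0 < l" and nm: "0 < nm"
begin

definition sound where "sound = sqrt (T + 1)"

text \<open>
  Linearized at \<open>(nm, nm, 0)\<close> with \<open>np = nm\<close>, the wave system is \<open>a' =
  c0 * e\<close>, \<open>e' = nm * p - c0 * e\<close>, \<open>p' = e / l\<^sup>2\<close> for the
  excess \<open>a\<close> of the density, the charge imbalance \<open>e = P - n\<close> and
  \<open>p\<close>. Its nonzero eigenvalues \<open>r1\<close> and \<open>r2\<close> solve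
  \<open>r\<^sup>2 + c0 * r = nm / l\<^sup>2\<close>.
\<close>

definition c0 where "c0 = nm / (\<mu> * sound)"

text \<open>
  The positive value of \<open>n (s - u)\<close> that the jump conditions allow; see
  \<open>rankine_hugoniot_facts\<close>.
\<close>

definition flux where "flux np = sound * sqrt (np * nm)"
definition disc where "disc = sqrt (c0\<^sup>2 + 4 * nm / l\<^sup>2)"
definition r1 where "r1 = (- c0 + disc) / 2"
definition r2 where "r2 = (- c0 - disc) / 2"

text \<open>The lower bound keeps the density at plus infinity away from vacuum.\<close>

definition near_states where "near_states = {nm / 2 ..< nm}"

text \<open>
  The remainders beyond the linear part in the equations for \<open>a\<close> and for
  \<open>e\<close>. The last summand of \<open>N1\<close> is linear, but its coefficient vanishes with
  the shock strength.
\<close>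

definition N1 where
  "N1 np a e p = 1 / (\<mu> * flux np) * ((T + 1) * (nm + a) * a * (a + (nm - np))
      + (2 * nm * a + a * a) * e - (nm + a) * (nm + a) * (l\<^sup>2 / 2) * (p * p))
      + (nm\<^sup>2 / (\<mu> * flux np) - c0) * e"
definition N2 where "N2 np a e p = (a + e) * p - N1 np a e p"

lemma sound: "0 < sound" "sound\<^sup>2 = T + 1" "sound * sound = T + 1" "1 \<le> sound"
  using T by (auto simp: sound_def)

lemma c0: "0 < c0" using mu nm sound by (simp add: c0_def)

lemma rates: "0 < r1" "r2 < 0" "r2 < r1" "r1 * r1 + c0 * r1 = nm / l\<^sup>2" "r2 * r2 + c0 * r2 = nm / l\<^sup>2"
proof -
  have d2: "disc\<^sup>2 = c0\<^sup>2 + 4 * nm / l\<^sup>2" unfolding disc_def using nm l by simp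
  have "c0\<^sup>2 < disc\<^sup>2" unfolding d2 using nm l by simp
  then have d: "c0 < disc" "0 \<le> disc"
    using power2_less_imp_less[of c0 disc] nm l by (auto simp: disc_def)
  then show "0 < r1" "r2 < 0" "r2 < r1" using c0 by (auto simp: r1_def r2_def)
  show "r1 * r1 + c0 * r1 = nm / l\<^sup>2" "r2 * r2 + c0 * r2 = nm / l\<^sup>2"
    using d2 by (simp_all add: r1_def r2_def field_simps power2_eq_square)
qed

lemma flux_bounds:
  assumes "np \<in> near_states"
  shows "sound * nm / 2 \<le> flux np" "0 < flux np" "flux np \<le> sound * nm" "(flux np)\<^sup>2 = (T + 1) * np * nm" "0 < np"
proof -
  have np: "nm / 2 \<le> np" "np < nm" using assms by (auto simp: near_states_def)
  show np0: "0 < np" using np nm by linarith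
  have "(nm / 2) * (nm / 2) \<le> np * nm" using np nm by (intro mult_mono) auto
  then have "nm / 2 \<le> sqrt (np * nm)" using nm by (intro real_le_rsqrt) (simp add: power2_eq_square)
  then show "sound * nm / 2 \<le> flux np" using sound by (simp add: flux_def)
  then show "0 < flux np" using sound nm by (smt (verit) divide_pos_pos mult_pos_pos)
  have "sqrt (np * nm) \<le> nm" using np nm by (intro real_le_lsqrt) (auto simp: power2_eq_square)
  then show "flux np \<le> sound * nm" using sound by (simp add: flux_def)
  show "(flux np)\<^sup>2 = (T + 1) * np * nm" using np0 nm sound by (simp add: flux_def power_mult_distrib)
qed

lemma flux_param_bounds:
  assumes "np \<in> near_states"
  shows "\<bar>1 / (\<mu> * flux np)\<bar> \<le> 2 / (\<mu> * sound * nm)"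
    and "\<bar>nm\<^sup>2 / (\<mu> * flux np) - c0\<bar> \<le> 2 / (\<mu> * sound) * (nm - np)"
proof -
  note flux = flux_bounds[OF assms]
  have np: "nm / 2 \<le> np" "np < nm" using assms by (auto simp: near_states_def)
  have "1 / (\<mu> * flux np) \<le> 1 / (\<mu> * (sound * nm / 2))"
    using flux mu nm sound by (intro divide_left_mono mult_left_mono) auto
  then show "\<bar>1 / (\<mu> * flux np)\<bar> \<le> 2 / (\<mu> * sound * nm)" using flux mu by (simp add: mult.assoc)
  have lo: "c0 \<le> nm\<^sup>2 / (\<mu> * flux np)"
  proof -
    have "nm\<^sup>2 / (\<mu> * (sound * nm)) \<le> nm\<^sup>2 / (\<mu> * flux np)"
      using flux mu nm sound by (intro divide_left_mono mult_left_mono) auto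
    then show ?thesis using nm by (simp add: c0_def power2_eq_square)
  qed
  have s: "np \<le> sqrt (np * nm)" using np flux(5) by (intro real_le_rsqrt) (simp add: power2_eq_square)
  have "nm\<^sup>2 / (\<mu> * flux np) \<le> nm\<^sup>2 / (\<mu> * (sound * np))"
    using s flux mu nm sound unfolding flux_def by (intro divide_left_mono mult_left_mono) auto
  also have "\<dots> = c0 + nm * (nm - np) / (\<mu> * sound * np)"
    using flux nm mu sound by (simp add: c0_def field_simps power2_eq_square)
  also have "nm * (nm - np) / (\<mu> * sound * np) \<le> nm * (nm - np) / (\<mu> * sound * (nm / 2))"
    using np flux nm mu sound by (intro divide_left_mono mult_left_mono) auto
  also have "\<dots> = 2 / (\<mu> * sound) * (nm - np)" using nm mu sound by (simp add: divide_simps)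
  finally show "\<bar>nm\<^sup>2 / (\<mu> * flux np) - c0\<bar> \<le> 2 / (\<mu> * sound) * (nm - np)" using lo by simp
qed

text \<open>
  Every monomial has two small factors among \<open>a\<close>, \<open>e\<close>, \<open>p\<close> and
  \<open>nm - np\<close>.
\<close>

lemma nonlinearity_order_2:
  "lip_order near_states (\<lambda>np. nm - np) 2 N1" "lip_order near_states (\<lambda>np. nm - np) 2 N2"
proof -
  let ?E = "\<lambda>np. nm - np"
  note c = lip_order_const[of near_states ?E] and x = lip_order_coord[of near_states ?E]
  note mul = lip_order_mult[of near_states ?E]
  have E: "0 \<le> ?E np" if "np \<in> near_states" for np using that by (simp add: near_states_def)
  have k: "lip_order near_states ?E 0 (\<lambda>np a e p. 1 / (\<mu> * flux np))"
    by (rule lip_order_param[of _ _ "2 / (\<mu> * sound * nm)"]) (use flux_param_bounds(1) E mu sound nm in auto)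
  have d: "lip_order near_states ?E 1 (\<lambda>np a e p. nm\<^sup>2 / (\<mu> * flux np) - c0)"
    by (rule lip_order_param[of _ _ "2 / (\<mu> * sound)"]) (use flux_param_bounds(2) E mu sound in auto)
  have eps: "lip_order near_states ?E 1 (\<lambda>np a e p. nm - np)"
    by (rule lip_order_param[of _ _ 1]) (use E in auto)
  have na: "lip_order near_states ?E 0 (\<lambda>np a e p. nm + a)"
    by (intro lip_order_add c lip_order_weaken[OF x(1)]) simp
  have t1: "lip_order near_states ?E 2 (\<lambda>np a e p. (T + 1) * (nm + a) * a * (a + (nm - np)))"
    using mul[OF mul[OF mul[OF c na] x(1)] lip_order_add[OF x(1) eps]] by (simp only: add_0 add_0_right one_add_one)
  have t2a: "lip_order near_states ?E 1 (\<lambda>np a e p. 2 * nm * a + a * a)"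
    using lip_order_add[OF mul[OF c x(1), of "2 * nm", unfolded add_0] lip_order_weaken[OF mul[OF x(1) x(1)], of 1]] by simp
  have t2: "lip_order near_states ?E 2 (\<lambda>np a e p. (2 * nm * a + a * a) * e)"
    using mul[OF t2a x(2)] by (simp only: add_0 add_0_right one_add_one)
  have t3: "lip_order near_states ?E 2 (\<lambda>np a e p. (nm + a) * (nm + a) * (l\<^sup>2 / 2) * (p * p))"
    using mul[OF mul[OF mul[OF na na] c] mul[OF x(3) x(3)]] by (simp only: add_0 add_0_right one_add_one)
  have t4: "lip_order near_states ?E 2 (\<lambda>np a e p. (nm\<^sup>2 / (\<mu> * flux np) - c0) * e)"
    using mul[OF d x(2)] by (simp only: add_0 add_0_right one_add_one)
  show n1: "lip_order near_states ?E 2 N1"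
    using lip_order_add[OF mul[OF k lip_order_diff[OF lip_order_add[OF t1 t2] t3], unfolded add_0] t4]
    unfolding N1_def[abs_def] .
  show "lip_order near_states ?E 2 N2"
    using lip_order_diff[OF mul[OF lip_order_add[OF x(1,2)] x(3), unfolded one_add_one] n1]
    unfolding N2_def[abs_def] .
qed

text \<open>
  One constant for all \<open>np\<close>: every later constant is built from it and has to be uniform
  in the shock strength.
\<close>

definition nonlin_const where
  "nonlin_const = (SOME C. 0 < C \<and> (\<forall>np\<in>near_states. \<forall>\<rho>. nm - np \<le> \<rho> \<longrightarrow> \<rho> \<le> 1 \<longrightarrow>
     lip_bounded \<rho> (C * \<rho>\<^sup>2) (C * \<rho>) (N1 np) \<and> lip_bounded \<rho> (C * \<rho>\<^sup>2) (C * \<rho>) (N2 np)))"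

lemma nonlin_const_props: "0 < nonlin_const \<and> (\<forall>np\<in>near_states. \<forall>\<rho>. nm - np \<le> \<rho> \<longrightarrow> \<rho> \<le> 1 \<longrightarrow>
     lip_bounded \<rho> (nonlin_const * \<rho>\<^sup>2) (nonlin_const * \<rho>) (N1 np) \<and> lip_bounded \<rho> (nonlin_const * \<rho>\<^sup>2) (nonlin_const * \<rho>) (N2 np))"
  unfolding nonlin_const_def
proof (rule someI_ex)
  obtain C where C: "0 \<le> C" "\<And>np r. np \<in> near_states \<Longrightarrow> nm - np \<le> r \<Longrightarrow> 0 < r \<Longrightarrow> r \<le> 1 \<Longrightarrow>
      lip_bounded r (C * r\<^sup>2) (C * r\<^sup>2 / r) (N1 np)"
    using nonlinearity_order_2(1) by (rule lip_orderE) (rule that; assumption)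
  obtain D where D: "0 \<le> D" "\<And>np r. np \<in> near_states \<Longrightarrow> nm - np \<le> r \<Longrightarrow> 0 < r \<Longrightarrow> r \<le> 1 \<Longrightarrow>
      lip_bounded r (D * r\<^sup>2) (D * r\<^sup>2 / r) (N2 np)"
    using nonlinearity_order_2(2) by (rule lip_orderE) (rule that; assumption)
  show "\<exists>C. 0 < C \<and> (\<forall>np\<in>near_states. \<forall>\<rho>. nm - np \<le> \<rho> \<longrightarrow> \<rho> \<le> 1 \<longrightarrow>
     lip_bounded \<rho> (C * \<rho>\<^sup>2) (C * \<rho>) (N1 np) \<and> lip_bounded \<rho> (C * \<rho>\<^sup>2) (C * \<rho>) (N2 np))"
  proof (intro exI[of _ "C + D + 1"] conjI ballI allI impI)
    show "0 < C + D + 1" using C(1) D(1) by simp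
    fix np \<rho> assume h: "np \<in> near_states" "nm - np \<le> \<rho>" "\<rho> \<le> 1"
    then have r: "0 < \<rho>" by (auto simp: near_states_def)
    have e: "K * \<rho>\<^sup>2 / \<rho> = K * \<rho>" for K using r by (simp add: power2_eq_square)
    show "lip_bounded \<rho> ((C + D + 1) * \<rho>\<^sup>2) ((C + D + 1) * \<rho>) (N1 np)"
      using C(1) D(1) r by (intro lip_bounded_mono[OF C(2)[OF h(1,2) r h(3), unfolded e]] mult_right_mono) auto
    show "lip_bounded \<rho> ((C + D + 1) * \<rho>\<^sup>2) ((C + D + 1) * \<rho>) (N2 np)"
      using C(1) D(1) r by (intro lip_bounded_mono[OF D(2)[OF h(1,2) r h(3), unfolded e]] mult_right_mono) auto
  qed
qed

lemma nonlin_const_pos: "0 < nonlin_const" by (rule nonlin_const_props[THEN conjunct1])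

lemma nonlin_const_bound:
  assumes "np \<in> near_states" "nm - np \<le> \<rho>" "\<rho> \<le> 1" "\<bar>a\<bar> \<le> \<rho>" "\<bar>e\<bar> \<le> \<rho>" "\<bar>p\<bar> \<le> \<rho>"
  shows "\<bar>N1 np a e p\<bar> \<le> nonlin_const * \<rho>\<^sup>2" "\<bar>N2 np a e p\<bar> \<le> nonlin_const * \<rho>\<^sup>2"
  by (rule lip_boundedD(1)[OF _ assms(4-6)];
      rule nonlin_const_props[THEN conjunct2, rule_format, OF assms(1-3), THEN conjunct1]
        nonlin_const_props[THEN conjunct2, rule_format, OF assms(1-3), THEN conjunct2])+

lemma nonlin_const_lip:
  assumes "np \<in> near_states" "nm - np \<le> \<rho>" "\<rho> \<le> 1" "\<bar>a\<bar> \<le> \<rho>" "\<bar>e\<bar> \<le> \<rho>" "\<bar>p\<bar> \<le> \<rho>"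
    "\<bar>a'\<bar> \<le> \<rho>" "\<bar>e'\<bar> \<le> \<rho>" "\<bar>p'\<bar> \<le> \<rho>"
  shows "\<bar>N1 np a e p - N1 np a' e' p'\<bar> \<le> nonlin_const * \<rho> * (\<bar>a - a'\<bar> + \<bar>e - e'\<bar> + \<bar>p - p'\<bar>)"
    "\<bar>N2 np a e p - N2 np a' e' p'\<bar> \<le> nonlin_const * \<rho> * (\<bar>a - a'\<bar> + \<bar>e - e'\<bar> + \<bar>p - p'\<bar>)"
  by (rule lip_boundedD(2)[OF _ assms(4-9)];
      rule nonlin_const_props[THEN conjunct2, rule_format, OF assms(1-3), THEN conjunct1]
        nonlin_const_props[THEN conjunct2, rule_format, OF assms(1-3), THEN conjunct2])+

text \<open>
  The integrated equations for the density \<open>n\<close>, for \<open>P = exp \<phi>\<close> and for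
  \<open>p = \<phi>'\<close>. Using \<open>P\<close> instead of \<open>\<phi>\<close> makes the system
  polynomial.
\<close>

definition wave_sys where
  "wave_sys np n P p \<longleftrightarrow> (\<forall>t.
     (n has_real_derivative (1 / (\<mu> * flux np)) * ((T + 1) * n t * (n t - nm) * (n t - np)
         + (n t)\<^sup>2 * (P t - n t) - l\<^sup>2 * (n t)\<^sup>2 * (p t)\<^sup>2 / 2)) (at t) \<and>
     (P has_real_derivative P t * p t) (at t) \<and>
     (p has_real_derivative (P t - n t) / l\<^sup>2) (at t))"

text \<open>
  The coordinates that diagonalize the linear part are \<open>z = a - c0 * l\<^sup>2 * p\<close> with
  rate \<open>0\<close> and \<open>e + l\<^sup>2 * (r + c0) * p\<close> with rate \<open>r\<close>,
  called \<open>g\<close> for \<open>r = r1\<close> and \<open>h\<close> for \<open>r = r2\<close>.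
  The inverse change of coordinates is \<open>p = psi g h\<close>, \<open>e = el g h\<close>, \<open>a
  = al z g h\<close>.
\<close>

definition psi where "psi g h = (g - h) / (l\<^sup>2 * (r1 - r2))"
definition el where "el g h = g - l\<^sup>2 * (r1 + c0) * psi g h"
definition al where "al z g h = z + c0 * l\<^sup>2 * psi g h"

definition normal_sys where
  "normal_sys np z g h \<longleftrightarrow> (\<forall>t.
     (z has_real_derivative N1 np (al (z t) (g t) (h t)) (el (g t) (h t)) (psi (g t) (h t))) (at t) \<and>
     (g has_real_derivative r1 * g t + N2 np (al (z t) (g t) (h t)) (el (g t) (h t)) (psi (g t) (h t))) (at t) \<and>
     (h has_real_derivative r2 * h t + N2 np (al (z t) (g t) (h t)) (el (g t) (h t)) (psi (g t) (h t))) (at t))"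

lemma coordinates_inverse:
  "psi (e + l\<^sup>2 * (r1 + c0) * p) (e + l\<^sup>2 * (r2 + c0) * p) = p"
  "el (e + l\<^sup>2 * (r1 + c0) * p) (e + l\<^sup>2 * (r2 + c0) * p) = e"
  "al (a - c0 * l\<^sup>2 * p) (e + l\<^sup>2 * (r1 + c0) * p) (e + l\<^sup>2 * (r2 + c0) * p) = a"
proof -
  have nz: "l\<^sup>2 * (r1 - r2) \<noteq> 0" using l rates by simp
  have "(e + l\<^sup>2 * (r1 + c0) * p) - (e + l\<^sup>2 * (r2 + c0) * p) = p * (l\<^sup>2 * (r1 - r2))"
    by (simp add: algebra_simps)
  then show 1: "psi (e + l\<^sup>2 * (r1 + c0) * p) (e + l\<^sup>2 * (r2 + c0) * p) = p"
    unfolding psi_def using nz by simp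
  show "el (e + l\<^sup>2 * (r1 + c0) * p) (e + l\<^sup>2 * (r2 + c0) * p) = e"
    "al (a - c0 * l\<^sup>2 * p) (e + l\<^sup>2 * (r1 + c0) * p) (e + l\<^sup>2 * (r2 + c0) * p) = a"
    unfolding el_def al_def 1 by simp_all
qed

lemma coordinates_inverse':
  "el g h + l\<^sup>2 * (r1 + c0) * psi g h = g" "el g h + l\<^sup>2 * (r2 + c0) * psi g h = h"
proof -
  have nz: "l\<^sup>2 * (r1 - r2) \<noteq> 0" using l rates by simp
  have "l\<^sup>2 * (r1 + c0) * psi g h - l\<^sup>2 * (r2 + c0) * psi g h = psi g h * (l\<^sup>2 * (r1 - r2))"
    by (simp add: algebra_simps)
  also have "\<dots> = g - h" unfolding psi_def using nz by simp
  finally show "el g h + l\<^sup>2 * (r1 + c0) * psi g h = g" "el g h + l\<^sup>2 * (r2 + c0) * psi g h = h"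
    unfolding el_def by linarith+
qed

lemma density_rhs:
  assumes "np \<in> near_states"
  shows "(1 / (\<mu> * flux np)) * ((T + 1) * n * (n - nm) * (n - np) + n\<^sup>2 * (P - n) - l\<^sup>2 * n\<^sup>2 * p\<^sup>2 / 2)
    = c0 * (P - n) + N1 np (n - nm) (P - n) p"
proof -
  define k where "k = 1 / (\<mu> * flux np)"
  have 1: "nm\<^sup>2 / (\<mu> * flux np) = nm\<^sup>2 * k" by (simp add: k_def)
  show ?thesis unfolding N1_def 1 k_def[symmetric] by (simp add: power2_eq_square algebra_simps)
qed

lemma wave_imp_normal:
  assumes w: "wave_sys np n P p" and np: "np \<in> near_states"
  shows "normal_sys np (\<lambda>t. (n t - nm) - c0 * l\<^sup>2 * p t) (\<lambda>t. (P t - n t) + l\<^sup>2 * (r1 + c0) * p t)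
     (\<lambda>t. (P t - n t) + l\<^sup>2 * (r2 + c0) * p t)"
proof -
  have l2: "l\<^sup>2 \<noteq> 0" using l by simp
  have n: "(n has_real_derivative c0 * (P t - n t) + N1 np (n t - nm) (P t - n t) (p t)) (at t)"
   and P: "(P has_real_derivative P t * p t) (at t)"
   and p: "(p has_real_derivative (P t - n t) / l\<^sup>2) (at t)" for t
    using w unfolding wave_sys_def density_rhs[OF np] by auto
  have r: "l\<^sup>2 * (r1 + c0) * r1 = nm" "l\<^sup>2 * (r2 + c0) * r2 = nm"
    using rates(4,5) l2 by (simp_all add: field_simps)
  have key: "((\<lambda>t. (P t - n t) + l\<^sup>2 * (r + c0) * p t) has_real_derivative
      r * ((P t - n t) + l\<^sup>2 * (r + c0) * p t) + N2 np (n t - nm) (P t - n t) (p t)) (at t)"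
    if "l\<^sup>2 * (r + c0) * r = nm" for r t
  proof -
    have "r * (l\<^sup>2 * (r + c0) * p t) = nm * p t" using that by (metis mult.commute mult.assoc)
    moreover have "l\<^sup>2 * (r + c0) * ((P t - n t) / l\<^sup>2) = (r + c0) * (P t - n t)" using l2 by simp
    ultimately have "P t * p t - (c0 * (P t - n t) + N1 np (n t - nm) (P t - n t) (p t)) + l\<^sup>2 * (r + c0) * ((P t - n t) / l\<^sup>2)
      = r * ((P t - n t) + l\<^sup>2 * (r + c0) * p t) + N2 np (n t - nm) (P t - n t) (p t)"
      unfolding N2_def distrib_left[of r] by (simp add: algebra_simps)
    moreover have "((\<lambda>t. (P t - n t) + l\<^sup>2 * (r + c0) * p t) has_real_derivative
      P t * p t - (c0 * (P t - n t) + N1 np (n t - nm) (P t - n t) (p t)) + l\<^sup>2 * (r + c0) * ((P t - n t) / l\<^sup>2)) (at t)"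
      by (auto intro!: derivative_eq_intros n P p)
    ultimately show ?thesis by simp
  qed
  show ?thesis unfolding normal_sys_def coordinates_inverse
    using key[OF r(1)] key[OF r(2)] l2 by (auto intro!: derivative_eq_intros n P p)
qed

lemma normal_imp_wave:
  assumes w: "normal_sys np z g h" and np: "np \<in> near_states"
  shows "wave_sys np (\<lambda>t. nm + al (z t) (g t) (h t)) (\<lambda>t. nm + al (z t) (g t) (h t) + el (g t) (h t))
    (\<lambda>t. psi (g t) (h t))"
proof -
  define a e p where "a = (\<lambda>t. al (z t) (g t) (h t))" and "e = (\<lambda>t. el (g t) (h t))" and "p = (\<lambda>t. psi (g t) (h t))"
  have l2: "l\<^sup>2 \<noteq> 0" using l by simp
  have nz: "l\<^sup>2 * (r1 - r2) \<noteq> 0" using l rates by simp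
  have gh: "g t = e t + l\<^sup>2 * (r1 + c0) * p t" "h t = e t + l\<^sup>2 * (r2 + c0) * p t" for t
    unfolding e_def p_def using coordinates_inverse' by simp_all
  have z: "(z has_real_derivative N1 np (a t) (e t) (p t)) (at t)"
   and g: "(g has_real_derivative r1 * g t + N2 np (a t) (e t) (p t)) (at t)"
   and h: "(h has_real_derivative r2 * h t + N2 np (a t) (e t) (p t)) (at t)" for t
    using w unfolding normal_sys_def a_def e_def p_def by blast+
  have r: "l\<^sup>2 * (r1 + c0) * r1 = nm" "l\<^sup>2 * (r2 + c0) * r2 = nm"
    using rates(4,5) l2 by (simp_all add: field_simps)
  have "r1 * g t - r2 * h t = (r1 - r2) * e t + (l\<^sup>2 * (r1 + c0) * r1 - l\<^sup>2 * (r2 + c0) * r2) * p t" for t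
    unfolding gh by (simp add: algebra_simps)
  then have gh': "r1 * g t - r2 * h t = (r1 - r2) * e t" for t unfolding r by simp
  have p': "(p has_real_derivative e t / l\<^sup>2) (at t)" for t
  proof -
    have "((\<lambda>t. (g t - h t) / (l\<^sup>2 * (r1 - r2))) has_real_derivative (r1 * g t - r2 * h t) / (l\<^sup>2 * (r1 - r2))) (at t)"
      by (rule DERIV_cong[OF DERIV_cdivide[OF DERIV_diff[OF g h]]]) simp
    then show ?thesis unfolding gh' p_def psi_def using l2 rates by simp
  qed
  have e': "(e has_real_derivative r1 * g t + N2 np (a t) (e t) (p t) - (r1 + c0) * e t) (at t)" for t
  proof -
    have "((\<lambda>t. g t - l\<^sup>2 * (r1 + c0) * p t) has_real_derivative r1 * g t + N2 np (a t) (e t) (p t) - l\<^sup>2 * (r1 + c0) * (e t / l\<^sup>2)) (at t)"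
      by (rule DERIV_cong[OF DERIV_diff[OF g DERIV_cmult[OF p']]]) simp
    then show ?thesis using l2 unfolding gh(1) by simp
  qed
  have a': "(a has_real_derivative c0 * e t + N1 np (a t) (e t) (p t)) (at t)" for t
  proof -
    have "((\<lambda>t. z t + c0 * l\<^sup>2 * p t) has_real_derivative N1 np (a t) (e t) (p t) + c0 * l\<^sup>2 * (e t / l\<^sup>2)) (at t)"
      by (rule DERIV_cong[OF DERIV_add[OF z DERIV_cmult[OF p']]]) simp
    then show ?thesis using l2 unfolding a_def al_def p_def by (simp add: add.commute)
  qed
  have rg: "r1 * g t = r1 * e t + nm * p t" for t
  proof -
    have "r1 * (l\<^sup>2 * (r1 + c0) * p t) = nm * p t" using r(1) by (metis mult.commute mult.assoc)
    then show ?thesis unfolding gh(1) distrib_left[of r1] by simp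
  qed
  have "((\<lambda>t. nm + a t + e t) has_real_derivative (nm + a t + e t) * p t) (at t)" for t
    by (auto intro!: derivative_eq_intros a' e' simp: rg N2_def) (simp add: algebra_simps)
  moreover have "((\<lambda>t. nm + a t) has_real_derivative c0 * e t + N1 np (a t) (e t) (p t)) (at t)" for t
    by (auto intro!: derivative_eq_intros a')
  ultimately show ?thesis
    unfolding wave_sys_def density_rhs[OF np] a_def[symmetric] e_def[symmetric] p_def[symmetric]
    using p' by (simp add: a_def e_def p_def)
qed

end

section \<open>Comparison of small solutions\<close>

text \<open>
  Turns a comparison of a solution with its translates into a comparison of derivatives at two
  different times.
\<close>

lemma deriv_abs_le_of_increments:
  fixes f k :: "real \<Rightarrow> real"
  assumes f: "(f has_real_derivative f') (at a)" and k: "(k has_real_derivative k') (at b)"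
    and le: "\<And>d. \<bar>f (a + d) - f a\<bar> \<le> B * \<bar>k (b + d) - k b\<bar>"
  shows "\<bar>f'\<bar> \<le> B * \<bar>k'\<bar>"
proof (rule tendsto_le)
  show "((\<lambda>d. \<bar>(f (a + d) - f a) / d\<bar>) \<longlongrightarrow> \<bar>f'\<bar>) (at 0)"
    using f unfolding DERIV_def by (rule tendsto_rabs)
  show "((\<lambda>d. B * \<bar>(k (b + d) - k b) / d\<bar>) \<longlongrightarrow> B * \<bar>k'\<bar>) (at 0)"
    using k unfolding DERIV_def by (intro tendsto_mult_left tendsto_rabs)
  show "\<forall>\<^sub>F d in at 0. \<bar>(f (a + d) - f a) / d\<bar> \<le> B * \<bar>(k (b + d) - k b) / d\<bar>"
    using le by (intro always_eventually) (simp add: abs_divide divide_right_mono)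
qed simp

lemma has_real_derivative_deriv:
  "(f has_real_derivative v) (at t) \<Longrightarrow> (f has_real_derivative deriv f t) (at t)"
  by (simp add: DERIV_imp_deriv)

context nsp
begin

definition psi_const where "psi_const = 1 / (l\<^sup>2 * (r1 - r2))"

text \<open>
  \<open>coord_const\<close> bounds the change of coordinates, so \<open>nonlin_const * \<rho> *
  coord_const\<close> is the Lipschitz constant of the nonlinear terms in \<open>(z, g, h)\<close> on
  the ball of radius \<open>\<rho>\<close>.
\<close>

definition coord_const where "coord_const = 1 + psi_const + l\<^sup>2 * (r1 + c0) * psi_const + c0 * l\<^sup>2 * psi_const"
definition gap where "gap = min r1 (- r2)"

text \<open>
  Small solutions are compared with the weight \<open>cosh (\<eta> * t)\<close>, \<open>\<eta> =
  growth_rate * \<rho>\<close>. With the factor \<open>12\<close> the Lipschitz constant is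
  \<open>\<eta> / 12\<close>, and \<open>max_radius\<close> ensures \<open>\<eta> \<le> gap /
  4\<close>. The three terms in the smallness condition are then at most \<open>1/12\<close>,
  \<open>1/36\<close> and \<open>1/36\<close>, together less than \<open>1/6\<close>.
\<close>

definition growth_rate where "growth_rate = 12 * nonlin_const * coord_const"
definition max_radius where "max_radius = min 1 (gap / (4 * growth_rate))"

lemma psi_const_pos: "0 < psi_const" using l rates by (simp add: psi_const_def)
lemma coord_const_ge_1: "1 \<le> coord_const"
proof -
  have "0 \<le> l\<^sup>2 * (r1 + c0) * psi_const" "0 \<le> c0 * l\<^sup>2 * psi_const" using psi_const_pos c0 rates by simp_all
  then show ?thesis using psi_const_pos unfolding coord_const_def by linarith
qed
lemma gap: "0 < gap" "gap \<le> \<bar>r1\<bar>" "gap \<le> \<bar>r2\<bar>" using rates by (auto simp: gap_def)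
lemma growth_rate_pos: "0 < growth_rate" using nonlin_const_pos coord_const_ge_1 by (simp add: growth_rate_def)
lemma max_radius: "0 < max_radius" "max_radius \<le> 1" "\<rho> \<le> max_radius \<Longrightarrow> growth_rate * \<rho> \<le> gap / 4"
proof -
  show "0 < max_radius" "max_radius \<le> 1" using gap growth_rate_pos by (auto simp: max_radius_def)
  assume "\<rho> \<le> max_radius"
  then have "\<rho> \<le> gap / (4 * growth_rate)" by (simp add: max_radius_def)
  then show "growth_rate * \<rho> \<le> gap / 4" using growth_rate_pos by (simp add: field_simps)
qed

lemma rate_sum_small:
  assumes "0 < \<rho>" "\<rho> \<le> max_radius"
  shows "0 < growth_rate * \<rho>" "growth_rate * \<rho> < \<bar>r1\<bar>" "growth_rate * \<rho> < \<bar>r2\<bar>" "0 \<le> nonlin_const * \<rho> * coord_const"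
    "nonlin_const * \<rho> * coord_const * (1 / (growth_rate * \<rho>) + 1 / (\<bar>r1\<bar> - growth_rate * \<rho>) + 1 / (\<bar>r2\<bar> - growth_rate * \<rho>)) \<le> 1/6"
    "nonlin_const * \<rho> * coord_const / (\<bar>r1\<bar> - growth_rate * \<rho>) \<le> growth_rate * \<rho> / (9 * gap)"
    "nonlin_const * \<rho> * coord_const / (\<bar>r2\<bar> - growth_rate * \<rho>) \<le> growth_rate * \<rho> / (9 * gap)"
proof -
  let ?e = "growth_rate * \<rho>"
  have q: "?e \<le> gap / 4" by (rule max_radius(3)[OF assms(2)])
  show 1: "0 < ?e" using growth_rate_pos assms by simp
  show "?e < \<bar>r1\<bar>" "?e < \<bar>r2\<bar>" using q gap by linarith+
  have L: "nonlin_const * \<rho> * coord_const = ?e / 12" by (simp add: growth_rate_def)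
  show "0 \<le> nonlin_const * \<rho> * coord_const" unfolding L using 1 by simp
  have d: "?e / 12 / (r - ?e) \<le> ?e / (9 * gap)" if "gap \<le> r" for r
  proof -
    have "?e / 12 / (r - ?e) \<le> ?e / 12 / (3/4 * gap)"
      using q gap that 1 by (intro divide_left_mono mult_pos_pos) auto
    also have "\<dots> = ?e / (9 * gap)" by simp
    finally show ?thesis .
  qed
  show a: "nonlin_const * \<rho> * coord_const / (\<bar>r1\<bar> - ?e) \<le> ?e / (9 * gap)" "nonlin_const * \<rho> * coord_const / (\<bar>r2\<bar> - ?e) \<le> ?e / (9 * gap)"
    unfolding L using d gap by blast+
  have "?e / (9 * gap) \<le> 1 / 36" using q gap by (simp add: field_simps)
  moreover have "?e / 12 * (1 / ?e) = 1 / 12" using growth_rate_pos assms by simp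
  ultimately show "nonlin_const * \<rho> * coord_const * (1 / ?e + 1 / (\<bar>r1\<bar> - ?e) + 1 / (\<bar>r2\<bar> - ?e)) \<le> 1/6"
    using a unfolding L distrib_left times_divide_eq_right mult_1_right by linarith
qed

lemma coordinates_linear:
  "psi g h - psi g' h' = psi (g - g') (h - h')"
  "el g h - el g' h' = el (g - g') (h - h')"
  "al z g h - al z' g' h' = al (z - z') (g - g') (h - h')"
proof -
  show p: "psi g h - psi g' h' = psi (g - g') (h - h')"
    unfolding psi_def diff_divide_distrib by simp
  show "el g h - el g' h' = el (g - g') (h - h')" "al z g h - al z' g' h' = al (z - z') (g - g') (h - h')"
    unfolding el_def al_def p[symmetric] by (simp_all add: algebra_simps)
qed

lemma coordinates_bound: "\<bar>al z g h\<bar> + \<bar>el g h\<bar> + \<bar>psi g h\<bar> \<le> coord_const * (\<bar>z\<bar> + \<bar>g\<bar> + \<bar>h\<bar>)"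
proof -
  have "\<bar>psi g h\<bar> = psi_const * \<bar>g - h\<bar>" unfolding psi_def psi_const_def using l rates by (simp add: abs_mult)
  also have "\<dots> \<le> psi_const * (\<bar>g\<bar> + \<bar>h\<bar>)" using psi_const_pos by (intro mult_left_mono) auto
  finally have p: "\<bar>psi g h\<bar> \<le> psi_const * (\<bar>g\<bar> + \<bar>h\<bar>)" .
  have q: "0 \<le> l\<^sup>2 * (r1 + c0)" "0 \<le> c0 * l\<^sup>2" using c0 rates by simp_all
  have qa: "\<bar>c * psi g h\<bar> = c * \<bar>psi g h\<bar>" if "0 \<le> c" for c
    using that by (simp add: abs_mult)
  have "\<bar>el g h\<bar> \<le> \<bar>g\<bar> + l\<^sup>2 * (r1 + c0) * \<bar>psi g h\<bar>"
    unfolding el_def using abs_triangle_ineq4[of g "l\<^sup>2 * (r1 + c0) * psi g h"] unfolding qa[OF q(1)] .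
  moreover have "\<bar>al z g h\<bar> \<le> \<bar>z\<bar> + c0 * l\<^sup>2 * \<bar>psi g h\<bar>"
    unfolding al_def using abs_triangle_ineq[of z "c0 * l\<^sup>2 * psi g h"] unfolding qa[OF q(2)] .
  moreover note mult_left_mono[OF p q(1)] mult_left_mono[OF p q(2)]
  ultimately have "\<bar>al z g h\<bar> + \<bar>el g h\<bar> + \<bar>psi g h\<bar> \<le> \<bar>z\<bar> + \<bar>g\<bar> + (psi_const + l\<^sup>2 * (r1 + c0) * psi_const + c0 * l\<^sup>2 * psi_const) * (\<bar>g\<bar> + \<bar>h\<bar>)"
    using p by (simp add: algebra_simps)
  also have "\<dots> \<le> \<bar>z\<bar> + \<bar>g\<bar> + \<bar>h\<bar> + (coord_const - 1) * (\<bar>z\<bar> + \<bar>g\<bar> + \<bar>h\<bar>)"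
  proof -
    have e: "psi_const + l\<^sup>2 * (r1 + c0) * psi_const + c0 * l\<^sup>2 * psi_const = coord_const - 1" by (simp add: coord_const_def)
    have "(coord_const - 1) * (\<bar>g\<bar> + \<bar>h\<bar>) \<le> (coord_const - 1) * (\<bar>z\<bar> + \<bar>g\<bar> + \<bar>h\<bar>)"
      using coord_const_ge_1 by (intro mult_left_mono) auto
    then show ?thesis unfolding e by linarith
  qed
  finally show ?thesis by (simp add: algebra_simps)
qed

text \<open>Smallness is measured in the physical unknowns, in which the nonlinear terms are given.\<close>

definition ball where
  "ball \<rho> z g h \<longleftrightarrow> (\<forall>t. \<bar>al (z t) (g t) (h t)\<bar> \<le> \<rho> \<and> \<bar>el (g t) (h t)\<bar> \<le> \<rho> \<and> \<bar>psi (g t) (h t)\<bar> \<le> \<rho>)"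

lemma normal_sys_shift: "normal_sys np z g h \<Longrightarrow> normal_sys np (\<lambda>t. z (t + s)) (\<lambda>t. g (t + s)) (\<lambda>t. h (t + s))"
  unfolding normal_sys_def DERIV_shift[symmetric] by blast

lemma ball_shift: "ball \<rho> z g h \<Longrightarrow> ball \<rho> (\<lambda>t. z (t + s)) (\<lambda>t. g (t + s)) (\<lambda>t. h (t + s))"
  unfolding ball_def by blast

lemma ball_coordinates:
  assumes "ball \<rho> z g h"
  obtains B where "\<And>t. \<bar>z t\<bar> + \<bar>g t\<bar> + \<bar>h t\<bar> \<le> B"
proof (rule that)
  fix t
  have b: "\<bar>al (z t) (g t) (h t)\<bar> \<le> \<rho>" "\<bar>el (g t) (h t)\<bar> \<le> \<rho>" "\<bar>psi (g t) (h t)\<bar> \<le> \<rho>"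
    using assms by (auto simp: ball_def)
  have m: "\<bar>k * psi (g t) (h t)\<bar> \<le> \<bar>k\<bar> * \<rho>" for k
    unfolding abs_mult by (intro mult_left_mono b) auto
  have 1: "z t = al (z t) (g t) (h t) - c0 * l\<^sup>2 * psi (g t) (h t)" by (simp add: al_def)
  have "\<bar>z t\<bar> \<le> \<rho> + \<bar>c0 * l\<^sup>2\<bar> * \<rho>" using m[of "c0 * l\<^sup>2"] b(1) by (subst 1) linarith
  moreover have "\<bar>g t\<bar> \<le> \<rho> + \<bar>l\<^sup>2 * (r1 + c0)\<bar> * \<rho>"
    using m[of "l\<^sup>2 * (r1 + c0)"] b(2) coordinates_inverse'(1)[of "g t" "h t"] by linarith
  moreover have "\<bar>h t\<bar> \<le> \<rho> + \<bar>l\<^sup>2 * (r2 + c0)\<bar> * \<rho>"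
    using m[of "l\<^sup>2 * (r2 + c0)"] b(2) coordinates_inverse'(2)[of "g t" "h t"] by linarith
  ultimately show "\<bar>z t\<bar> + \<bar>g t\<bar> + \<bar>h t\<bar> \<le> (\<rho> + \<bar>c0 * l\<^sup>2\<bar> * \<rho>) + (\<rho> + \<bar>l\<^sup>2 * (r1 + c0)\<bar> * \<rho>) + (\<rho> + \<bar>l\<^sup>2 * (r2 + c0)\<bar> * \<rho>)"
    by linarith
qed

text \<open>
  A solution that stays small for all times is determined by its central coordinate at time
  \<open>0\<close>, with a Lipschitz estimate: the difference of two such solutions is bounded, and
  \<open>center_saddle_bound\<close> applies to it. The hyperbolic components of the difference are
  smaller by a factor \<open>\<rho>\<close>.
\<close>

lemma small_solutions_compare:
  assumes np: "np \<in> near_states" "nm - np \<le> \<rho>" "\<rho> \<le> max_radius"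
    and X: "normal_sys np z g h" "ball \<rho> z g h" and X': "normal_sys np z' g' h'" "ball \<rho> z' g' h'"
  shows "\<bar>z t - z' t\<bar> + \<bar>g t - g' t\<bar> + \<bar>h t - h' t\<bar> \<le> 2 * \<bar>z 0 - z' 0\<bar> * cosh (growth_rate * \<rho> * t)"
    "\<bar>g t - g' t\<bar> \<le> growth_rate * \<rho> / gap * \<bar>z 0 - z' 0\<bar> * cosh (growth_rate * \<rho> * t)"
    "\<bar>h t - h' t\<bar> \<le> growth_rate * \<rho> / gap * \<bar>z 0 - z' 0\<bar> * cosh (growth_rate * \<rho> * t)"
proof -
  have \<rho>: "0 < \<rho>" using np(1,2) by (auto simp: near_states_def)
  note small = rate_sum_small[OF \<rho> np(3)]
  define F1 where "F1 = (\<lambda>z g h (t::real). N1 np (al (z t) (g t) (h t)) (el (g t) (h t)) (psi (g t) (h t)))"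
  define F2 where "F2 = (\<lambda>z g h (t::real). N2 np (al (z t) (g t) (h t)) (el (g t) (h t)) (psi (g t) (h t)))"
  define S where "S = (\<lambda>t. \<bar>z t - z' t\<bar> + \<bar>g t - g' t\<bar> + \<bar>h t - h' t\<bar>)"
  obtain B where B: "\<And>t. \<bar>z t\<bar> + \<bar>g t\<bar> + \<bar>h t\<bar> \<le> B" using ball_coordinates[OF X(2)] by blast
  obtain B' where B': "\<And>t. \<bar>z' t\<bar> + \<bar>g' t\<bar> + \<bar>h' t\<bar> \<le> B'" using ball_coordinates[OF X'(2)] by blast
  have F: "\<bar>F1 z g h t - F1 z' g' h' t\<bar> \<le> nonlin_const * \<rho> * coord_const * S t" "\<bar>F2 z g h t - F2 z' g' h' t\<bar> \<le> nonlin_const * \<rho> * coord_const * S t" for t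
  proof -
    let ?d = "\<bar>al (z t) (g t) (h t) - al (z' t) (g' t) (h' t)\<bar> + \<bar>el (g t) (h t) - el (g' t) (h' t)\<bar>
        + \<bar>psi (g t) (h t) - psi (g' t) (h' t)\<bar>"
    have "?d \<le> coord_const * S t" unfolding coordinates_linear S_def by (rule coordinates_bound)
    from mult_left_mono[OF this, of "nonlin_const * \<rho>"] have d: "nonlin_const * \<rho> * ?d \<le> nonlin_const * \<rho> * coord_const * S t"
      using nonlin_const_pos \<rho> by (simp add: mult.assoc)
    have "\<rho> \<le> 1" using np(3) max_radius(2) by linarith
    then show "\<bar>F1 z g h t - F1 z' g' h' t\<bar> \<le> nonlin_const * \<rho> * coord_const * S t" "\<bar>F2 z g h t - F2 z' g' h' t\<bar> \<le> nonlin_const * \<rho> * coord_const * S t"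
      unfolding F1_def F2_def using X(2) X'(2) unfolding ball_def
      by (intro order_trans[OF nonlin_const_lip(1)[OF np(1,2)] d] order_trans[OF nonlin_const_lip(2)[OF np(1,2)] d]; blast)+
  qed
  have D1: "((\<lambda>t. z t - z' t) has_real_derivative F1 z g h t - F1 z' g' h' t) (at t)" for t
    unfolding F1_def by (intro DERIV_diff; use X(1) X'(1) in \<open>unfold normal_sys_def, blast\<close>)
  have D2: "((\<lambda>t. g t - g' t) has_real_derivative r1 * (g t - g' t) + (F2 z g h t - F2 z' g' h' t)) (at t)" for t
  proof -
    have "((\<lambda>t. g t - g' t) has_real_derivative (r1 * g t + F2 z g h t) - (r1 * g' t + F2 z' g' h' t)) (at t)"
      unfolding F2_def by (intro DERIV_diff; use X(1) X'(1) in \<open>unfold normal_sys_def, blast\<close>)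
    then show ?thesis by (simp add: algebra_simps)
  qed
  have D3: "((\<lambda>t. h t - h' t) has_real_derivative r2 * (h t - h' t) + (F2 z g h t - F2 z' g' h' t)) (at t)" for t
  proof -
    have "((\<lambda>t. h t - h' t) has_real_derivative (r2 * h t + F2 z g h t) - (r2 * h' t + F2 z' g' h' t)) (at t)"
      unfolding F2_def by (intro DERIV_diff; use X(1) X'(1) in \<open>unfold normal_sys_def, blast\<close>)
    then show ?thesis by (simp add: algebra_simps)
  qed
  have SB: "S t \<le> (B + B') * cosh (growth_rate * \<rho> * t)" for t
  proof -
    have "S t \<le> B + B'" unfolding S_def using B[of t] B'[of t] by linarith
    also have "\<dots> \<le> (B + B') * cosh (growth_rate * \<rho> * t)"
      by (rule le_mult_cosh) (use B[of 0] B'[of 0] in linarith)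
    finally show ?thesis .
  qed
  have half: "nonlin_const * \<rho> * coord_const * (1 / (growth_rate * \<rho>) + 1 / (\<bar>r1\<bar> - growth_rate * \<rho>) + 1 / (\<bar>r2\<bar> - growth_rate * \<rho>)) \<le> 1/2"
    using small(5) by linarith
  note csb = center_saddle_bound[OF D1 D2 D3, OF F(1)[unfolded S_def] F(2)[unfolded S_def] F(2)[unfolded S_def] SB[unfolded S_def] small(1-4) half]
  show "\<bar>z t - z' t\<bar> + \<bar>g t - g' t\<bar> + \<bar>h t - h' t\<bar> \<le> 2 * \<bar>z 0 - z' 0\<bar> * cosh (growth_rate * \<rho> * t)"
    using csb(1)[of t] .
  have fin: "nonlin_const * \<rho> * coord_const * (2 * \<bar>z 0 - z' 0\<bar>) / r * cosh (growth_rate * \<rho> * t) \<le> growth_rate * \<rho> / gap * \<bar>z 0 - z' 0\<bar> * cosh (growth_rate * \<rho> * t)"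
    if "nonlin_const * \<rho> * coord_const / r \<le> growth_rate * \<rho> / (9 * gap)" for r
  proof -
    have "0 \<le> growth_rate * \<rho> / gap" using small(1) gap by simp
    then have "2 * (nonlin_const * \<rho> * coord_const / r) \<le> growth_rate * \<rho> / gap" using that by (simp add: field_simps)
    then have "2 * (nonlin_const * \<rho> * coord_const / r) * \<bar>z 0 - z' 0\<bar> * cosh (growth_rate * \<rho> * t) \<le> growth_rate * \<rho> / gap * \<bar>z 0 - z' 0\<bar> * cosh (growth_rate * \<rho> * t)"
      by (intro mult_right_mono) auto
    then show ?thesis by (simp add: algebra_simps)
  qed
  show "\<bar>g t - g' t\<bar> \<le> growth_rate * \<rho> / gap * \<bar>z 0 - z' 0\<bar> * cosh (growth_rate * \<rho> * t)"
    by (rule order_trans[OF csb(2) fin[OF small(6)]])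
  show "\<bar>h t - h' t\<bar> \<le> growth_rate * \<rho> / gap * \<bar>z 0 - z' 0\<bar> * cosh (growth_rate * \<rho> * t)"
    by (rule order_trans[OF csb(3) fin[OF small(7)]])
qed

text \<open>
  The system is autonomous, so a small solution may be compared with its own translates. Dividing by
  the translation shows that \<open>z'\<close> changes at most by a fixed factor over times of order
  \<open>1 / \<rho>\<close>, and that the hyperbolic components are slaved to \<open>z\<close>.
\<close>

lemma harnack:
  assumes np: "np \<in> near_states" "nm - np \<le> \<rho>" "\<rho> \<le> max_radius"
    and X: "normal_sys np z g h" "ball \<rho> z g h"
  shows "\<bar>deriv z s\<bar> \<le> 2 * \<bar>deriv z t\<bar> * cosh (growth_rate * \<rho> * (s - t))"
    "\<bar>deriv g t\<bar> \<le> growth_rate * \<rho> / gap * \<bar>deriv z t\<bar>"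
    "\<bar>deriv h t\<bar> \<le> growth_rate * \<rho> / gap * \<bar>deriv z t\<bar>"
proof -
  have D: "(z has_real_derivative deriv z t) (at t)" "(g has_real_derivative deriv g t) (at t)"
    "(h has_real_derivative deriv h t) (at t)" for t
    using X(1) unfolding normal_sys_def by (blast intro: has_real_derivative_deriv)+
  have c: "\<bar>z (r + t + d) - z (r + t)\<bar> + \<bar>g (r + t + d) - g (r + t)\<bar> + \<bar>h (r + t + d) - h (r + t)\<bar>
       \<le> 2 * \<bar>z (t + d) - z t\<bar> * cosh (growth_rate * \<rho> * r)"
    "\<bar>g (r + t + d) - g (r + t)\<bar> \<le> growth_rate * \<rho> / gap * \<bar>z (t + d) - z t\<bar> * cosh (growth_rate * \<rho> * r)"
    "\<bar>h (r + t + d) - h (r + t)\<bar> \<le> growth_rate * \<rho> / gap * \<bar>z (t + d) - z t\<bar> * cosh (growth_rate * \<rho> * r)" for r d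
    using small_solutions_compare[OF np normal_sys_shift[OF X(1), of "t + d"] ball_shift[OF X(2), of "t + d"]
      normal_sys_shift[OF X(1), of t] ball_shift[OF X(2), of t], of r] by (simp_all add: add.assoc)
  have "\<bar>deriv z s\<bar> \<le> (2 * cosh (growth_rate * \<rho> * (s - t))) * \<bar>deriv z t\<bar>"
  proof (rule deriv_abs_le_of_increments[OF D(1) D(1)])
    fix d
    have "\<bar>z (s - t + t + d) - z (s - t + t)\<bar> \<le> 2 * \<bar>z (t + d) - z t\<bar> * cosh (growth_rate * \<rho> * (s - t))"
      using c(1)[of "s - t" d] by linarith
    then show "\<bar>z (s + d) - z s\<bar> \<le> 2 * cosh (growth_rate * \<rho> * (s - t)) * \<bar>z (t + d) - z t\<bar>"
      by (simp add: mult.commute mult.left_commute)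
  qed
  then show "\<bar>deriv z s\<bar> \<le> 2 * \<bar>deriv z t\<bar> * cosh (growth_rate * \<rho> * (s - t))" by (simp add: algebra_simps)
  show "\<bar>deriv g t\<bar> \<le> growth_rate * \<rho> / gap * \<bar>deriv z t\<bar>"
    by (rule deriv_abs_le_of_increments[OF D(2) D(1)]) (use c(2)[of 0] in simp)
  show "\<bar>deriv h t\<bar> \<le> growth_rate * \<rho> / gap * \<bar>deriv z t\<bar>"
    by (rule deriv_abs_le_of_increments[OF D(3) D(1)]) (use c(3)[of 0] in simp)
qed

end

section \<open>Existence of a small profile\<close>

lemma intermediate_value:
  fixes f :: "real \<Rightarrow> real"
  assumes "\<And>t. isCont f t" "f a \<le> c" "c \<le> f b"
  obtains x where "f x = c"
proof (cases "a \<le> b")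
  case True
  then show ?thesis using IVT[of f a c b] assms that by blast
next
  case False
  then show ?thesis using IVT2[of f a c b] assms that by auto
qed

context nsp
begin

text \<open>The two far fields are rest points.\<close>

lemma nonlinearity_zero: "N1 np 0 0 0 = 0" "N2 np 0 0 0 = 0"
  "N1 np (- (nm - np)) 0 0 = 0" "N2 np (- (nm - np)) 0 0 = 0"
  by (simp_all add: N1_def N2_def)

text \<open>
  The Lyapunov-Perron problem needs globally Lipschitz terms, so the arguments of the nonlinear terms
  are clamped to \<open>[-R, R]\<close>. The resulting solution starts midway between the rest points
  \<open>z = 0\<close> and \<open>z = - \<epsilon>\<close> and can never reach either of those values,
  because the comparison estimate, applied from the time of contact, would make it that rest point.
  Hence \<open>|z| \<le> \<epsilon>\<close>, and the hyperbolic components inherit this size from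
  their equations; in particular the clamping is never active.
\<close>

lemma small_profile_exists:
  assumes np: "np \<in> near_states" "nm - np \<le> max_radius / (2 * coord_const)"
  obtains z g h where "normal_sys np z g h" "z 0 = - (nm - np) / 2"
    "\<And>t. - (nm - np) < z t" "\<And>t. z t < 0" "ball (2 * coord_const * (nm - np)) z g h"
proof -
  define R where "R = max_radius"
  define \<epsilon> where "\<epsilon> = nm - np"
  define cl where "cl = (\<lambda>x. max (- R) (min R x))"
  have R: "0 < R" "R \<le> 1" "R \<le> max_radius" using max_radius by (auto simp: R_def)
  have \<epsilon>: "0 < \<epsilon>" using np by (auto simp: near_states_def \<epsilon>_def)
  have K\<epsilon>: "coord_const * \<epsilon> \<le> R / 2" using np(2) coord_const_ge_1 by (simp add: \<epsilon>_def R_def field_simps)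
  have "1 * \<epsilon> \<le> coord_const * \<epsilon>" using coord_const_ge_1 \<epsilon> by (intro mult_right_mono) auto
  then have \<epsilon>R: "\<epsilon> \<le> R" "nm - np \<le> R" using K\<epsilon> R by (auto simp: \<epsilon>_def)
  have cl: "\<bar>cl x\<bar> \<le> R" "\<bar>cl x - cl y\<bar> \<le> \<bar>x - y\<bar>" "\<bar>x\<bar> \<le> R \<Longrightarrow> cl x = x" for x y
    using R by (auto simp: cl_def)
  define f0 where "f0 = (\<lambda>z g h. N1 np (cl (al z g h)) (cl (el g h)) (cl (psi g h)))"
  define f where "f = (\<lambda>z g h. N2 np (cl (al z g h)) (cl (el g h)) (cl (psi g h)))"
  define L where "L = nonlin_const * R * coord_const"
  note small = rate_sum_small[OF R(1,3), folded L_def]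
  have lips: "\<bar>f0 x y w - f0 x' y' w'\<bar> \<le> L * (\<bar>x - x'\<bar> + \<bar>y - y'\<bar> + \<bar>w - w'\<bar>)"
     "\<bar>f x y w - f x' y' w'\<bar> \<le> L * (\<bar>x - x'\<bar> + \<bar>y - y'\<bar> + \<bar>w - w'\<bar>)" for x y w x' y' w'
  proof -
    let ?d = "\<bar>cl (al x y w) - cl (al x' y' w')\<bar> + \<bar>cl (el y w) - cl (el y' w')\<bar> + \<bar>cl (psi y w) - cl (psi y' w')\<bar>"
    have "?d \<le> \<bar>al x y w - al x' y' w'\<bar> + \<bar>el y w - el y' w'\<bar> + \<bar>psi y w - psi y' w'\<bar>"
      by (intro add_mono cl(2))
    also have "\<dots> \<le> coord_const * (\<bar>x - x'\<bar> + \<bar>y - y'\<bar> + \<bar>w - w'\<bar>)"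
      unfolding coordinates_linear by (rule coordinates_bound)
    finally have d: "nonlin_const * R * ?d \<le> L * (\<bar>x - x'\<bar> + \<bar>y - y'\<bar> + \<bar>w - w'\<bar>)"
      unfolding L_def mult.assoc using nonlin_const_pos R by (intro mult_left_mono) auto
    show "\<bar>f0 x y w - f0 x' y' w'\<bar> \<le> L * (\<bar>x - x'\<bar> + \<bar>y - y'\<bar> + \<bar>w - w'\<bar>)"
      unfolding f0_def by (rule order_trans[OF nonlin_const_lip(1)[OF np(1) \<epsilon>R(2) R(2) cl(1) cl(1) cl(1) cl(1) cl(1) cl(1)] d])
    show "\<bar>f x y w - f x' y' w'\<bar> \<le> L * (\<bar>x - x'\<bar> + \<bar>y - y'\<bar> + \<bar>w - w'\<bar>)"
      unfolding f_def by (rule order_trans[OF nonlin_const_lip(2)[OF np(1) \<epsilon>R(2) R(2) cl(1) cl(1) cl(1) cl(1) cl(1) cl(1)] d])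
  qed
  have bnd: "\<bar>f0 x y w\<bar> \<le> nonlin_const * R\<^sup>2" "\<bar>f x y w\<bar> \<le> nonlin_const * R\<^sup>2" for x y w
    unfolding f0_def f_def using nonlin_const_bound[OF np(1) \<epsilon>R(2) R(2) cl(1) cl(1) cl(1)] by auto
  obtain z g h where z0: "z 0 = - \<epsilon> / 2"
    and z: "\<And>t. (z has_real_derivative f0 (z t) (g t) (h t)) (at t)"
    and g: "\<And>t. (g has_real_derivative r1 * g t + f (z t) (g t) (h t)) (at t)"
    and h: "\<And>t. (h has_real_derivative r2 * h t + f (z t) (g t) (h t)) (at t)"
    and gb: "\<And>t. \<bar>g t\<bar> \<le> nonlin_const * R\<^sup>2 / \<bar>r1\<bar>" and hb: "\<And>t. \<bar>h t\<bar> \<le> nonlin_const * R\<^sup>2 / \<bar>r2\<bar>"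
    using lyapunov_perron[OF lips(1) lips(2) bnd small(1-5), of "- \<epsilon> / 2"] by blast
  \<comment> \<open>equilibria are never reached\<close>
  have avoid: "z t0 \<noteq> w" if w: "w = 0 \<or> w = - \<epsilon>" for t0 w
  proof
    assume hit: "z t0 = w"
    have zero: "f0 w 0 0 = 0" "f w 0 0 = 0"
      using w cl(3)[of 0] cl(3)[of "- \<epsilon>"] R \<epsilon>R \<epsilon> nonlinearity_zero
      unfolding f0_def f_def al_def el_def psi_def \<epsilon>_def by auto
    define m0 where "m0 = (\<lambda>t. f0 (z (t + t0)) (g (t + t0)) (h (t + t0)))"
    define m1 where "m1 = (\<lambda>t. f (z (t + t0)) (g (t + t0)) (h (t + t0)))"
    define S where "S = (\<lambda>t. \<bar>z (t + t0) - w\<bar> + \<bar>g (t + t0)\<bar> + \<bar>h (t + t0)\<bar>)"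
    have m: "\<bar>m0 t\<bar> \<le> L * S t" "\<bar>m1 t\<bar> \<le> L * S t" for t
      using lips(1)[of "z (t + t0)" "g (t + t0)" "h (t + t0)" w 0 0]
        lips(2)[of "z (t + t0)" "g (t + t0)" "h (t + t0)" w 0 0] zero
      by (simp_all add: m0_def m1_def S_def)
    have Z: "((\<lambda>t. z (t + t0) - w) has_real_derivative m0 t) (at t)" for t
      unfolding m0_def using DERIV_diff[OF z[of "t + t0", unfolded DERIV_shift] DERIV_const] by simp
    have G: "((\<lambda>t. g (t + t0)) has_real_derivative r1 * g (t + t0) + m1 t) (at t)" for t
      unfolding m1_def using g[of "t + t0", unfolded DERIV_shift] .
    have H: "((\<lambda>t. h (t + t0)) has_real_derivative r2 * h (t + t0) + m1 t) (at t)" for t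
      unfolding m1_def using h[of "t + t0", unfolded DERIV_shift] .
    have B0: "0 \<le> nonlin_const * R\<^sup>2" using nonlin_const_pos by simp
    have mb: "\<bar>m0 t\<bar> \<le> nonlin_const * R\<^sup>2 * cosh (growth_rate * R * t)" for t
      unfolding m0_def by (rule order_trans[OF bnd(1) le_mult_cosh[OF B0]])
    have Zb: "\<bar>z (t + t0) - w\<bar> \<le> nonlin_const * R\<^sup>2 / (growth_rate * R) * cosh (growth_rate * R * t)" for t
      using central_bound[OF Z mb small(1), of t] hit by simp
    have Sb: "S t \<le> (nonlin_const * R\<^sup>2 / (growth_rate * R) + nonlin_const * R\<^sup>2 / \<bar>r1\<bar> + nonlin_const * R\<^sup>2 / \<bar>r2\<bar>) * cosh (growth_rate * R * t)" for t
    proof -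
      have "\<bar>g (t + t0)\<bar> \<le> nonlin_const * R\<^sup>2 / \<bar>r1\<bar> * cosh (growth_rate * R * t)"
        by (rule order_trans[OF gb le_mult_cosh]) (use B0 in simp)
      moreover have "\<bar>h (t + t0)\<bar> \<le> nonlin_const * R\<^sup>2 / \<bar>r2\<bar> * cosh (growth_rate * R * t)"
        by (rule order_trans[OF hb le_mult_cosh]) (use B0 in simp)
      ultimately show ?thesis using Zb[of t] unfolding S_def distrib_right by linarith
    qed
    have half: "L * (1 / (growth_rate * R) + 1 / (\<bar>r1\<bar> - growth_rate * R) + 1 / (\<bar>r2\<bar> - growth_rate * R)) \<le> 1/2"
      using small(5) by linarith
    have "S (- t0) \<le> 2 * \<bar>z (0 + t0) - w\<bar> * cosh (growth_rate * R * - t0)"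
      unfolding S_def by (rule center_saddle_bound(1)[OF Z G H m(1)[unfolded S_def] m(2)[unfolded S_def] m(2)[unfolded S_def]
          Sb[unfolded S_def] small(1-4) half])
    then have "z 0 = w" using hit unfolding S_def by simp
    then show False using z0 w \<epsilon> by auto
  qed
  have zc: "isCont z t" for t using z DERIV_isCont by blast
  have up: "z t < 0" for t
  proof (rule ccontr)
    assume "\<not> z t < 0"
    then obtain x where "z x = 0" using intermediate_value[of z 0 0 t, OF zc] z0 \<epsilon> by auto
    then show False using avoid by blast
  qed
  have low: "- \<epsilon> < z t" for t
  proof (rule ccontr)
    assume "\<not> - \<epsilon> < z t"
    then obtain x where "z x = - \<epsilon>" using intermediate_value[of z t "- \<epsilon>" 0, OF zc] z0 \<epsilon> by auto
    then show False using avoid by blast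
  qed
  have LR: "L / gap \<le> 1 / 48"
    using max_radius(3)[OF R(3)] gap by (simp add: L_def growth_rate_def field_simps)
  have ghR: "\<bar>g t\<bar> + \<bar>h t\<bar> \<le> 2 * (nonlin_const * R\<^sup>2 / gap)" for t
  proof -
    have "nonlin_const * R\<^sup>2 / \<bar>r1\<bar> \<le> nonlin_const * R\<^sup>2 / gap" "nonlin_const * R\<^sup>2 / \<bar>r2\<bar> \<le> nonlin_const * R\<^sup>2 / gap"
      using gap nonlin_const_pos by (intro divide_left_mono mult_pos_pos; auto)+
    then show ?thesis using gb[of t] hb[of t] by linarith
  qed
  have inR: "\<bar>al (z t) (g t) (h t)\<bar> \<le> R \<and> \<bar>el (g t) (h t)\<bar> \<le> R \<and> \<bar>psi (g t) (h t)\<bar> \<le> R" for t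
  proof -
    have "\<bar>z t\<bar> \<le> \<epsilon>" using up[of t] low[of t] by linarith
    then have "coord_const * (\<bar>z t\<bar> + \<bar>g t\<bar> + \<bar>h t\<bar>) \<le> coord_const * (\<epsilon> + 2 * (nonlin_const * R\<^sup>2 / gap))"
      using ghR[of t] coord_const_ge_1 by (intro mult_left_mono) auto
    also have "\<dots> = coord_const * \<epsilon> + 2 * R * (L / gap)" by (simp add: L_def power2_eq_square algebra_simps)
    also have "\<dots> \<le> R / 2 + 2 * R * (1 / 48)" using K\<epsilon> LR R by (intro add_mono mult_left_mono) auto
    also have "\<dots> \<le> R" using R by simp
    finally show ?thesis using coordinates_bound[of "z t" "g t" "h t"] by linarith
  qed
  then have id: "cl (al (z t) (g t) (h t)) = al (z t) (g t) (h t)" "cl (el (g t) (h t)) = el (g t) (h t)"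
     "cl (psi (g t) (h t)) = psi (g t) (h t)" for t using cl(3) by blast+
  have sys: "normal_sys np z g h"
    unfolding normal_sys_def using z g h unfolding f0_def f_def id by blast
  \<comment> \<open>bounded solutions of the hyperbolic equations shrink their own bound, up to a multiple of eps\<close>
  have improve: "\<bar>g t\<bar> + \<bar>h t\<bar> \<le> (\<epsilon> + B) / 24" if B: "\<And>t. \<bar>g t\<bar> + \<bar>h t\<bar> \<le> B" for B t
  proof -
    have B0: "0 \<le> B" using B[of 0] by linarith
    have F: "\<bar>f (z t) (g t) (h t)\<bar> \<le> L * (\<epsilon> + B) * cosh (0 * t)" for t
    proof -
      have "\<bar>f (z t) (g t) (h t)\<bar> \<le> L * (\<bar>z t\<bar> + \<bar>g t\<bar> + \<bar>h t\<bar>)"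
        using lips(2)[of "z t" "g t" "h t" 0 0 0] cl(3)[of 0] R nonlinearity_zero
        unfolding f_def[of] by (simp add: al_def el_def psi_def)
      also have "\<dots> \<le> L * (\<epsilon> + B)"
        using up[of t] low[of t] B[of t] small(4) by (intro mult_left_mono) auto
      finally show ?thesis by simp
    qed
    have gB: "\<bar>g t\<bar> \<le> B * cosh (0 * t)" "\<bar>h t\<bar> \<le> B * cosh (0 * t)" for t using B[of t] by auto
    have "\<bar>g t\<bar> \<le> L * (\<epsilon> + B) / (\<bar>r1\<bar> - 0) * cosh (0 * t)"
      by (rule hyperbolic_bound[OF g F gB(1)]) (use gap in auto)
    moreover have "\<bar>h t\<bar> \<le> L * (\<epsilon> + B) / (\<bar>r2\<bar> - 0) * cosh (0 * t)"
      by (rule hyperbolic_bound[OF h F gB(2)]) (use gap in auto)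
    moreover have q: "L * (\<epsilon> + B) / r \<le> (\<epsilon> + B) / 48" if "gap \<le> r" for r
    proof -
      have "L * (\<epsilon> + B) / r \<le> L * (\<epsilon> + B) / gap"
        using that gap small(4) B0 \<epsilon> by (intro divide_left_mono mult_nonneg_nonneg mult_pos_pos) auto
      also have "\<dots> = (L / gap) * (\<epsilon> + B)" by simp
      also have "\<dots> \<le> 1 / 48 * (\<epsilon> + B)" using LR B0 \<epsilon> by (intro mult_right_mono) auto
      finally show ?thesis by simp
    qed
    note q[OF gap(2)] q[OF gap(3)]
    ultimately show ?thesis unfolding diff_zero mult_zero_left cosh_0 mult_1_right by linarith
  qed
  define B where "B = (SUP t. \<bar>g t\<bar> + \<bar>h t\<bar>)"
  have bdd: "bdd_above (range (\<lambda>t. \<bar>g t\<bar> + \<bar>h t\<bar>))" using ghR by (auto intro!: bdd_aboveI)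
  have B: "\<bar>g t\<bar> + \<bar>h t\<bar> \<le> B" for t unfolding B_def by (rule cSUP_upper[OF _ bdd]) simp
  have "B \<le> (\<epsilon> + B) / 24" by (subst B_def, rule cSUP_least) (use improve[OF B] in auto)
  then have B\<epsilon>: "B \<le> \<epsilon>" using \<epsilon> by simp
  have "ball (2 * coord_const * \<epsilon>) z g h" unfolding ball_def
  proof
    fix t
    have "coord_const * (\<bar>z t\<bar> + \<bar>g t\<bar> + \<bar>h t\<bar>) \<le> coord_const * (2 * \<epsilon>)"
      using up[of t] low[of t] B[of t] B\<epsilon> coord_const_ge_1 by (intro mult_left_mono) auto
    then show "\<bar>al (z t) (g t) (h t)\<bar> \<le> 2 * coord_const * \<epsilon> \<and> \<bar>el (g t) (h t)\<bar> \<le> 2 * coord_const * \<epsilon> \<and> \<bar>psi (g t) (h t)\<bar> \<le> 2 * coord_const * \<epsilon>"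
      using coordinates_bound[of "z t" "g t" "h t"] by linarith
  qed
  then show ?thesis using that sys z0 low up unfolding \<epsilon>_def by blast
qed

end

section \<open>Shape and decay of a small profile\<close>

context nsp
begin

text \<open>
  Relative to the speed \<open>|z'|\<close>, the velocities of \<open>p\<close>, \<open>P - n\<close>
  and \<open>n - z\<close> are at most \<open>slave_const * \<epsilon>\<close>; the viscous
  coefficient \<open>\<mu> flux / n\<^sup>2\<close> lies between \<open>visc_min\<close> and
  \<open>visc_max\<close>; \<open>slow_const * \<epsilon>\<close> bounds the error in the reduced
  equation; \<open>decay_rate\<close> and \<open>slope_const\<close> are the constants in the
  resulting two-sided differential inequality for \<open>n\<close>.
\<close>

definition slave_const where "slave_const = 4 * coord_const * coord_const * growth_rate / gap"
definition visc_min where "visc_min = \<mu> * sound / (8 * nm)"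
definition visc_max where "visc_max = 4 * \<mu> * sound / nm"
definition slow_const where "slow_const = visc_max * slave_const + l\<^sup>2 * slave_const + 4 * l\<^sup>2 * coord_const / nm"
definition decay_rate where "decay_rate = (T + 1) / (2 * nm * (visc_max + visc_min / 2))"
definition slope_const where "slope_const = 4 * (T + 1) / (visc_min * nm)"

lemma consts_pos: "0 < slave_const" "0 < visc_min" "0 < visc_max" "0 < slow_const" "0 < decay_rate" "0 < slope_const"
proof -
  show 1: "0 < slave_const" "0 < visc_min" "0 < visc_max" using coord_const_ge_1 growth_rate_pos gap mu sound nm by (simp_all add: slave_const_def visc_min_def visc_max_def)
  then show "0 < slow_const" using l coord_const_ge_1 nm unfolding slow_const_def by (intro add_pos_pos mult_pos_pos divide_pos_pos) auto
  show "0 < decay_rate" "0 < slope_const" using 1 T nm unfolding decay_rate_def slope_const_def by (auto intro!: divide_pos_pos mult_pos_pos add_pos_pos)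
qed

end

text \<open>
  The five smallness conditions on the shock strength: the comparison estimates apply; the densities
  stay within a factor \<open>2\<close> of \<open>nm\<close>; the slaved velocities are at most
  \<open>1/8\<close> of \<open>|z'|\<close>; the error in the reduced equation is at most half of the
  viscous term; and \<open>n 0\<close>, like \<open>nm + z 0\<close>, is close to the middle between
  the far fields.
\<close>

locale small_profile = nsp +
  fixes np :: real and z g h :: "real \<Rightarrow> real"
  assumes np: "np \<in> near_states"
    and small: "2 * coord_const * (nm - np) \<le> max_radius" "8 * coord_const * (nm - np) \<le> nm" "8 * slave_const * (nm - np) \<le> 1"
      "2 * slow_const * (nm - np) \<le> visc_min" "64 * c0 * l\<^sup>2 * nonlin_const * coord_const\<^sup>2 * (nm - np) \<le> nm"
    and sys: "normal_sys np z g h" and z0: "z 0 = - (nm - np) / 2"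
    and small_ball: "ball (2 * coord_const * (nm - np)) z g h"
begin

definition \<epsilon> where "\<epsilon> = nm - np"
definition n where "n t = nm + al (z t) (g t) (h t)"
definition P where "P t = nm + al (z t) (g t) (h t) + el (g t) (h t)"
definition p where "p t = psi (g t) (h t)"

text \<open>
  The speed in the central direction, to which all other velocities are compared, and the right-hand
  side of the reduced equation, the flux of a Burgers shock.
\<close>

definition w where "w t = \<bar>deriv z t\<bar>"
definition Q where "Q t = (T + 1) * (nm - n t) * (n t - np) / n t"

lemma eps: "0 < \<epsilon>" "\<epsilon> \<le> nm / 2" "np = nm - \<epsilon>" using np by (auto simp: near_states_def \<epsilon>_def)

lemma w_nonneg: "0 \<le> w t" by (simp add: w_def)

lemma in_ball: "\<bar>al (z t) (g t) (h t)\<bar> \<le> 2 * coord_const * \<epsilon>" "\<bar>el (g t) (h t)\<bar> \<le> 2 * coord_const * \<epsilon>" "\<bar>p t\<bar> \<le> 2 * coord_const * \<epsilon>"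
  using small_ball unfolding ball_def \<epsilon>_def p_def by auto

lemma nP_bounds: "nm / 2 \<le> n t" "n t \<le> 2 * nm" "nm / 2 \<le> P t" "P t \<le> 2 * nm" "0 < n t" "0 < P t"
proof -
  have s: "2 * coord_const * \<epsilon> \<le> nm / 4" using small(2) by (simp add: \<epsilon>_def)
  show 1: "nm / 2 \<le> n t" "n t \<le> 2 * nm" "nm / 2 \<le> P t" "P t \<le> 2 * nm"
    using in_ball[of t] s nm unfolding n_def P_def by linarith+
  show "0 < n t" "0 < P t" using 1 nm by linarith+
qed

lemma zgh_deriv:
  "(z has_real_derivative deriv z t) (at t)" "(g has_real_derivative deriv g t) (at t)"
  "(h has_real_derivative deriv h t) (at t)"
  using sys unfolding normal_sys_def by (blast intro: has_real_derivative_deriv)+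

lemma eps_ball: "nm - np \<le> 2 * coord_const * \<epsilon>"
proof -
  have "1 * \<epsilon> \<le> 2 * coord_const * \<epsilon>" using coord_const_ge_1 eps by (intro mult_right_mono) auto
  then show ?thesis by (simp add: \<epsilon>_def)
qed

lemma ball_le: "2 * coord_const * \<epsilon> \<le> max_radius" using small(1) by (simp add: \<epsilon>_def)

lemma harnack':
  "w s \<le> 2 * w t * cosh (2 * coord_const * growth_rate * \<epsilon> * (s - t))"
  "\<bar>deriv g t\<bar> + \<bar>deriv h t\<bar> \<le> 4 * coord_const * growth_rate / gap * \<epsilon> * w t"
proof -
  note H = harnack[OF np eps_ball ball_le sys small_ball[folded \<epsilon>_def]]
  show "w s \<le> 2 * w t * cosh (2 * coord_const * growth_rate * \<epsilon> * (s - t))"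
    using H(1)[of s t] unfolding w_def by (simp add: mult_ac)
  have "growth_rate * (2 * coord_const * \<epsilon>) / gap * \<bar>deriv z t\<bar> + growth_rate * (2 * coord_const * \<epsilon>) / gap * \<bar>deriv z t\<bar> = 4 * coord_const * growth_rate / gap * \<epsilon> * w t"
    by (simp add: w_def mult_ac)
  then show "\<bar>deriv g t\<bar> + \<bar>deriv h t\<bar> \<le> 4 * coord_const * growth_rate / gap * \<epsilon> * w t"
    using H(2,3)[of t] by linarith
qed

lemma psi_deriv: "(p has_real_derivative psi (deriv g t) (deriv h t)) (at t)"
  unfolding p_def[abs_def] psi_def
  by (rule DERIV_cong[OF DERIV_cdivide[OF DERIV_diff[OF zgh_deriv(2,3)]]]) simp

lemma el_deriv: "((\<lambda>t. el (g t) (h t)) has_real_derivative el (deriv g t) (deriv h t)) (at t)"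
  unfolding el_def
  by (rule DERIV_cong[OF DERIV_diff[OF zgh_deriv(2) DERIV_cmult[OF psi_deriv[unfolded p_def[abs_def]]]]]) simp

lemma n_deriv: "(n has_real_derivative al (deriv z t) (deriv g t) (deriv h t)) (at t)"
proof -
  have "((\<lambda>t. nm + (z t + c0 * l\<^sup>2 * psi (g t) (h t))) has_real_derivative al (deriv z t) (deriv g t) (deriv h t)) (at t)"
    by (rule DERIV_cong[OF DERIV_add[OF DERIV_const DERIV_add[OF zgh_deriv(1) DERIV_cmult[OF psi_deriv[unfolded p_def[abs_def]]]]]])
      (simp add: al_def)
  then show ?thesis unfolding n_def[abs_def] al_def .
qed

lemma wave: "wave_sys np n P p"
  using normal_imp_wave[OF sys np] unfolding n_def[abs_def] P_def[abs_def] p_def[abs_def] .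

lemma P_deriv: "(P has_real_derivative P t * p t) (at t)" using wave unfolding wave_sys_def by blast

text \<open>
  \<open>n - nm - z\<close>, \<open>p\<close> and \<open>P - n\<close> are linear in \<open>g\<close>
  and \<open>h\<close>, whose velocities carry the factor \<open>\<epsilon>\<close>.
\<close>

lemma slaved:
  "\<bar>deriv n t - deriv z t\<bar> \<le> slave_const * \<epsilon> * w t" "\<bar>deriv p t\<bar> \<le> slave_const * \<epsilon> * w t"
  "\<bar>P t * p t - deriv n t\<bar> \<le> slave_const * \<epsilon> * w t"
proof -
  have "\<bar>al 0 (deriv g t) (deriv h t)\<bar> + \<bar>el (deriv g t) (deriv h t)\<bar> + \<bar>psi (deriv g t) (deriv h t)\<bar>
      \<le> coord_const * (\<bar>deriv g t\<bar> + \<bar>deriv h t\<bar>)" using coordinates_bound[of 0 "deriv g t" "deriv h t"] by simp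
  also have "\<dots> \<le> coord_const * (4 * coord_const * growth_rate / gap * \<epsilon> * w t)"
    using harnack'(2)[of t] coord_const_ge_1 by (intro mult_left_mono) auto
  also have "\<dots> = slave_const * \<epsilon> * w t" by (simp add: slave_const_def)
  finally have b: "\<bar>al 0 (deriv g t) (deriv h t)\<bar> + \<bar>el (deriv g t) (deriv h t)\<bar> + \<bar>psi (deriv g t) (deriv h t)\<bar> \<le> slave_const * \<epsilon> * w t" .
  have n': "deriv n t = deriv z t + al 0 (deriv g t) (deriv h t)"
    using DERIV_imp_deriv[OF n_deriv] by (simp add: al_def)
  then show "\<bar>deriv n t - deriv z t\<bar> \<le> slave_const * \<epsilon> * w t" using b by linarith
  show "\<bar>deriv p t\<bar> \<le> slave_const * \<epsilon> * w t" unfolding DERIV_imp_deriv[OF psi_deriv] using b by linarith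
  have "P = (\<lambda>t. n t + el (g t) (h t))" by (auto simp: P_def n_def)
  then have "(P has_real_derivative deriv n t + el (deriv g t) (deriv h t)) (at t)"
    using DERIV_add[OF has_real_derivative_deriv[OF n_deriv] el_deriv] by simp
  then have "P t * p t = deriv n t + el (deriv g t) (deriv h t)" using P_deriv DERIV_unique by blast
  then show "\<bar>P t * p t - deriv n t\<bar> \<le> slave_const * \<epsilon> * w t" using b by linarith
qed

lemma slave_const_small: "slave_const * \<epsilon> * w t \<le> w t / 8"
  using mult_right_mono[OF small(3) w_nonneg, of t] by (simp add: \<epsilon>_def)

lemma p_bounds: "\<bar>p t\<bar> \<le> 4 / nm * w t"
proof -
  have "\<bar>P t * p t\<bar> \<le> 2 * w t"
    using slaved(1,3)[of t] slave_const_small[of t] w_nonneg[of t] unfolding w_def by linarith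
  moreover have "nm / 2 * \<bar>p t\<bar> \<le> P t * \<bar>p t\<bar>" using nP_bounds by (intro mult_right_mono) auto
  ultimately have "nm / 2 * \<bar>p t\<bar> \<le> 2 * w t" using nP_bounds(6)[of t] by (simp add: abs_mult)
  then show ?thesis using nm by (simp add: field_simps)
qed

text \<open>
  The integrated momentum equation solved for the viscous term, with \<open>P - n\<close> eliminated
  by Poisson's equation. Without the two terms in \<open>p\<close> it is the profile equation of a
  viscous Burgers shock.
\<close>

lemma slow_equation: "- (\<mu> * flux np / (n t)\<^sup>2) * deriv n t + l\<^sup>2 * deriv p t - l\<^sup>2 * (p t)\<^sup>2 / 2 = Q t"
proof -
  have flux: "0 < \<mu> * flux np" using flux_bounds[OF np] mu by simp
  have n0: "n t \<noteq> 0" using nP_bounds(5)[of t] by simp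
  have l0: "l\<^sup>2 \<noteq> 0" using l by simp
  have dn: "deriv n t = (1 / (\<mu> * flux np)) * ((T + 1) * n t * (n t - nm) * (n t - np)
         + (n t)\<^sup>2 * (P t - n t) - l\<^sup>2 * (n t)\<^sup>2 * (p t)\<^sup>2 / 2)"
    and dp: "deriv p t = (P t - n t) / l\<^sup>2"
    using wave unfolding wave_sys_def by (auto intro!: DERIV_imp_deriv)
  have gen: "X * d = Y" if "d = 1 / X * Y" "X \<noteq> 0" for X d Y :: real using that by simp
  have e: "\<mu> * flux np * deriv n t = (T + 1) * n t * (n t - nm) * (n t - np)
         + (n t)\<^sup>2 * (P t - n t) - l\<^sup>2 * (n t)\<^sup>2 * (p t)\<^sup>2 / 2" 
    by (rule gen[OF dn less_imp_neq[OF flux, symmetric]])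
  have f: "l\<^sup>2 * deriv p t = P t - n t" using dp l0 by simp
  have "- (\<mu> * flux np / (n t)\<^sup>2) * deriv n t = - (\<mu> * flux np * deriv n t) / (n t)\<^sup>2" by simp
  also have "\<dots> = Q t - (P t - n t) + l\<^sup>2 * (p t)\<^sup>2 / 2"
    unfolding e Q_def using n0 by (simp add: field_simps power2_eq_square)
  finally show ?thesis unfolding f by simp
qed

lemma visc_bounds: "visc_min \<le> \<mu> * flux np / (n t)\<^sup>2" "\<mu> * flux np / (n t)\<^sup>2 \<le> visc_max"
proof -
  note flux = flux_bounds[OF np]
  have "(n t)\<^sup>2 \<le> (2 * nm)\<^sup>2" using nP_bounds by (intro power_mono) (auto simp: less_imp_le)
  then have "\<mu> * (sound * nm / 2) / (2 * nm)\<^sup>2 \<le> \<mu> * flux np / (n t)\<^sup>2"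
    using flux mu nP_bounds(5)[of t] sound nm by (intro frac_le mult_left_mono) auto
  then show "visc_min \<le> \<mu> * flux np / (n t)\<^sup>2" using nm by (simp add: visc_min_def power2_eq_square)
  have "(nm / 2)\<^sup>2 \<le> (n t)\<^sup>2" using nP_bounds nm by (intro power_mono) auto
  then have "\<mu> * flux np / (n t)\<^sup>2 \<le> \<mu> * (sound * nm) / (nm / 2)\<^sup>2"
    using flux mu sound nm by (intro frac_le mult_left_mono) auto
  then show "\<mu> * flux np / (n t)\<^sup>2 \<le> visc_max" using nm by (simp add: visc_max_def power2_eq_square mult_ac)
qed

text \<open>
  The dispersive terms are small compared with \<open>w\<close> because \<open>p'\<close> is slaved
  and \<open>p\<close> is both of size \<open>\<epsilon>\<close> and of size \<open>w\<close>. So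
  \<open>Q\<close> and \<open>- z'\<close> have the same sign and comparable size.
\<close>

lemma slow_estimate: "\<bar>Q t + \<mu> * flux np / (n t)\<^sup>2 * deriv z t\<bar> \<le> visc_min / 2 * w t"
proof -
  let ?v = "\<mu> * flux np / (n t)\<^sup>2"
  have v: "0 \<le> ?v" "?v \<le> visc_max" using visc_bounds[of t] consts_pos(2) by linarith+
  have "\<bar>?v * (deriv z t - deriv n t)\<bar> \<le> visc_max * (slave_const * \<epsilon> * w t)"
    unfolding abs_mult using v slaved(1)[of t] by (intro mult_mono) (auto simp: abs_minus_commute)
  moreover have "\<bar>l\<^sup>2 * deriv p t\<bar> \<le> l\<^sup>2 * (slave_const * \<epsilon> * w t)"
    unfolding abs_mult using slaved(2)[of t] by (intro mult_mono) auto
  moreover have "\<bar>l\<^sup>2 * (p t)\<^sup>2 / 2\<bar> \<le> 4 * l\<^sup>2 * coord_const / nm * \<epsilon> * w t"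
  proof -
    have "\<bar>p t\<bar> * \<bar>p t\<bar> \<le> (2 * coord_const * \<epsilon>) * (4 / nm * w t)"
      using in_ball(3)[of t] p_bounds[of t] coord_const_ge_1 eps by (intro mult_mono) auto
    then have "l\<^sup>2 / 2 * (\<bar>p t\<bar> * \<bar>p t\<bar>) \<le> l\<^sup>2 / 2 * ((2 * coord_const * \<epsilon>) * (4 / nm * w t))"
      by (intro mult_left_mono) auto
    moreover have "\<bar>l\<^sup>2 * (p t)\<^sup>2 / 2\<bar> = l\<^sup>2 / 2 * (\<bar>p t\<bar> * \<bar>p t\<bar>)"
      by (simp add: power2_eq_square abs_mult)
    ultimately show ?thesis by (simp add: power2_eq_square mult_ac)
  qed
  moreover have "Q t + ?v * deriv z t = ?v * (deriv z t - deriv n t) + l\<^sup>2 * deriv p t - l\<^sup>2 * (p t)\<^sup>2 / 2"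
    using slow_equation[of t] unfolding right_diff_distrib by linarith
  ultimately have "\<bar>Q t + ?v * deriv z t\<bar> \<le> visc_max * (slave_const * \<epsilon> * w t) + l\<^sup>2 * (slave_const * \<epsilon> * w t) + 4 * l\<^sup>2 * coord_const / nm * \<epsilon> * w t"
    by linarith
  also have "\<dots> = slow_const * \<epsilon> * w t" by (simp add: slow_const_def algebra_simps)
  also have "\<dots> \<le> visc_min / 2 * w t"
    using mult_right_mono[OF small(4) w_nonneg, of t] by (simp add: \<epsilon>_def)
  finally show ?thesis .
qed

lemma Q_bounds: "visc_min / 2 * w t \<le> \<bar>Q t\<bar>" "\<bar>Q t\<bar> \<le> (visc_max + visc_min / 2) * w t"
  "w t \<noteq> 0 \<Longrightarrow> 0 < Q t \<Longrightarrow> deriv z t < 0"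
proof -
  let ?v = "\<mu> * flux np / (n t)\<^sup>2"
  have v: "0 < ?v" using visc_bounds[of t] consts_pos(2) by linarith
  have a: "\<bar>?v * deriv z t\<bar> = ?v * w t" by (simp only: abs_mult w_def abs_of_pos[OF v])
  have b: "visc_min * w t \<le> ?v * w t" "?v * w t \<le> visc_max * w t"
    using visc_bounds[of t] w_nonneg[of t] by (intro mult_right_mono; auto)+
  show "visc_min / 2 * w t \<le> \<bar>Q t\<bar>" "\<bar>Q t\<bar> \<le> (visc_max + visc_min / 2) * w t"
  proof -
    have gen: "M1 / 2 \<le> \<bar>q\<bar> \<and> \<bar>q\<bar> \<le> M2 + M1 / 2"
      if "\<bar>q + X\<bar> \<le> M1 / 2" "\<bar>X\<bar> = Y" "M1 \<le> Y" "Y \<le> M2" for q X Y M1 M2 :: real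
      using that by linarith
    have "\<bar>Q t + ?v * deriv z t\<bar> \<le> visc_min * w t / 2" using slow_estimate[of t] by simp
    from gen[OF this a b] show "visc_min / 2 * w t \<le> \<bar>Q t\<bar>" "\<bar>Q t\<bar> \<le> (visc_max + visc_min / 2) * w t"
      by (simp_all add: distrib_right)
  qed
  assume h: "w t \<noteq> 0" "0 < Q t"
  show "deriv z t < 0"
  proof (rule ccontr)
    assume "\<not> deriv z t < 0"
    then have "?v * w t \<le> ?v * deriv z t" using v by (simp add: w_def)
    then have "visc_min * w t \<le> visc_min / 2 * w t" using slow_estimate[of t] h(2) b by linarith
    then have "visc_min * w t \<le> 0" by linarith
    then show False using h(1) w_nonneg[of t] consts_pos(2) by (simp add: mult_le_0_iff)
  qed
qed

lemma w_le: "w t \<le> 4 * nonlin_const * coord_const\<^sup>2 * \<epsilon>\<^sup>2"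
proof -
  have "deriv z t = N1 np (al (z t) (g t) (h t)) (el (g t) (h t)) (psi (g t) (h t))"
    using sys unfolding normal_sys_def by (blast intro: DERIV_imp_deriv)
  then have "w t \<le> nonlin_const * (2 * coord_const * \<epsilon>)\<^sup>2"
    unfolding w_def using nonlin_const_bound(1)[OF np eps_ball _ in_ball(1) in_ball(2) in_ball(3)[unfolded p_def], of t] ball_le max_radius(2)
    by simp
  then show ?thesis by (simp add: power_mult_distrib)
qed

text \<open>
  The density differs from \<open>nm + z\<close> by a multiple of \<open>p\<close>, which is of size
  \<open>\<epsilon>\<^sup>2\<close>.
\<close>

lemma n_at_0: "nm - 3/4 * \<epsilon> \<le> n 0" "n 0 \<le> nm - \<epsilon> / 4"
proof -
  have "\<bar>c0 * l\<^sup>2 * p 0\<bar> \<le> c0 * l\<^sup>2 * (4 / nm * (4 * nonlin_const * coord_const\<^sup>2 * \<epsilon>\<^sup>2))"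
  proof -
    have "\<bar>p 0\<bar> \<le> 4 / nm * (4 * nonlin_const * coord_const\<^sup>2 * \<epsilon>\<^sup>2)"
      by (rule order_trans[OF p_bounds mult_left_mono[OF w_le]]) (use nm in auto)
    then show ?thesis unfolding abs_mult using c0 by (intro mult_mono) auto
  qed
  also have "\<dots> = 64 * c0 * l\<^sup>2 * nonlin_const * coord_const\<^sup>2 * \<epsilon> * (\<epsilon> / (4 * nm))" by (simp add: power2_eq_square)
  also have "\<dots> \<le> nm * (\<epsilon> / (4 * nm))"
    using small(5) eps nm unfolding \<epsilon>_def by (intro mult_right_mono) auto
  also have "\<dots> = \<epsilon> / 4" using nm by simp
  finally have "\<bar>c0 * l\<^sup>2 * p 0\<bar> \<le> \<epsilon> / 4" .
  moreover have "n 0 = nm + (z 0 + c0 * l\<^sup>2 * p 0)" by (simp add: n_def al_def p_def)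
  ultimately show "nm - 3/4 * \<epsilon> \<le> n 0" "n 0 \<le> nm - \<epsilon> / 4"
    using z0 unfolding \<epsilon>_def by linarith+
qed

text \<open>
  By the Harnack inequality \<open>z'\<close> either vanishes identically or nowhere, and at time
  \<open>0\<close> the density lies strictly between the far fields, where the reduced equation does
  not allow \<open>z' = 0\<close>.
\<close>

lemma w_pos: "0 < w t"
proof (rule ccontr)
  assume "\<not> 0 < w t"
  then have "w t = 0" using w_nonneg[of t] by linarith
  then have "w 0 = 0" using harnack'(1)[of 0 t] w_nonneg[of 0] by simp
  then have "Q 0 = 0" using Q_bounds(2)[of 0] by simp
  moreover have "0 < Q 0" unfolding Q_def using n_at_0 eps T nP_bounds(5)[of 0]
    by (intro divide_pos_pos mult_pos_pos) auto
  ultimately show False by simp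
qed

text \<open>At a far field \<open>Q\<close> vanishes, hence \<open>w\<close> would.\<close>

lemma n_between: "np < n t" "n t < nm"
proof -
  have nz: "Q t \<noteq> 0" for t using Q_bounds(1)[of t] mult_pos_pos[OF consts_pos(2) w_pos[of t]] by linarith
  then have ne: "n t \<noteq> nm" "n t \<noteq> np" for t
  proof -
    have "n t = nm \<or> n t = np \<Longrightarrow> Q t = 0" unfolding Q_def by auto
    then show "n t \<noteq> nm" "n t \<noteq> np" using nz[of t] by blast+
  qed
  have c: "isCont n t" for t using n_deriv DERIV_isCont by blast
  have i: "np < n 0" "n 0 < nm" using n_at_0 eps by linarith+
  show "np < n t"
  proof (rule ccontr)
    assume "\<not> np < n t"
    then obtain x where "n x = np" using intermediate_value[of n t np 0, OF c] i by auto
    then show False using ne by blast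
  qed
  show "n t < nm"
  proof (rule ccontr)
    assume "\<not> n t < nm"
    then obtain x where "n x = nm" using intermediate_value[of n 0 nm t, OF c] i by auto
    then show False using ne by blast
  qed
qed

lemma Q_pos: "0 < Q t"
  unfolding Q_def using n_between[of t] T nP_bounds(5)[of t] by (intro divide_pos_pos mult_pos_pos) auto

lemma z_decreasing: "deriv z t = - w t"
  using Q_bounds(3)[OF _ Q_pos, of t] w_pos[of t] by (auto simp: w_def)

text \<open>
  The errors in \<open>slaved\<close> are at most \<open>w / 8\<close>, so \<open>n'\<close> and
  \<open>P' = P * p\<close> both have the sign and, up to these errors, the size of \<open>z'\<close>.
\<close>

lemma n_p_comparable:
  "w t / 2 \<le> - deriv n t" "- deriv n t \<le> 2 * w t" "w t / (4 * nm) \<le> - p t" "- p t \<le> 3 / nm * w t"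
proof -
  show n: "w t / 2 \<le> - deriv n t" "- deriv n t \<le> 2 * w t"
    using slaved(1)[of t] slave_const_small[of t] w_nonneg[of t] unfolding z_decreasing by linarith+
  have P: "w t / 2 \<le> P t * - p t" "P t * - p t \<le> 3/2 * w t"
    using slaved(1,3)[of t] slave_const_small[of t] w_nonneg[of t] unfolding z_decreasing by simp_all
  have "0 < P t * - p t" using P(1) w_pos[of t] by linarith
  then have np0: "0 < - p t" using nP_bounds(6)[of t] by (simp add: mult_less_0_iff)
  have "P t * - p t \<le> 2 * nm * - p t" using nP_bounds np0 by (intro mult_right_mono) auto
  then show "w t / (4 * nm) \<le> - p t" using P(1) nm by (simp add: field_simps)
  have "nm / 2 * - p t \<le> P t * - p t" using nP_bounds np0 by (intro mult_right_mono) auto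
  then show "- p t \<le> 3 / nm * w t" using P(2) nm by (simp add: field_simps)
qed

lemma n_decreasing: "deriv n t \<le> 0"
  using n_p_comparable(1)[of t] w_nonneg[of t] by linarith

lemma w_comparable:
  "decay_rate * ((nm - n t) * (n t - np)) \<le> - deriv n t" "w t \<le> slope_const * ((nm - n t) * (n t - np))"
proof -
  let ?y = "(nm - n t) * (n t - np)"
  have y: "0 \<le> ?y" using n_between[of t] by simp
  have Qe: "Q t = (T + 1) * ?y / n t" by (simp add: Q_def mult_ac)
  have "(T + 1) * ?y / nm \<le> Q t" unfolding Qe
    using y T n_between[of t] nP_bounds(5)[of t] by (intro divide_left_mono) auto
  also have "\<dots> \<le> (visc_max + visc_min / 2) * w t" using Q_bounds(2)[of t] by linarith
  also have "\<dots> \<le> (visc_max + visc_min / 2) * (2 * - deriv n t)"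
    using n_p_comparable(1)[of t] consts_pos by (intro mult_left_mono) auto
  finally have *: "(T + 1) * ?y / nm \<le> (visc_max + visc_min / 2) * (2 * - deriv n t)" .
  have gen: "X / (2 * nm * C) \<le> d" if "X / nm \<le> C * (2 * d)" "0 < C" for X C d
    using that nm by (simp add: field_simps)
  show "decay_rate * ?y \<le> - deriv n t"
    using gen[OF *] consts_pos by (simp add: decay_rate_def)
  have "visc_min / 2 * w t \<le> Q t" using Q_bounds(1)[of t] Q_pos[of t] by linarith
  also have "\<dots> \<le> (T + 1) * ?y / (nm / 2)" unfolding Qe
    using y T nP_bounds nm by (intro divide_left_mono) auto
  finally have *: "visc_min / 2 * w t \<le> (T + 1) * ?y / (nm / 2)" .
  have gen: "d \<le> 4 * X / (C * nm)" if "C / 2 * d \<le> X / (nm / 2)" "0 < C" for X C d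
    using that nm by (simp add: field_simps)
  show "w t \<le> slope_const * ?y" using gen[OF * consts_pos(2)] unfolding slope_const_def times_divide_eq_left mult.assoc .
qed

text \<open>
  For positive times \<open>n\<close> lies below \<open>n 0\<close> and so \<open>nm - n \<ge>
  \<epsilon> / 4\<close>; the logistic inequality for \<open>n - np\<close> becomes linear, with rate
  \<open>decay_rate * \<epsilon> / 4\<close>. \<open>decay_left\<close> is the mirror image.
\<close>

lemma decay_right:
  assumes "0 \<le> t"
  shows "n t - np \<le> \<epsilon> * exp (- (decay_rate / 4) * \<epsilon> * t)"
proof -
  define k where "k = decay_rate / 4 * \<epsilon>"
  define F where "F = (\<lambda>t. - (n t - np) * exp (k * t))"
  have D: "(F has_real_derivative (- deriv n t - k * (n t - np)) * exp (k * t)) (at t)" for t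
    unfolding F_def by (auto intro!: derivative_eq_intros has_real_derivative_deriv[OF n_deriv] simp: algebra_simps)
  have n_le: "n s \<le> nm - \<epsilon> / 4" if "0 \<le> s" for s
  proof -
    have "- n 0 \<le> - n s"
      by (rule has_deriv_nonneg_mono[of "\<lambda>t. - n t" "\<lambda>t. - deriv n t"])
        (use that n_decreasing in \<open>auto intro!: DERIV_minus has_real_derivative_deriv[OF n_deriv]\<close>)
    then show ?thesis using n_at_0(2) by linarith
  qed
  have "F 0 \<le> F t"
  proof (rule DERIV_nonneg_imp_nondecreasing[OF assms])
    fix s assume s: "0 \<le> s" "s \<le> t"
    have "k * (n s - np) = decay_rate * (\<epsilon> / 4 * (n s - np))" by (simp add: k_def)
    also have "\<dots> \<le> decay_rate * ((nm - n s) * (n s - np))"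
      using n_le[OF s(1)] n_between[of s] consts_pos by (intro mult_left_mono mult_right_mono) auto
    also have "\<dots> \<le> - deriv n s" by (rule w_comparable)
    finally have "0 \<le> (- deriv n s - k * (n s - np)) * exp (k * s)" by simp
    then show "\<exists>y. (F has_real_derivative y) (at s) \<and> 0 \<le> y" using D by blast
  qed
  then have "(n t - np) * exp (k * t) \<le> n 0 - np" by (simp add: F_def algebra_simps)
  also have "\<dots> \<le> \<epsilon>" using n_between(2)[of 0] by (simp add: \<epsilon>_def)
  finally have "(n t - np) * exp (k * t) * exp (- k * t) \<le> \<epsilon> * exp (- k * t)"
    by (intro mult_right_mono) auto
  moreover have "exp (k * t) * exp (- k * t) = 1" by (simp add: mult_exp_exp)
  ultimately have "n t - np \<le> \<epsilon> * exp (- k * t)" by (simp only: mult.assoc mult_1_right)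
  then show ?thesis unfolding k_def minus_mult_left .
qed

lemma decay_left:
  assumes "t \<le> 0"
  shows "nm - n t \<le> \<epsilon> * exp (decay_rate / 4 * \<epsilon> * t)"
proof -
  define k where "k = decay_rate / 4 * \<epsilon>"
  define F where "F = (\<lambda>t. (nm - n t) * exp (- k * t))"
  have D: "(F has_real_derivative (- deriv n t - k * (nm - n t)) * exp (- k * t)) (at t)" for t
    unfolding F_def by (auto intro!: derivative_eq_intros has_real_derivative_deriv[OF n_deriv] simp: algebra_simps)
  have n_ge: "np + \<epsilon> / 4 \<le> n s" if "s \<le> 0" for s
  proof -
    have "- n s \<le> - n 0"
      by (rule has_deriv_nonneg_mono[of "\<lambda>t. - n t" "\<lambda>t. - deriv n t"])
        (use that n_decreasing in \<open>auto intro!: DERIV_minus has_real_derivative_deriv[OF n_deriv]\<close>)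
    then show ?thesis using n_at_0(1) eps(3) by linarith
  qed
  have "F t \<le> F 0"
  proof (rule DERIV_nonneg_imp_nondecreasing[OF assms])
    fix s assume s: "t \<le> s" "s \<le> 0"
    have "k * (nm - n s) = decay_rate * ((nm - n s) * (\<epsilon> / 4))" by (simp add: k_def)
    also have "\<dots> \<le> decay_rate * ((nm - n s) * (n s - np))"
      using n_ge[OF s(2)] n_between[of s] consts_pos by (intro mult_left_mono) auto
    also have "\<dots> \<le> - deriv n s" by (rule w_comparable)
    finally have "0 \<le> (- deriv n s - k * (nm - n s)) * exp (- k * s)" by simp
    then show "\<exists>y. (F has_real_derivative y) (at s) \<and> 0 \<le> y" using D by blast
  qed
  then have "(nm - n t) * exp (- k * t) \<le> nm - n 0" by (simp add: F_def)
  also have "\<dots> \<le> \<epsilon>" using n_between(1)[of 0] by (simp add: \<epsilon>_def)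
  finally have "(nm - n t) * exp (- k * t) * exp (k * t) \<le> \<epsilon> * exp (k * t)"
    by (intro mult_right_mono) auto
  moreover have "exp (- k * t) * exp (k * t) = 1" by (simp add: mult_exp_exp)
  ultimately have "nm - n t \<le> \<epsilon> * exp (k * t)" by (simp only: mult.assoc mult_1_right)
  then show ?thesis unfolding k_def .
qed

lemma w_decay: "w t \<le> slope_const * \<epsilon>\<^sup>2 * exp (- (decay_rate / 4) * \<epsilon> * \<bar>t\<bar>)"
proof -
  have le: "nm - n t \<le> \<epsilon>" "n t - np \<le> \<epsilon>" using n_between[of t] by (auto simp: \<epsilon>_def)
  have "(nm - n t) * (n t - np) \<le> \<epsilon> * (\<epsilon> * exp (- (decay_rate / 4) * \<epsilon> * \<bar>t\<bar>))"
  proof (cases "0 \<le> t")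
    case True
    then show ?thesis using decay_right[OF True] le n_between[of t] eps by (intro mult_mono) auto
  next
    case False
    then have "(n t - np) * (nm - n t) \<le> \<epsilon> * (\<epsilon> * exp (- (decay_rate / 4) * \<epsilon> * \<bar>t\<bar>))"
      using decay_left[of t] le n_between[of t] eps by (intro mult_mono) auto
    then show ?thesis by (simp add: mult.commute)
  qed
  then have "slope_const * ((nm - n t) * (n t - np)) \<le> slope_const * (\<epsilon> * (\<epsilon> * exp (- (decay_rate / 4) * \<epsilon> * \<bar>t\<bar>)))"
    using consts_pos by (intro mult_left_mono) auto
  then show ?thesis using w_comparable(2)[of t] by (simp add: power2_eq_square mult_ac)
qed

end

section \<open>Smooth functions of one variable\<close>

lemma differentiable_on_UNIV_iff:
  "f differentiable_on UNIV \<longleftrightarrow> (\<forall>t::real. (f has_real_derivative deriv f t) (at t))"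
  by (auto simp: differentiable_on_def DERIV_deriv_iff_real_differentiable)

lemma smooth_has_derivative: "smooth f \<Longrightarrow> (f has_real_derivative deriv f t) (at t)"
  unfolding smooth_def differentiable_on_UNIV_iff by (metis funpow_0)

lemma smooth_deriv: "smooth f \<Longrightarrow> smooth (deriv f)"
  unfolding smooth_def by (metis funpow_Suc_right comp_apply)

lemma smooth_funpow_deriv: "smooth f \<Longrightarrow> smooth ((deriv ^^ k) f)"
  by (induction k) (auto intro: smooth_deriv)

text \<open>
  Differentiability of finite order, which gives the closure properties of smooth functions and the
  smoothness of solutions of differential equations by induction on the order.
\<close>

definition ndiff :: "nat \<Rightarrow> (real \<Rightarrow> real) \<Rightarrow> bool" where
  "ndiff k f \<longleftrightarrow> (\<forall>j<k. (deriv ^^ j) f differentiable_on UNIV)"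

lemma smooth_iff_ndiff: "smooth f \<longleftrightarrow> (\<forall>k. ndiff k f)"
  unfolding smooth_def ndiff_def by blast

lemma ndiff_0 [simp]: "ndiff 0 f" by (simp add: ndiff_def)

lemma ndiff_Suc: "ndiff (Suc k) f \<longleftrightarrow> (\<forall>t. (f has_real_derivative deriv f t) (at t)) \<and> ndiff k (deriv f)"
proof -
  have "ndiff (Suc k) f \<longleftrightarrow> f differentiable_on UNIV \<and> (\<forall>j<k. (deriv ^^ Suc j) f differentiable_on UNIV)"
    unfolding ndiff_def All_less_Suc2 by simp
  then show ?thesis unfolding funpow_Suc_right differentiable_on_UNIV_iff[of f] ndiff_def by simp
qed

lemma ndiff_SucI:
  assumes "\<And>t. (f has_real_derivative f' t) (at t)" "ndiff k f'"
  shows "ndiff (Suc k) f"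
proof -
  have "deriv f = f'" using assms(1) by (auto intro: DERIV_imp_deriv)
  then show ?thesis using assms unfolding ndiff_Suc by simp
qed

lemma ndiff_SucD: "ndiff (Suc k) f \<Longrightarrow> ndiff k f"
  unfolding ndiff_def by simp

lemma ndiff_const: "ndiff k (\<lambda>t. c)"
proof (induction k arbitrary: c)
  case (Suc k)
  show ?case by (rule ndiff_SucI[OF DERIV_const Suc])
qed simp

lemma ndiff_add: "ndiff k f \<Longrightarrow> ndiff k g \<Longrightarrow> ndiff k (\<lambda>t. f t + g t)"
proof (induction k arbitrary: f g)
  case (Suc k)
  show ?case
    by (rule ndiff_SucI[where f' = "\<lambda>t. deriv f t + deriv g t"])
      (use Suc in \<open>auto simp: ndiff_Suc intro!: DERIV_add\<close>)
qed simp

lemma ndiff_mult: "ndiff k f \<Longrightarrow> ndiff k g \<Longrightarrow> ndiff k (\<lambda>t. f t * g t)"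
proof (induction k arbitrary: f g)
  case (Suc k)
  have n: "ndiff k f" "ndiff k g" using Suc.prems by (auto intro: ndiff_SucD)
  have d: "ndiff k (deriv f)" "ndiff k (deriv g)" using Suc.prems by (auto simp: ndiff_Suc)
  show ?case
  proof (rule ndiff_SucI[where f' = "\<lambda>t. deriv f t * g t + f t * deriv g t"])
    show "((\<lambda>t. f t * g t) has_real_derivative deriv f t * g t + f t * deriv g t) (at t)" for t
      using Suc.prems unfolding ndiff_Suc by (auto intro!: derivative_eq_intros simp: mult.commute)
    show "ndiff k (\<lambda>t. deriv f t * g t + f t * deriv g t)"
      by (intro ndiff_add Suc.IH n d)
  qed
qed simp

lemma ndiff_uminus: "ndiff k f \<Longrightarrow> ndiff k (\<lambda>t. - f t)"
  using ndiff_mult[OF ndiff_const[of k "- 1"], of f] by simp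

lemma ndiff_diff: "ndiff k f \<Longrightarrow> ndiff k g \<Longrightarrow> ndiff k (\<lambda>t. f t - g t)"
  using ndiff_add[OF _ ndiff_uminus, of k f g] by simp

lemmas ndiff_intros = ndiff_const ndiff_add ndiff_mult ndiff_uminus ndiff_diff

lemma smooth_const: "smooth (\<lambda>t. c)" by (simp add: smooth_iff_ndiff ndiff_const)
lemma smooth_add: "smooth f \<Longrightarrow> smooth g \<Longrightarrow> smooth (\<lambda>t. f t + g t)" by (simp add: smooth_iff_ndiff ndiff_add)
lemma smooth_mult: "smooth f \<Longrightarrow> smooth g \<Longrightarrow> smooth (\<lambda>t. f t * g t)" by (simp add: smooth_iff_ndiff ndiff_mult)
lemma smooth_uminus: "smooth f \<Longrightarrow> smooth (\<lambda>t. - f t)" by (simp add: smooth_iff_ndiff ndiff_uminus)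
lemma smooth_diff: "smooth f \<Longrightarrow> smooth g \<Longrightarrow> smooth (\<lambda>t. f t - g t)" by (simp add: smooth_iff_ndiff ndiff_diff)
lemmas smooth_intros = smooth_const smooth_add smooth_mult smooth_uminus smooth_diff

lemma smoothI:
  assumes "\<And>t. (f has_real_derivative f' t) (at t)" "smooth f'"
  shows "smooth f"
  unfolding smooth_iff_ndiff
proof
  fix k show "ndiff k f" using ndiff_SucI[OF assms(1)] assms(2) unfolding smooth_iff_ndiff
    by (cases k) auto
qed

lemma smooth_inverse:
  assumes f: "smooth f" and nz: "\<And>t. f t \<noteq> 0"
  shows "smooth (\<lambda>t. inverse (f t))"
  unfolding smooth_iff_ndiff
proof
  fix k show "ndiff k (\<lambda>t. inverse (f t))"
  proof (induction k)
    case (Suc k)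
    show ?case
    proof (rule ndiff_SucI[where f' = "\<lambda>t. - (inverse (f t) * deriv f t * inverse (f t))"])
      show "((\<lambda>t. inverse (f t)) has_real_derivative - (inverse (f t) * deriv f t * inverse (f t))) (at t)" for t
        using DERIV_inverse'[OF smooth_has_derivative[OF f] nz] by simp
      show "ndiff k (\<lambda>t. - (inverse (f t) * deriv f t * inverse (f t)))"
        using smooth_deriv[OF f] Suc unfolding smooth_iff_ndiff by (intro ndiff_intros) auto
    qed
  qed simp
qed

lemma deriv_eqI: "(\<And>t. (f has_real_derivative f' t) (at t)) \<Longrightarrow> deriv f = f'"
  by (auto intro: DERIV_imp_deriv)

lemma deriv_add_fun: "smooth f \<Longrightarrow> smooth g \<Longrightarrow> deriv (\<lambda>t. f t + g t) = (\<lambda>t. deriv f t + deriv g t)"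
  by (intro deriv_eqI DERIV_add smooth_has_derivative)

lemma deriv_mult_fun: "smooth f \<Longrightarrow> smooth g \<Longrightarrow> deriv (\<lambda>t. f t * g t) = (\<lambda>t. deriv f t * g t + f t * deriv g t)"
  by (intro deriv_eqI) (auto intro!: derivative_eq_intros smooth_has_derivative simp: mult.commute)

lemma funpow_deriv_add:
  "smooth f \<Longrightarrow> smooth g \<Longrightarrow> (deriv ^^ k) (\<lambda>t. f t + g t) = (\<lambda>t. (deriv ^^ k) f t + (deriv ^^ k) g t)"
  by (induction k) (simp_all add: deriv_add_fun smooth_funpow_deriv)

lemma funpow_deriv_cmult: "smooth f \<Longrightarrow> (deriv ^^ k) (\<lambda>t. c * f t) = (\<lambda>t. c * (deriv ^^ k) f t)"
  by (induction k) (simp_all add: deriv_mult_fun smooth_const smooth_funpow_deriv)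

section \<open>Families graded by powers of a small parameter\<close>

text \<open>
  \<open>E i\<close> is the small parameter of the member \<open>i\<close> and \<open>W i\<close> a
  bounded weight that carries its decay.
\<close>

locale weighted_family =
  fixes I :: "'i set" and E :: "'i \<Rightarrow> real" and W :: "'i \<Rightarrow> real \<Rightarrow> real"
  assumes E: "\<And>i. i \<in> I \<Longrightarrow> 0 < E i" "\<And>i. i \<in> I \<Longrightarrow> E i \<le> 1"
    and W: "\<And>i t. i \<in> I \<Longrightarrow> 0 \<le> W i t" and W_bounded: "\<exists>C. \<forall>i\<in>I. \<forall>t. W i t \<le> C"
begin

text \<open>Size \<open>E ^ m\<close>, without and with decay, uniformly in the family.\<close>

definition unif_order where "unif_order m f \<longleftrightarrow> (\<exists>C\<ge>0. \<forall>i\<in>I. \<forall>t. \<bar>f i t\<bar> \<le> C * E i ^ m)"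
definition weighted_order where "weighted_order m f \<longleftrightarrow> (\<exists>C\<ge>0. \<forall>i\<in>I. \<forall>t. \<bar>f i t\<bar> \<le> C * E i ^ m * W i t)"
definition smooth_fam where "smooth_fam f \<longleftrightarrow> (\<forall>i\<in>I. smooth (f i))"

text \<open>
  Profiles of strength \<open>E\<close> vary on the length scale \<open>1 / E\<close>, so every
  differentiation costs a factor \<open>E\<close>. In \<open>derivs_order k m f\<close> the first
  \<open>k\<close> members of \<open>f\<close>, \<open>f'\<close>, \<open>f''\<close> and so on are
  bounded in this way and decay. In \<open>graded k m f\<close> this holds from \<open>f'\<close> on,
  while \<open>f\<close> itself, which may have nonzero limits, is only bounded.
\<close>

definition derivs_order where "derivs_order k m f \<longleftrightarrow> smooth_fam f \<and> (\<forall>j<k. weighted_order (m + j) (\<lambda>i. (deriv ^^ j) (f i)))"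
definition graded where "graded k m f \<longleftrightarrow> unif_order m f \<and> smooth_fam f \<and> derivs_order k (Suc m) (\<lambda>i. deriv (f i))"

lemma weighted_orderI:
  assumes "\<And>i t. i \<in> I \<Longrightarrow> \<bar>f i t\<bar> \<le> C * E i ^ m * W i t"
  shows "weighted_order m f"
proof -
  have "\<bar>f i t\<bar> \<le> \<bar>C\<bar> * E i ^ m * W i t" if "i \<in> I" for i t
  proof -
    have "C * E i ^ m * W i t \<le> \<bar>C\<bar> * E i ^ m * W i t"
      using E[OF that] W[OF that, of t] by (intro mult_right_mono) auto
    then show ?thesis using assms[OF that, of t] by linarith
  qed
  then show ?thesis unfolding weighted_order_def by (intro exI[of _ "\<bar>C\<bar>"]) auto
qed

lemma unif_orderI:
  assumes "\<And>i t. i \<in> I \<Longrightarrow> \<bar>f i t\<bar> \<le> C * E i ^ m"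
  shows "unif_order m f"
proof -
  have "\<bar>f i t\<bar> \<le> \<bar>C\<bar> * E i ^ m" if "i \<in> I" for i t
  proof -
    have "C * E i ^ m \<le> \<bar>C\<bar> * E i ^ m"
      using E[OF that] by (intro mult_right_mono) auto
    then show ?thesis using assms[OF that, of t] by linarith
  qed
  then show ?thesis unfolding unif_order_def by (intro exI[of _ "\<bar>C\<bar>"]) auto
qed

lemma weighted_orderE: assumes "weighted_order m f" obtains C where "0 \<le> C" "\<And>i t. i \<in> I \<Longrightarrow> \<bar>f i t\<bar> \<le> C * E i ^ m * W i t"
  using assms unfolding weighted_order_def by blast

lemma unif_orderE: assumes "unif_order m f" obtains C where "0 \<le> C" "\<And>i t. i \<in> I \<Longrightarrow> \<bar>f i t\<bar> \<le> C * E i ^ m"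
  using assms unfolding unif_order_def by blast

lemma weighted_order_add: assumes "weighted_order m f" "weighted_order m g" shows "weighted_order m (\<lambda>i t. f i t + g i t)"
proof -
  obtain C where C: "\<And>i t. i \<in> I \<Longrightarrow> \<bar>f i t\<bar> \<le> C * E i ^ m * W i t" using assms(1) by (rule weighted_orderE) (rule that; assumption)
  obtain C' where C': "\<And>i t. i \<in> I \<Longrightarrow> \<bar>g i t\<bar> \<le> C' * E i ^ m * W i t" using assms(2) by (rule weighted_orderE) (rule that; assumption)
  show ?thesis
    by (rule weighted_orderI[of _ "C + C'"], unfold distrib_right, rule order_trans[OF abs_triangle_ineq add_mono[OF C C']])
qed

lemma unif_order_add: assumes "unif_order m f" "unif_order m g" shows "unif_order m (\<lambda>i t. f i t + g i t)"
proof -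
  obtain C where C: "\<And>i t. i \<in> I \<Longrightarrow> \<bar>f i t\<bar> \<le> C * E i ^ m" using assms(1) by (rule unif_orderE) (rule that; assumption)
  obtain C' where C': "\<And>i t. i \<in> I \<Longrightarrow> \<bar>g i t\<bar> \<le> C' * E i ^ m" using assms(2) by (rule unif_orderE) (rule that; assumption)
  show ?thesis
    by (rule unif_orderI[of _ "C + C'"], unfold distrib_right, rule order_trans[OF abs_triangle_ineq add_mono[OF C C']])
qed

lemma unif_order_mult: assumes "unif_order m f" "unif_order k g" shows "unif_order (m + k) (\<lambda>i t. f i t * g i t)"
proof -
  obtain C where C: "0 \<le> C" "\<And>i t. i \<in> I \<Longrightarrow> \<bar>f i t\<bar> \<le> C * E i ^ m" using assms(1) by (rule unif_orderE) (rule that; assumption)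
  obtain C' where C': "0 \<le> C'" "\<And>i t. i \<in> I \<Longrightarrow> \<bar>g i t\<bar> \<le> C' * E i ^ k" using assms(2) by (rule unif_orderE) (rule that; assumption)
  show ?thesis
  proof (rule unif_orderI[of _ "C * C'"])
    fix i t assume i: "i \<in> I"
    have "\<bar>f i t * g i t\<bar> \<le> (C * E i ^ m) * (C' * E i ^ k)"
      unfolding abs_mult by (intro mult_mono C(2) C'(2) i) (use C(1) E(1)[OF i] in auto)
    then show "\<bar>f i t * g i t\<bar> \<le> C * C' * E i ^ (m + k)" by (simp add: power_add mult_ac)
  qed
qed

lemma weighted_order_mult: assumes "weighted_order m f" "unif_order k g" shows "weighted_order (m + k) (\<lambda>i t. f i t * g i t)"
proof -
  obtain C where C: "0 \<le> C" "\<And>i t. i \<in> I \<Longrightarrow> \<bar>f i t\<bar> \<le> C * E i ^ m * W i t" using assms(1) by (rule weighted_orderE) (rule that; assumption)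
  obtain C' where C': "0 \<le> C'" "\<And>i t. i \<in> I \<Longrightarrow> \<bar>g i t\<bar> \<le> C' * E i ^ k" using assms(2) by (rule unif_orderE) (rule that; assumption)
  show ?thesis
  proof (rule weighted_orderI[of _ "C * C'"])
    fix i t assume i: "i \<in> I"
    have "\<bar>f i t * g i t\<bar> \<le> (C * E i ^ m * W i t) * (C' * E i ^ k)"
      unfolding abs_mult by (intro mult_mono C(2) C'(2) i) (use C(1) E(1)[OF i] W[OF i, of t] in auto)
    then show "\<bar>f i t * g i t\<bar> \<le> C * C' * E i ^ (m + k) * W i t" by (simp add: power_add mult_ac)
  qed
qed

lemma weighted_order_imp_unif_order: assumes "weighted_order m f" shows "unif_order m f"
proof -
  obtain C where C: "0 \<le> C" "\<And>i t. i \<in> I \<Longrightarrow> \<bar>f i t\<bar> \<le> C * E i ^ m * W i t" using assms(1) by (rule weighted_orderE) (rule that; assumption)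
  obtain B where B: "\<And>i t. i \<in> I \<Longrightarrow> W i t \<le> B" using W_bounded by blast
  show ?thesis
  proof (rule unif_orderI[of _ "C * B"])
    fix i t assume i: "i \<in> I"
    have "C * E i ^ m * W i t \<le> C * E i ^ m * B" using C(1) E(1)[OF i] by (intro mult_left_mono B i) auto
    then show "\<bar>f i t\<bar> \<le> C * B * E i ^ m" using C(2)[OF i, of t] by (simp add: mult_ac)
  qed
qed

lemma weighted_order_weaken: assumes "weighted_order k f" "m \<le> k" shows "weighted_order m f"
proof -
  obtain C where C: "0 \<le> C" "\<And>i t. i \<in> I \<Longrightarrow> \<bar>f i t\<bar> \<le> C * E i ^ k * W i t" using assms(1) by (rule weighted_orderE) (rule that; assumption)
  show ?thesis
  proof (rule weighted_orderI[of _ C])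
    fix i t assume i: "i \<in> I"
    have "C * E i ^ k * W i t \<le> C * E i ^ m * W i t"
      using C(1) E[OF i] W[OF i] assms(2) by (intro mult_right_mono mult_left_mono power_decreasing) auto
    then show "\<bar>f i t\<bar> \<le> C * E i ^ m * W i t" using C(2)[OF i, of t] by linarith
  qed
qed

lemma unif_order_weaken: assumes "unif_order k f" "m \<le> k" shows "unif_order m f"
proof -
  obtain C where C: "0 \<le> C" "\<And>i t. i \<in> I \<Longrightarrow> \<bar>f i t\<bar> \<le> C * E i ^ k" using assms(1) by (rule unif_orderE) (rule that; assumption)
  show ?thesis
  proof (rule unif_orderI[of _ C])
    fix i t assume i: "i \<in> I"
    have "C * E i ^ k \<le> C * E i ^ m"
      using C(1) E[OF i] assms(2) by (intro mult_left_mono power_decreasing) auto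
    then show "\<bar>f i t\<bar> \<le> C * E i ^ m" using C(2)[OF i, of t] by linarith
  qed
qed

lemma weighted_order_cong: "(\<And>i. i \<in> I \<Longrightarrow> f i = g i) \<Longrightarrow> weighted_order m f \<longleftrightarrow> weighted_order m g" unfolding weighted_order_def by simp
lemma derivs_order_cong: "(\<And>i. i \<in> I \<Longrightarrow> f i = g i) \<Longrightarrow> derivs_order k m f \<longleftrightarrow> derivs_order k m g"
  unfolding derivs_order_def weighted_order_def smooth_fam_def by simp

lemma smooth_fam_deriv: "smooth_fam f \<Longrightarrow> smooth_fam (\<lambda>i. deriv (f i))" unfolding smooth_fam_def by (blast intro: smooth_deriv)

lemma derivs_order_0: "derivs_order 0 m f \<longleftrightarrow> smooth_fam f" by (simp add: derivs_order_def)

lemma derivs_order_Suc: "derivs_order (Suc k) m f \<longleftrightarrow> smooth_fam f \<and> weighted_order m f \<and> derivs_order k (Suc m) (\<lambda>i. deriv (f i))"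
proof -
  have "(\<forall>j<Suc k. weighted_order (m + j) (\<lambda>i. (deriv ^^ j) (f i))) \<longleftrightarrow>
      weighted_order m f \<and> (\<forall>j<k. weighted_order (Suc m + j) (\<lambda>i. (deriv ^^ j) (deriv (f i))))"
    unfolding All_less_Suc2 funpow_Suc_right by simp
  then show ?thesis unfolding derivs_order_def using smooth_fam_deriv by blast
qed

lemma derivs_order_Suc_last: "derivs_order (Suc k) m f \<longleftrightarrow> derivs_order k m f \<and> weighted_order (m + k) (\<lambda>i. (deriv ^^ k) (f i))"
  unfolding derivs_order_def by (auto simp: less_Suc_eq)

lemma derivs_order_SucD: "derivs_order (Suc k) m f \<Longrightarrow> derivs_order k m f" by (simp add: derivs_order_Suc_last)

lemma derivs_order_weaken: "derivs_order k n f \<Longrightarrow> m \<le> n \<Longrightarrow> derivs_order k m f"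
  unfolding derivs_order_def by (auto intro: weighted_order_weaken)

lemma graded_SucD: "graded (Suc k) m f \<Longrightarrow> graded k m f" by (auto simp: graded_def intro: derivs_order_SucD)

lemma graded_weaken: "graded k n f \<Longrightarrow> m \<le> n \<Longrightarrow> graded k m f"
  unfolding graded_def by (auto intro: unif_order_weaken derivs_order_weaken)

lemma derivs_order_imp_graded: "derivs_order (Suc k) m f \<Longrightarrow> graded k m f"
  unfolding derivs_order_Suc graded_def by (auto intro: weighted_order_imp_unif_order)

lemma smooth_fam_add: "smooth_fam f \<Longrightarrow> smooth_fam g \<Longrightarrow> smooth_fam (\<lambda>i t. f i t + g i t)" unfolding smooth_fam_def by (auto intro: smooth_add)
lemma smooth_fam_mult: "smooth_fam f \<Longrightarrow> smooth_fam g \<Longrightarrow> smooth_fam (\<lambda>i t. f i t * g i t)" unfolding smooth_fam_def by (auto intro: smooth_mult)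

lemma derivs_order_add: "derivs_order k m f \<Longrightarrow> derivs_order k m g \<Longrightarrow> derivs_order k m (\<lambda>i t. f i t + g i t)"
proof -
  assume f: "derivs_order k m f" and g: "derivs_order k m g"
  then have smooth_fam: "smooth_fam f" "smooth_fam g" by (auto simp: derivs_order_def)
  have "weighted_order (m + j) (\<lambda>i. (deriv ^^ j) (\<lambda>t. f i t + g i t))" if "j < k" for j
  proof -
    have "weighted_order (m + j) (\<lambda>i t. (deriv ^^ j) (f i) t + (deriv ^^ j) (g i) t)"
      using f g that unfolding derivs_order_def by (intro weighted_order_add) auto
    then show ?thesis
      by (subst weighted_order_cong[of _ "\<lambda>i t. (deriv ^^ j) (f i) t + (deriv ^^ j) (g i) t"])
        (use smooth_fam in \<open>auto simp: funpow_deriv_add smooth_fam_def\<close>)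
  qed
  then show ?thesis unfolding derivs_order_def using smooth_fam_add[OF smooth_fam] by blast
qed

lemma deriv_mult_family:
  assumes "smooth_fam f" "smooth_fam g"
  shows "derivs_order k m (\<lambda>i. deriv (\<lambda>t. f i t * g i t)) \<longleftrightarrow> derivs_order k m (\<lambda>i t. deriv (f i) t * g i t + deriv (g i) t * f i t)"
  by (rule derivs_order_cong) (use assms in \<open>auto simp: smooth_fam_def deriv_mult_fun mult.commute\<close>)

text \<open>
  It is enough that one factor decays. By the product rule the derivative is a sum of two products of
  the same kind, one of them with the roles of the factors exchanged, since the derivative of the
  graded factor decays.
\<close>

lemma derivs_order_mult_graded: "derivs_order (Suc k) m f \<Longrightarrow> graded k n g \<Longrightarrow> derivs_order (Suc k) (m + n) (\<lambda>i t. f i t * g i t)"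
proof (induction k arbitrary: m n f g)
  case 0
  then show ?case unfolding derivs_order_Suc[of 0] derivs_order_0 graded_def by (auto intro: smooth_fam_deriv smooth_fam_mult weighted_order_mult)
next
  case (Suc k)
  have smooth_fam: "smooth_fam f" "smooth_fam g" using Suc.prems by (auto simp: derivs_order_def graded_def)
  have "derivs_order (Suc k) (Suc m + n) (\<lambda>i t. deriv (f i) t * g i t)"
    by (rule Suc.IH) (use Suc.prems in \<open>auto simp: derivs_order_Suc[of "Suc k"] intro: graded_SucD\<close>)
  moreover have "derivs_order (Suc k) (Suc n + m) (\<lambda>i t. deriv (g i) t * f i t)"
    by (rule Suc.IH) (use Suc.prems in \<open>auto simp: graded_def[of "Suc k"] intro: graded_SucD derivs_order_imp_graded\<close>)
  ultimately have "derivs_order (Suc k) (Suc (m + n)) (\<lambda>i t. deriv (f i) t * g i t + deriv (g i) t * f i t)"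
    by (intro derivs_order_add) (simp_all add: add.commute)
  then have "derivs_order (Suc k) (Suc (m + n)) (\<lambda>i. deriv (\<lambda>t. f i t * g i t))"
    by (simp add: deriv_mult_family[OF smooth_fam])
  moreover have "weighted_order (m + n) (\<lambda>i t. f i t * g i t)"
    by (rule weighted_order_mult) (use Suc.prems in \<open>auto simp: derivs_order_Suc graded_def\<close>)
  ultimately show ?case unfolding derivs_order_Suc[of "Suc k"] using smooth_fam_mult[OF smooth_fam] by simp
qed

lemma derivs_order_mult_graded': "derivs_order k m f \<Longrightarrow> graded k n g \<Longrightarrow> derivs_order k (m + n) (\<lambda>i t. f i t * g i t)"
proof (cases k)
  case 0
  assume "derivs_order k m f" "graded k n g"
  then show ?thesis using 0 by (simp add: derivs_order_0 graded_def smooth_fam_mult)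
next
  case (Suc j)
  assume "derivs_order k m f" "graded k n g"
  then show ?thesis using derivs_order_mult_graded[of j m f n g] graded_SucD[of j n g] Suc by simp
qed

lemma graded_add: "graded k m f \<Longrightarrow> graded k m g \<Longrightarrow> graded k m (\<lambda>i t. f i t + g i t)"
proof -
  assume f: "graded k m f" and g: "graded k m g"
  then have smooth_fam: "smooth_fam f" "smooth_fam g" by (auto simp: graded_def)
  have "derivs_order k (Suc m) (\<lambda>i t. deriv (f i) t + deriv (g i) t)"
    using f g by (intro derivs_order_add) (auto simp: graded_def)
  then have "derivs_order k (Suc m) (\<lambda>i. deriv (\<lambda>t. f i t + g i t))"
    by (subst derivs_order_cong[of _ "\<lambda>i t. deriv (f i) t + deriv (g i) t"]) (use smooth_fam in \<open>auto simp: smooth_fam_def deriv_add_fun\<close>)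
  then show ?thesis using f g unfolding graded_def by (auto intro: unif_order_add smooth_fam_add)
qed

lemma graded_mult: "graded k m f \<Longrightarrow> graded k n g \<Longrightarrow> graded k (m + n) (\<lambda>i t. f i t * g i t)"
proof -
  assume f: "graded k m f" and g: "graded k n g"
  then have smooth_fam: "smooth_fam f" "smooth_fam g" by (auto simp: graded_def)
  have "derivs_order k (Suc m + n) (\<lambda>i t. deriv (f i) t * g i t)"
    by (rule derivs_order_mult_graded'[OF _ g]) (use f in \<open>auto simp: graded_def\<close>)
  moreover have "derivs_order k (Suc n + m) (\<lambda>i t. deriv (g i) t * f i t)"
    by (rule derivs_order_mult_graded'[OF _ f]) (use g in \<open>auto simp: graded_def\<close>)
  ultimately have "derivs_order k (Suc (m + n)) (\<lambda>i. deriv (\<lambda>t. f i t * g i t))"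
    unfolding deriv_mult_family[OF smooth_fam] by (intro derivs_order_add) (simp_all add: add.commute)
  then show ?thesis using f g unfolding graded_def by (auto intro: unif_order_mult smooth_fam_mult)
qed

lemma weighted_order_zero: "weighted_order m (\<lambda>i t. 0)" by (rule weighted_orderI[of _ 0]) simp

lemma funpow_deriv_zero: "(deriv ^^ j) (\<lambda>t::real. 0::real) = (\<lambda>t. 0)"
  by (induction j) simp_all

lemma graded_param:
  assumes "\<And>i. i \<in> I \<Longrightarrow> \<bar>c i\<bar> \<le> C * E i ^ m"
  shows "graded k m (\<lambda>i t. c i)"
proof -
  have "unif_order m (\<lambda>i t. c i)" using assms by (rule unif_orderI)
  moreover have "derivs_order k n (\<lambda>i t. 0)" for n
    unfolding derivs_order_def funpow_deriv_zero using weighted_order_zero by (simp add: smooth_fam_def smooth_const)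
  ultimately show ?thesis unfolding graded_def by (simp add: smooth_fam_def smooth_const)
qed

lemma graded_const: "graded k 0 (\<lambda>i t. c)" by (rule graded_param[of _ "\<bar>c\<bar>"]) simp

lemma graded_cmult: "graded k m f \<Longrightarrow> graded k m (\<lambda>i t. c * f i t)"
  using graded_mult[OF graded_const[of k c], of m f] by simp

lemma graded_uminus: "graded k m f \<Longrightarrow> graded k m (\<lambda>i t. - f i t)"
  using graded_cmult[of k m f "-1"] by simp

lemma graded_diff: assumes "graded k m f" "graded k m g" shows "graded k m (\<lambda>i t. f i t - g i t)"
  using graded_add[OF assms(1) graded_uminus[OF assms(2)]] by simp

lemma graded_imp_weighted_order: "graded k m f \<Longrightarrow> j < k \<Longrightarrow> weighted_order (Suc m + j) (\<lambda>i. (deriv ^^ Suc j) (f i))"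
  unfolding graded_def derivs_order_def funpow_Suc_right by auto

lemma graded_Suc: "graded (Suc k) m f \<longleftrightarrow> graded k m f \<and> weighted_order (Suc m + k) (\<lambda>i. (deriv ^^ Suc k) (f i))"
  unfolding graded_def derivs_order_Suc_last funpow_Suc_right by auto

text \<open>
  The derivative of \<open>1 / f\<close> is \<open>- f' / f\<^sup>2\<close>, so the bounds on \<open>1
  / f\<close> of one order give those of the next. The order \<open>2\<close> in the second part is
  better than what membership in \<open>graded k 0\<close> says: \<open>f\<close> is constant up to a
  term of order \<open>1\<close>.
\<close>

lemma graded_inverse:
  assumes f: "\<And>k. graded k 1 (\<lambda>i t. f i t - c)" and low: "\<And>i t. i \<in> I \<Longrightarrow> b \<le> f i t" and b: "0 < b"
  shows "graded k 0 (\<lambda>i t. inverse (f i t)) \<and> derivs_order k 2 (\<lambda>i. deriv (\<lambda>t. inverse (f i t)))"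
proof (induction k)
  case 0
  have "graded 0 0 (\<lambda>i t. (f i t - c) + c)" by (intro graded_add graded_const graded_weaken[OF f]) simp
  then have Sf: "smooth_fam f" by (simp add: graded_def)
  have "unif_order 0 (\<lambda>i t. inverse (f i t))"
  proof (rule unif_orderI[of _ "inverse b"])
    fix i t assume "i \<in> I"
    from low[OF this, of t] b show "\<bar>inverse (f i t)\<bar> \<le> inverse b * E i ^ 0"
      by (simp add: le_imp_inverse_le)
  qed
  moreover have "smooth_fam (\<lambda>i t. inverse (f i t))" unfolding smooth_fam_def
  proof
    fix i assume i: "i \<in> I"
    show "smooth (\<lambda>t. inverse (f i t))"
    proof (rule smooth_inverse)
      show "smooth (f i)" using Sf i by (simp add: smooth_fam_def)
      show "f i t \<noteq> 0" for t using low[OF i, of t] b by linarith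
    qed
  qed
  ultimately show ?case unfolding graded_def derivs_order_0 by (auto intro: smooth_fam_deriv)
next
  case (Suc k)
  have "graded k 0 (\<lambda>i t. (f i t - c) + c)" by (intro graded_add graded_const graded_weaken[OF f]) simp
  then have Sf: "smooth_fam f" by (simp add: graded_def)
  have d: "deriv (\<lambda>t. f i t - c) = deriv (f i)" if "i \<in> I" for i
    by (intro deriv_eqI) (use Sf that in \<open>auto intro!: derivative_eq_intros smooth_has_derivative simp: smooth_fam_def\<close>)
  have Df: "derivs_order (Suc k) 2 (\<lambda>i. deriv (f i))"
  proof -
    have "derivs_order (Suc k) 2 (\<lambda>i. deriv (\<lambda>t. f i t - c)) \<longleftrightarrow> derivs_order (Suc k) 2 (\<lambda>i. deriv (f i))"
      by (rule derivs_order_cong) (rule d)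
    then show ?thesis using f[of "Suc k"] by (simp add: graded_def numeral_2_eq_2)
  qed
  have "derivs_order (Suc k) 2 (\<lambda>i t. (- 1) * (deriv (f i) t * inverse (f i t) * inverse (f i t)))"
  proof -
    have 1: "derivs_order (Suc k) (2 + 0 + 0) (\<lambda>i t. deriv (f i) t * inverse (f i t) * inverse (f i t))"
      by (intro derivs_order_mult_graded Df Suc.IH[THEN conjunct1])
    have "derivs_order (Suc k) (2 + 0 + 0 + 0) (\<lambda>i t. (deriv (f i) t * inverse (f i t) * inverse (f i t)) * (- 1))"
      by (rule derivs_order_mult_graded[OF 1 graded_const])
    then show ?thesis by (simp add: mult.commute)
  qed
  moreover have "deriv (\<lambda>t. inverse (f i t)) = (\<lambda>t. (- 1) * (deriv (f i) t * inverse (f i t) * inverse (f i t)))" if "i \<in> I" for i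
  proof (rule deriv_eqI)
    fix t
    have nz: "f i t \<noteq> 0" using low[OF that, of t] b by linarith
    have fd: "(f i has_real_derivative deriv (f i) t) (at t)"
      using Sf that by (auto simp: smooth_fam_def intro: smooth_has_derivative)
    show "((\<lambda>t. inverse (f i t)) has_real_derivative (- 1) * (deriv (f i) t * inverse (f i t) * inverse (f i t))) (at t)"
      using DERIV_inverse'[OF fd nz] by (simp add: mult_ac)
  qed
  ultimately have "derivs_order (Suc k) 2 (\<lambda>i. deriv (\<lambda>t. inverse (f i t)))" by (subst derivs_order_cong) auto
  then show ?case using Suc.IH derivs_order_weaken[of "Suc k" 2 _ 1] unfolding graded_def by (simp add: smooth_fam_def)
qed

end

section \<open>Higher derivatives of the profiles\<close>

context nsp
begin

lemma normal_sys_smooth: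
  assumes sys: "normal_sys np z g h"
  shows "smooth z" "smooth g" "smooth h"
proof -
  have "ndiff k z \<and> ndiff k g \<and> ndiff k h" for k
  proof (induction k)
    case (Suc k)
    then have n: "ndiff k z" "ndiff k g" "ndiff k h" by auto
    have p: "ndiff k (\<lambda>t. psi (g t) (h t))"
      unfolding psi_def divide_inverse by (intro ndiff_intros n)
    have e: "ndiff k (\<lambda>t. el (g t) (h t))" unfolding el_def by (intro ndiff_intros n p)
    have a: "ndiff k (\<lambda>t. al (z t) (g t) (h t))" unfolding al_def by (intro ndiff_intros n p)
    have N1: "ndiff k (\<lambda>t. N1 np (al (z t) (g t) (h t)) (el (g t) (h t)) (psi (g t) (h t)))"
      unfolding N1_def by (intro ndiff_intros a e p)
    have N2: "ndiff k (\<lambda>t. N2 np (al (z t) (g t) (h t)) (el (g t) (h t)) (psi (g t) (h t)))"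
      unfolding N2_def by (intro ndiff_intros a e p N1)
    note sys = sys[unfolded normal_sys_def, rule_format]
    show ?case
      using ndiff_SucI[OF sys[THEN conjunct1] N1]
        ndiff_SucI[OF sys[THEN conjunct2, THEN conjunct1] ndiff_add[OF ndiff_mult[OF ndiff_const n(2)] N2]]
        ndiff_SucI[OF sys[THEN conjunct2, THEN conjunct2] ndiff_add[OF ndiff_mult[OF ndiff_const n(3)] N2]]
      by blast
  qed simp
  then show "smooth z" "smooth g" "smooth h" unfolding smooth_iff_ndiff by auto
qed

end

text \<open>
  One profile for each value \<open>i\<close> of the density at plus infinity, so that bounds can be
  stated uniformly in the shock strength \<open>nm - i\<close>.
\<close>

locale profile_family = nsp +
  fixes I :: "real set" and Z G H :: "real \<Rightarrow> real \<Rightarrow> real"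
  assumes prof: "\<And>i. i \<in> I \<Longrightarrow> small_profile T \<mu> l nm i (Z i) (G i) (H i)"
begin

text \<open>
  \<open>|z'|\<close> is of size \<open>(nm - i)\<^sup>2\<close> (\<open>w_le\<close>), so this is
  bounded uniformly in the family; it decays exponentially and satisfies the Harnack inequality.
\<close>

abbreviation W where "W \<equiv> \<lambda>i t. \<bar>deriv (Z i) t\<bar> / (nm - i)\<^sup>2"

lemma member:
  assumes "i \<in> I"
  shows "i \<in> near_states" "0 < nm - i" "nm - i \<le> 1" "normal_sys i (Z i) (G i) (H i)"
    "2 * coord_const * growth_rate * (nm - i) \<le> gap / 4"
proof -
  interpret p: small_profile T \<mu> l nm i "Z i" "G i" "H i" by (rule prof[OF assms])
  show "i \<in> near_states" "0 < nm - i" "normal_sys i (Z i) (G i) (H i)"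
    using p.np p.eps(1) p.sys by (simp_all add: p.\<epsilon>_def)
  show "nm - i \<le> 1" using p.eps_ball p.ball_le max_radius(2) by linarith
  show "2 * coord_const * growth_rate * (nm - i) \<le> gap / 4" using max_radius(3)[OF p.small(1)] by (simp add: mult_ac)
qed

sublocale weighted_family I "\<lambda>i. nm - i" W
proof
  show "0 < nm - i" "nm - i \<le> 1" if "i \<in> I" for i using member[OF that] by auto
  show "0 \<le> W i t" if "i \<in> I" for i t by simp
  show "\<exists>C. \<forall>i\<in>I. \<forall>t. W i t \<le> C"
  proof (intro exI ballI allI)
    fix i t assume i: "i \<in> I"
    interpret p: small_profile T \<mu> l nm i "Z i" "G i" "H i" by (rule prof[OF i])
    show "W i t \<le> 4 * nonlin_const * coord_const\<^sup>2"
      using p.w_le[of t] p.eps(1) by (simp add: p.w_def p.\<epsilon>_def pos_divide_le_eq)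
  qed
qed

definition AL where "AL i t = al (Z i t) (G i t) (H i t)"
definition EL where "EL i t = el (G i t) (H i t)"
definition PS where "PS i t = psi (G i t) (H i t)"
definition M1 where "M1 i t = N1 i (AL i t) (EL i t) (PS i t)"
definition M2 where "M2 i t = N2 i (AL i t) (EL i t) (PS i t)"

lemma family_smooth: "smooth_fam Z" "smooth_fam G" "smooth_fam H"
  using normal_sys_smooth[OF member(4)] unfolding smooth_fam_def by blast+

lemma family_deriv:
  assumes "i \<in> I"
  shows "deriv (Z i) = M1 i" "deriv (G i) = (\<lambda>t. r1 * G i t + M2 i t)" "deriv (H i) = (\<lambda>t. r2 * H i t + M2 i t)"
  using member(4)[OF assms] unfolding normal_sys_def M1_def M2_def AL_def EL_def PS_def
  by (auto intro!: deriv_eqI)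

lemma graded_coordinates:
  assumes "graded k 1 Z" "graded k 1 G" "graded k 1 H"
  shows "graded k 1 AL" "graded k 1 EL" "graded k 1 PS"
proof -
  have "graded k 1 (\<lambda>i t. psi_const * (G i t - H i t))" by (intro graded_cmult graded_diff assms)
  then show p: "graded k 1 PS" unfolding PS_def[abs_def] psi_def psi_const_def by simp
  show "graded k 1 AL" unfolding AL_def[abs_def] al_def PS_def[symmetric] by (intro graded_cmult graded_add assms p)
  show "graded k 1 EL" unfolding EL_def[abs_def] el_def PS_def[symmetric] by (intro graded_cmult graded_diff assms p)
qed

lemma graded_nonlinearity:
  assumes "graded k 1 Z" "graded k 1 G" "graded k 1 H"
  shows "graded k 2 M1" "graded k 2 M2"
proof -
  note x = graded_coordinates[OF assms]
  note c = graded_const[of k]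
  have kk: "graded k 0 (\<lambda>i t. 1 / (\<mu> * flux i))"
    by (rule graded_param[of _ "2 / (\<mu> * sound * nm)"]) (use flux_param_bounds(1)[OF member(1)] in simp)
  have d: "graded k 1 (\<lambda>i t. nm\<^sup>2 / (\<mu> * flux i) - c0)"
    by (rule graded_param[of _ "2 / (\<mu> * sound)"]) (use flux_param_bounds(2)[OF member(1)] in simp)
  have eps: "graded k 1 (\<lambda>i t. nm - i)"
    by (rule graded_param[of _ 1]) (use member(2) in \<open>auto simp: less_imp_le\<close>)
  have na: "graded k 0 (\<lambda>i t. nm + AL i t)" by (intro graded_add c graded_weaken[OF x(1)]) simp
  have t1: "graded k 2 (\<lambda>i t. (T + 1) * (nm + AL i t) * AL i t * (AL i t + (nm - i)))"
    using graded_mult[OF graded_mult[OF graded_mult[OF c na] x(1)] graded_add[OF x(1) eps]] by (simp only: add_0 add_0_right one_add_one)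
  have t2a: "graded k 1 (\<lambda>i t. 2 * nm * AL i t + AL i t * AL i t)"
    using graded_add[OF graded_cmult[OF x(1)] graded_weaken[OF graded_mult[OF x(1) x(1)], of 1]] by simp
  have t2: "graded k 2 (\<lambda>i t. (2 * nm * AL i t + AL i t * AL i t) * EL i t)"
    using graded_mult[OF t2a x(2)] by (simp only: add_0 add_0_right one_add_one)
  have t3: "graded k 2 (\<lambda>i t. (nm + AL i t) * (nm + AL i t) * (l\<^sup>2 / 2) * (PS i t * PS i t))"
    using graded_mult[OF graded_mult[OF graded_mult[OF na na] c] graded_mult[OF x(3) x(3)]] by (simp only: add_0 add_0_right one_add_one)
  have t4: "graded k 2 (\<lambda>i t. (nm\<^sup>2 / (\<mu> * flux i) - c0) * EL i t)"
    using graded_mult[OF d x(2)] by (simp only: add_0 add_0_right one_add_one)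
  show n1: "graded k 2 M1"
    using graded_add[OF graded_mult[OF kk graded_diff[OF graded_add[OF t1 t2] t3], unfolded add_0] t4]
    unfolding M1_def[abs_def] N1_def .
  show "graded k 2 M2"
    using graded_diff[OF graded_mult[OF graded_add[OF x(1,2)] x(3), unfolded one_add_one] n1]
    unfolding M2_def[abs_def] N2_def M1_def[abs_def] .
qed

text \<open>
  A derivative \<open>y\<close> of a hyperbolic component solves \<open>y' = r * y + m\<close>, where
  \<open>m\<close> is the derivative of the nonlinear term. A bounded solution is no larger than its
  forcing: the Harnack inequality bounds the weight in \<open>m\<close> at time \<open>s + t\<close>
  by the weight at time \<open>t\<close>, up to a factor \<open>2 * cosh (\<eta> * s)\<close> that the
  estimate \<open>hyperbolic_bound\<close> admits. The nonlinear term being quadratic, this gains one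
  order over what \<open>graded\<close> states.
\<close>

lemma slaved_derivatives:
  assumes N: "graded (Suc k) 2 M2" and F: "graded (Suc k) 1 F"
    and F': "\<And>i. i \<in> I \<Longrightarrow> deriv (F i) = (\<lambda>t. r * F i t + M2 i t)" and r: "gap \<le> \<bar>r\<bar>"
  shows "weighted_order (3 + k) (\<lambda>i. (deriv ^^ Suc k) (F i))"
proof -
  have SF: "smooth_fam F" and SN: "smooth_fam M2" using F N by (auto simp: graded_def)
  have "weighted_order (3 + k) (\<lambda>i. (deriv ^^ Suc k) (M2 i))" using graded_imp_weighted_order[OF N, of k] by (simp add: numeral_3_eq_3 numeral_2_eq_2)
  then obtain C where C: "0 \<le> C" "\<And>i t. i \<in> I \<Longrightarrow> \<bar>(deriv ^^ Suc k) (M2 i) t\<bar> \<le> C * (nm - i) ^ (3 + k) * W i t"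
    by (rule weighted_orderE) (rule that; assumption)
  have "unif_order 0 (\<lambda>i. (deriv ^^ Suc k) (F i))"
    by (rule unif_order_weaken[OF weighted_order_imp_unif_order[OF graded_imp_weighted_order[OF F]]]) auto
  then obtain B where B: "0 \<le> B" "\<And>i t. i \<in> I \<Longrightarrow> \<bar>(deriv ^^ Suc k) (F i) t\<bar> \<le> B * (nm - i) ^ 0"
    by (rule unif_orderE) (rule that; assumption)
  show ?thesis
  proof (rule weighted_orderI[of _ "4 * C / gap"])
    fix i t assume i: "i \<in> I"
    interpret p: small_profile T \<mu> l nm i "Z i" "G i" "H i" by (rule prof[OF i])
    define \<eta> where "\<eta> = 2 * coord_const * growth_rate * (nm - i)"
    have \<eta>: "0 \<le> \<eta>" "\<eta> \<le> gap / 4"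
      using member[OF i] coord_const_ge_1 growth_rate_pos by (auto simp: \<eta>_def)
    define y where "y = (deriv ^^ Suc k) (F i)"
    define m where "m = (deriv ^^ Suc k) (M2 i)"
    define X where "X = C * (nm - i) ^ (3 + k) * W i t"
    have sF: "smooth (F i)" and sN: "smooth (M2 i)" using SF SN i by (auto simp: smooth_fam_def)
    have dF: "deriv y = (\<lambda>t. r * y t + m t)"
    proof -
      have "deriv y = (deriv ^^ Suc k) (deriv (F i))" unfolding y_def
        by (metis comp_apply funpow.simps(2) funpow_Suc_right)
      also have "\<dots> = (\<lambda>t. r * y t + m t)"
        unfolding F'[OF i] y_def m_def
        by (subst funpow_deriv_add) (auto intro: smooth_mult smooth_const sF sN simp: funpow_deriv_cmult[OF sF] simp del: funpow.simps)
      finally show ?thesis .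
    qed
    have "((\<lambda>s. y (s + t)) has_real_derivative r * y (s + t) + m (s + t)) (at s)" for s
    proof -
      have "(y has_real_derivative r * y (s + t) + m (s + t)) (at (s + t))"
        using smooth_has_derivative[of y] smooth_funpow_deriv[OF sF, of "Suc k"] dF unfolding y_def by simp
      then show ?thesis unfolding DERIV_shift .
    qed
    moreover have "\<bar>m (s + t)\<bar> \<le> 2 * X * cosh (\<eta> * s)" for s
    proof -
      have "W i (s + t) \<le> 2 * W i t * cosh (\<eta> * s)"
      proof -
        have "\<bar>deriv (Z i) (s + t)\<bar> \<le> 2 * \<bar>deriv (Z i) t\<bar> * cosh (\<eta> * s)"
          using p.harnack'(1)[of "s + t" t] unfolding p.w_def p.\<epsilon>_def \<eta>_def by simp
        then have "W i (s + t) \<le> 2 * \<bar>deriv (Z i) t\<bar> * cosh (\<eta> * s) / (nm - i)\<^sup>2"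
          by (rule divide_right_mono) simp
        then show ?thesis by simp
      qed
      then have "C * (nm - i) ^ (3 + k) * W i (s + t) \<le> C * (nm - i) ^ (3 + k) * (2 * W i t * cosh (\<eta> * s))"
        using C(1) member(2)[OF i] by (intro mult_left_mono) auto
      also have "\<dots> = 2 * X * cosh (\<eta> * s)" by (simp add: X_def)
      finally show ?thesis using C(2)[OF i, of "s + t"] unfolding m_def by linarith
    qed
    moreover have "\<bar>y (s + t)\<bar> \<le> B * cosh (\<eta> * s)" for s
      using B(2)[OF i, of "s + t"] le_mult_cosh[OF B(1), of "\<eta> * s"] unfolding y_def by simp
    ultimately have "\<bar>y (0 + t)\<bar> \<le> 2 * X / (\<bar>r\<bar> - \<eta>) * cosh (\<eta> * 0)"
      by (rule hyperbolic_bound) (use \<eta> r gap in auto)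
    also have "\<dots> \<le> 2 * X / (gap / 2)"
    proof -
      have "0 \<le> X" using C(1) member(2)[OF i] by (simp add: X_def)
      then have "2 * X / (\<bar>r\<bar> - \<eta>) \<le> 2 * X / (gap / 2)"
        using \<eta> r gap(1) by (intro divide_left_mono mult_pos_pos) auto
      then show ?thesis by simp
    qed
    also have "\<dots> = 4 * C / gap * (nm - i) ^ (3 + k) * W i t" by (simp add: X_def mult_ac)
    finally show "\<bar>(deriv ^^ Suc k) (F i) t\<bar> \<le> 4 * C / gap * (nm - i) ^ (3 + k) * W i t"
      unfolding y_def by simp
  qed
qed

lemma family_values: "unif_order 1 Z" "unif_order 1 G" "unif_order 1 H"
proof -
  have b: "\<bar>AL i t\<bar> \<le> 2 * coord_const * (nm - i)" "\<bar>EL i t\<bar> \<le> 2 * coord_const * (nm - i)" "\<bar>PS i t\<bar> \<le> 2 * coord_const * (nm - i)"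
    if "i \<in> I" for i t
  proof -
    interpret p: small_profile T \<mu> l nm i "Z i" "G i" "H i" by (rule prof[OF that])
    show "\<bar>AL i t\<bar> \<le> 2 * coord_const * (nm - i)" "\<bar>EL i t\<bar> \<le> 2 * coord_const * (nm - i)" "\<bar>PS i t\<bar> \<le> 2 * coord_const * (nm - i)"
      using p.in_ball[of t] unfolding AL_def EL_def PS_def p.p_def p.\<epsilon>_def by auto
  qed
  have v: "unif_order 1 AL" "unif_order 1 EL" "unif_order 1 PS" by (rule unif_orderI[of _ "2 * coord_const"]; use b in simp)+
  have cm: "unif_order 1 (\<lambda>i t. c * f i t)" if "unif_order 1 f" for c f
  proof -
    have "unif_order 0 (\<lambda>i t. c)" by (rule unif_orderI[of _ "\<bar>c\<bar>"]) simp
    from unif_order_mult[OF this that] show ?thesis by simp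
  qed
  have "unif_order 1 (\<lambda>i t. AL i t + (- (c0 * l\<^sup>2)) * PS i t)" by (intro unif_order_add cm v)
  then show "unif_order 1 Z" by (simp add: AL_def PS_def al_def eta_contract_eq)
  have "unif_order 1 (\<lambda>i t. EL i t + (l\<^sup>2 * (r1 + c0)) * PS i t)" by (intro unif_order_add cm v)
  then show "unif_order 1 G" by (simp add: EL_def PS_def coordinates_inverse' eta_contract_eq)
  have "unif_order 1 (\<lambda>i t. EL i t + (l\<^sup>2 * (r2 + c0)) * PS i t)" by (intro unif_order_add cm v)
  then show "unif_order 1 H" by (simp add: EL_def PS_def coordinates_inverse' eta_contract_eq)
qed

lemma family_first_derivatives: "weighted_order 2 (\<lambda>i. deriv (Z i))" "weighted_order 3 (\<lambda>i. deriv (G i))" "weighted_order 3 (\<lambda>i. deriv (H i))"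
proof -
  show "weighted_order 2 (\<lambda>i. deriv (Z i))"
  proof (rule weighted_orderI[of _ 1])
    fix i t assume "i \<in> I"
    then show "\<bar>deriv (Z i) t\<bar> \<le> 1 * (nm - i)\<^sup>2 * W i t" using member(2)[of i] by simp
  qed
  have b: "\<bar>deriv (G i) t\<bar> + \<bar>deriv (H i) t\<bar> \<le> 4 * coord_const * growth_rate / gap * (nm - i) ^ 3 * W i t" if "i \<in> I" for i t
  proof -
    interpret p: small_profile T \<mu> l nm i "Z i" "G i" "H i" by (rule prof[OF that])
    show ?thesis using p.harnack'(2)[of t] p.eps(1)
      by (simp add: p.w_def p.\<epsilon>_def power3_eq_cube power2_eq_square)
  qed
  show "weighted_order 3 (\<lambda>i. deriv (G i))"
    by (rule weighted_orderI[of _ "4 * coord_const * growth_rate / gap"], rule order_trans[OF _ b]) auto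
  show "weighted_order 3 (\<lambda>i. deriv (H i))"
    by (rule weighted_orderI[of _ "4 * coord_const * growth_rate / gap"], rule order_trans[OF _ b]) auto
qed

text \<open>
  Induction on the number of derivatives. If the coordinates are controlled up to some order, so are
  the nonlinear terms, and the differential equations give one more derivative. For the hyperbolic
  components the term \<open>r * g\<close> has no small factor; there the gain comes from
  \<open>slaved_derivatives\<close>.
\<close>

lemma family_graded: "graded (Suc k) 1 Z \<and> graded (Suc k) 1 G \<and> graded (Suc k) 1 H"
proof (induction k)
  case 0
  have "graded 0 1 Z" "graded 0 1 G" "graded 0 1 H"
    using family_values family_smooth by (auto simp: graded_def derivs_order_0 intro: smooth_fam_deriv)
  then show ?case unfolding graded_Suc[of 0]
    using family_first_derivatives by (auto simp: numeral_2_eq_2[symmetric] intro: weighted_order_weaken)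
next
  case (Suc k)
  then have X: "graded (Suc k) 1 Z" "graded (Suc k) 1 G" "graded (Suc k) 1 H" by auto
  note N = graded_nonlinearity[OF X]
  have bN: "weighted_order (3 + k) (\<lambda>i. (deriv ^^ Suc k) (M1 i))" "weighted_order (3 + k) (\<lambda>i. (deriv ^^ Suc k) (M2 i))"
    using graded_imp_weighted_order[OF N(1), of k] graded_imp_weighted_order[OF N(2), of k] by (simp_all add: numeral_3_eq_3 numeral_2_eq_2)
  have Z: "weighted_order (3 + k) (\<lambda>i. (deriv ^^ Suc (Suc k)) (Z i))"
  proof -
    have e: "(deriv ^^ Suc (Suc k)) (Z i) = (deriv ^^ Suc k) (M1 i)" if "i \<in> I" for i
      unfolding funpow_Suc_right[of "Suc k"] comp_apply family_deriv(1)[OF that] ..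
    show ?thesis by (rule iffD2[OF weighted_order_cong[OF e] bN(1)])
  qed
  have F: "weighted_order (3 + k) (\<lambda>i. (deriv ^^ Suc (Suc k)) (F i))"
    if F': "\<And>i. i \<in> I \<Longrightarrow> deriv (F i) = (\<lambda>t. r * F i t + M2 i t)" and r: "gap \<le> \<bar>r\<bar>" and AF: "graded (Suc k) 1 F"
    for F r
  proof -
    have smooth_fam: "smooth_fam F" "smooth_fam M2" using AF N by (auto simp: graded_def)
    have e: "(deriv ^^ Suc (Suc k)) (F i) = (\<lambda>t. r * (deriv ^^ Suc k) (F i) t + (deriv ^^ Suc k) (M2 i) t)" if i: "i \<in> I" for i
    proof -
      have s: "smooth (F i)" "smooth (M2 i)" using smooth_fam i by (auto simp: smooth_fam_def)
      show ?thesis unfolding funpow_Suc_right[of "Suc k"] comp_apply F'[OF i]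
        by (subst funpow_deriv_add) (auto intro: smooth_mult smooth_const s simp: funpow_deriv_cmult[OF s(1)] simp del: funpow.simps)
    qed
    have "weighted_order (3 + k) (\<lambda>i t. r * (deriv ^^ Suc k) (F i) t + (deriv ^^ Suc k) (M2 i) t)"
    proof (rule weighted_order_add[OF _ bN(2)])
      have "unif_order 0 (\<lambda>i t. r)" by (rule unif_orderI[of _ "\<bar>r\<bar>"]) simp
      from weighted_order_mult[OF slaved_derivatives[OF N(2) AF F' r] this]
      show "weighted_order (3 + k) (\<lambda>i t. r * (deriv ^^ Suc k) (F i) t)" by (simp add: mult.commute)
    qed
    then show ?thesis unfolding weighted_order_def by (simp add: e del: funpow.simps)
  qed
  show ?case unfolding graded_Suc[of "Suc k"]
    using X Z F[OF family_deriv(2) gap(2) X(2)] F[OF family_deriv(3) gap(3) X(3)]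
    by (simp add: numeral_3_eq_3 del: funpow.simps)
qed

text \<open>
  Enough to bound the derivatives of the density, of the potential, whose derivative is
  \<open>p\<close>, and of the velocity, which is affine in \<open>1 / n\<close>. The slope
  \<open>p\<close> has to be bounded with one order more than \<open>n\<close>, which holds because it
  is a combination of hyperbolic components.
\<close>

lemma family_bounds:
  shows "weighted_order (Suc (Suc k)) (\<lambda>i. (deriv ^^ Suc k) (AL i))"
    and "weighted_order (Suc (Suc k)) (\<lambda>i. (deriv ^^ k) (PS i))"
    and "weighted_order (Suc (Suc k)) (\<lambda>i. (deriv ^^ Suc k) (\<lambda>t. inverse (nm + AL i t)))"
proof -
  have X: "graded k 1 Z" "graded k 1 G" "graded k 1 H" for k using family_graded[of k] graded_SucD by blast+
  note C = graded_coordinates[OF X]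
  show "weighted_order (Suc (Suc k)) (\<lambda>i. (deriv ^^ Suc k) (AL i))"
    using graded_imp_weighted_order[OF C(1)[of "Suc k"], of k] by simp
  show "weighted_order (Suc (Suc k)) (\<lambda>i. (deriv ^^ k) (PS i))"
  proof (cases k)
    case 0
    have "weighted_order 2 PS"
    proof (rule weighted_orderI[of _ "4 / nm"])
      fix i t assume i: "i \<in> I"
      interpret p: small_profile T \<mu> l nm i "Z i" "G i" "H i" by (rule prof[OF i])
      show "\<bar>PS i t\<bar> \<le> 4 / nm * (nm - i)\<^sup>2 * W i t"
        using p.p_bounds[of t] p.eps(1) by (simp add: PS_def p.p_def p.w_def p.\<epsilon>_def)
    qed
    then show ?thesis using 0 by (simp add: numeral_2_eq_2)
  next
    case (Suc j)
    have s: "smooth (G i)" "smooth (H i)" if "i \<in> I" for i using family_smooth that by (auto simp: smooth_fam_def)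
    define q where "q = - psi_const"
    have e: "(deriv ^^ Suc j) (PS i) = (\<lambda>t. psi_const * (deriv ^^ Suc j) (G i) t + q * (deriv ^^ Suc j) (H i) t)" if i: "i \<in> I" for i
    proof -
      have "PS i = (\<lambda>t. psi_const * G i t + q * H i t)"
        by (auto simp: PS_def psi_def psi_const_def q_def diff_divide_distrib)
      then show ?thesis
        by (simp only:) (subst funpow_deriv_add, auto intro: smooth_mult smooth_const s[OF i]
            simp: funpow_deriv_cmult[OF s(1)[OF i]] funpow_deriv_cmult[OF s(2)[OF i]] simp del: funpow.simps)
    qed
    note N = graded_nonlinearity[OF X]
    have b: "weighted_order (3 + j) (\<lambda>i. (deriv ^^ Suc j) (G i))" "weighted_order (3 + j) (\<lambda>i. (deriv ^^ Suc j) (H i))"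
      by (rule slaved_derivatives[OF N(2) X(2) family_deriv(2) gap(2)], assumption)
        (rule slaved_derivatives[OF N(2) X(3) family_deriv(3) gap(3)], assumption)
    have cm: "weighted_order n (\<lambda>i t. c * f i t)" if "weighted_order n f" for n c f
    proof -
      have "unif_order 0 (\<lambda>i t. c)" by (rule unif_orderI[of _ "\<bar>c\<bar>"]) simp
      from weighted_order_mult[OF that this] show ?thesis by (simp add: mult.commute)
    qed
    have "weighted_order (3 + j) (\<lambda>i t. psi_const * (deriv ^^ Suc j) (G i) t + q * (deriv ^^ Suc j) (H i) t)"
      by (intro weighted_order_add cm b)
    then have "weighted_order (3 + j) (\<lambda>i. (deriv ^^ Suc j) (PS i))" unfolding weighted_order_def by (simp add: e del: funpow.simps)
    then show ?thesis unfolding Suc by (simp add: numeral_3_eq_3 del: funpow.simps)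
  qed
  have inv: "graded (Suc k) 0 (\<lambda>i t. inverse (nm + AL i t))" "derivs_order (Suc k) 2 (\<lambda>i. deriv (\<lambda>t. inverse (nm + AL i t)))"
  proof -
    have a: "graded k 1 (\<lambda>i t. (nm + AL i t) - nm)" for k using C(1)[of k] by simp
    have low: "nm / 2 \<le> nm + AL i t" if "i \<in> I" for i t
    proof -
      interpret p: small_profile T \<mu> l nm i "Z i" "G i" "H i" by (rule prof[OF that])
      show ?thesis using p.nP_bounds(1)[of t] by (simp add: p.n_def AL_def)
    qed
    note AI = graded_inverse[OF a low]
    show "graded (Suc k) 0 (\<lambda>i t. inverse (nm + AL i t))" "derivs_order (Suc k) 2 (\<lambda>i. deriv (\<lambda>t. inverse (nm + AL i t)))"
      using AI nm by auto
  qed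
  then show "weighted_order (Suc (Suc k)) (\<lambda>i. (deriv ^^ Suc k) (\<lambda>t. inverse (nm + AL i t)))"
    unfolding derivs_order_def funpow_Suc_right comp_apply by (auto simp: numeral_2_eq_2)
qed

end

section \<open>A monotone functional along arbitrary waves\<close>

lemma last_crossing:
  fixes f :: "real \<Rightarrow> real"
  assumes c: "\<And>t. isCont f t" and ab: "a \<le> b" "f a \<le> c" "c < f b"
  obtains a' where "a \<le> a'" "a' < b" "f a' = c" "\<And>t. a' < t \<Longrightarrow> t \<le> b \<Longrightarrow> c < f t"
proof -
  define S where "S = {a..b} \<inter> f -` {..c}"
  have cf: "continuous_on UNIV f" using c by (simp add: continuous_on_eq_continuous_at)
  have "closed (f -` {..c})" using cf continuous_closed_vimage[of "{..c}" f] c by auto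
  then have "compact S" unfolding S_def by (intro compact_Int_closed) auto
  moreover have "S \<noteq> {}" using ab by (auto simp: S_def)
  ultimately obtain a' where a': "a' \<in> S" "\<And>t. t \<in> S \<Longrightarrow> t \<le> a'"
    using compact_attains_sup[of S] by blast
  have i: "a \<le> a'" "a' \<le> b" "f a' \<le> c" using a'(1) by (auto simp: S_def)
  then have ne: "a' < b" using ab by (cases "a' = b") auto
  have above: "c < f t" if "a' < t" "t \<le> b" for t
    using a'(2)[of t] that i by (force simp: S_def)
  have "f a' = c"
  proof (rule ccontr)
    assume "f a' \<noteq> c"
    then have lt: "f a' < c" using i by simp
    obtain x where x: "a' \<le> x" "x \<le> b" "f x = c"
      using IVT[of f a' c b] lt ab(3) ne c by auto
    then show False using above[of x] lt by (cases "x = a'") auto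
  qed
  then show ?thesis using that i(1) ne above by blast
qed

lemma first_crossing:
  fixes f :: "real \<Rightarrow> real"
  assumes c: "\<And>t. isCont f t" and ab: "a \<le> b" "f a < c" "c \<le> f b"
  obtains b' where "a < b'" "b' \<le> b" "f b' = c" "\<And>t. a \<le> t \<Longrightarrow> t < b' \<Longrightarrow> f t < c"
proof -
  have c': "isCont (\<lambda>t. - f (- t)) t" for t
    using isCont_o2[OF isCont_minus[OF continuous_ident] c, of t] by (intro isCont_minus) simp
  obtain a' where "- b \<le> a'" "a' < - a" "- f (- a') = - c" "\<And>t. a' < t \<Longrightarrow> t \<le> - a \<Longrightarrow> - c < - f (- t)"
    using last_crossing[of "\<lambda>t. - f (- t)" "- b" "- a" "- c", OF c'] ab by auto
  then show ?thesis using that[of "- a'"] by (metis add.inverse_inverse neg_less_iff_less neg_le_iff_le)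
qed

lemma first_return:
  fixes f :: "real \<Rightarrow> real"
  assumes c: "\<And>t. isCont f t" and ab: "a \<le> b" "c < f a" "f b \<le> c"
  obtains b' where "a < b'" "b' \<le> b" "f b' = c" "\<And>t. a \<le> t \<Longrightarrow> t < b' \<Longrightarrow> c < f t"
proof -
  have c': "isCont (\<lambda>t. - f t) t" for t by (intro continuous_intros c)
  show ?thesis
    using first_crossing[of "\<lambda>t. - f t" a b "- c", OF c'] ab that by (metis neg_less_iff_less neg_le_iff_le neg_equal_iff_equal)
qed

lemma deriv_nonneg_leaving:
  fixes f :: "real \<Rightarrow> real"
  assumes "(f has_real_derivative f') (at a)" "a < b" "\<And>t. a < t \<Longrightarrow> t < b \<Longrightarrow> f a \<le> f t"
  shows "0 \<le> f'"
proof (rule ccontr)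
  assume "\<not> 0 \<le> f'"
  then obtain d where d: "d > 0" "\<And>h. h > 0 \<Longrightarrow> h < d \<Longrightarrow> f (a + h) < f a"
    using DERIV_neg_dec_right[OF assms(1)] by auto
  define h where "h = min (d / 2) ((b - a) / 2)"
  have "0 < h" using d(1) assms(2) by (simp add: h_def)
  moreover have "h \<le> d / 2" "h \<le> (b - a) / 2" unfolding h_def by (rule min.cobounded1, rule min.cobounded2)
  ultimately show False using d(2)[of h] assms(3)[of "a + h"] d(1) assms(2) by force
qed

lemma deriv_nonpos_entering:
  fixes f :: "real \<Rightarrow> real"
  assumes "(f has_real_derivative f') (at b)" "a < b" "\<And>t. a < t \<Longrightarrow> t < b \<Longrightarrow> f b \<le> f t"
  shows "f' \<le> 0"
proof (rule ccontr)
  assume "\<not> f' \<le> 0"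
  then obtain d where d: "d > 0" "\<And>h. h > 0 \<Longrightarrow> h < d \<Longrightarrow> f (b - h) < f b"
    using DERIV_pos_inc_left[OF assms(1)] by auto
  define h where "h = min (d / 2) ((b - a) / 2)"
  have "0 < h" using d(1) assms(2) by (simp add: h_def)
  moreover have "h \<le> d / 2" "h \<le> (b - a) / 2" unfolding h_def by (rule min.cobounded1, rule min.cobounded2)
  ultimately show False using d(2)[of h] assms(3)[of "b - h"] d(1) assms(2) by force
qed

text \<open>For the maximum principle on the line.\<close>

lemma attains_max_above_limits:
  fixes f :: "real \<Rightarrow> real"
  assumes c: "\<And>t. isCont f t" and lim: "(f \<longlongrightarrow> a) at_bot" "(f \<longlongrightarrow> b) at_top" and t: "a < f t" "b < f t"
  obtains s where "\<And>r. f r \<le> f s"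
proof -
  obtain A where A: "\<And>r. r \<le> A \<Longrightarrow> f r < f t"
    using order_tendstoD(2)[OF lim(1) t(1)] by (auto simp: eventually_at_bot_linorder)
  obtain B where B: "\<And>r. B \<le> r \<Longrightarrow> f r < f t"
    using order_tendstoD(2)[OF lim(2) t(2)] by (auto simp: eventually_at_top_linorder)
  have At: "A < t" "t < B" using A[of t] B[of t] by force+
  obtain s where s: "s \<in> {A..B}" "\<And>r. r \<in> {A..B} \<Longrightarrow> f r \<le> f s"
    using continuous_attains_sup[of "{A..B}" f] At c
    by (auto simp: continuous_at_imp_continuous_on)
  have "f r \<le> f s" for r
  proof (cases "r \<in> {A..B}")
    case False
    then have "f r < f t" using A[of r] B[of r] by force
    also have "f t \<le> f s" using s(2)[of t] At by auto
    finally show ?thesis by simp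
  qed (use s in auto)
  then show ?thesis using that by blast
qed

lemma increment_ge:
  fixes f :: "real \<Rightarrow> real"
  assumes "a \<le> b" "\<And>x. a \<le> x \<Longrightarrow> x \<le> b \<Longrightarrow> (f has_real_derivative f' x) (at x)"
    "\<And>x. a \<le> x \<Longrightarrow> x \<le> b \<Longrightarrow> m \<le> f' x"
  shows "m * (b - a) \<le> f b - f a"
proof -
  have "f a - m * a \<le> f b - m * b"
  proof (rule DERIV_nonneg_imp_nondecreasing[OF assms(1)])
    fix x assume x: "a \<le> x" "x \<le> b"
    have "((\<lambda>x. f x - m * x) has_real_derivative f' x - m * 1) (at x)"
      by (intro DERIV_diff DERIV_cmult DERIV_ident assms(2) x)
    then show "\<exists>z. ((\<lambda>x. f x - m * x) has_real_derivative z) (at x) \<and> 0 \<le> z"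
      using assms(3)[OF x] by fastforce
  qed
  then show ?thesis by (simp add: algebra_simps)
qed

lemma increment_le:
  fixes f :: "real \<Rightarrow> real"
  assumes "a \<le> b" "\<And>x. a \<le> x \<Longrightarrow> x \<le> b \<Longrightarrow> (f has_real_derivative f' x) (at x)"
    "\<And>x. a \<le> x \<Longrightarrow> x \<le> b \<Longrightarrow> f' x \<le> m"
  shows "f b - f a \<le> m * (b - a)"
proof -
  have "- m * (b - a) \<le> - f b - - f a"
    by (rule increment_ge[of a b "\<lambda>x. - f x" "\<lambda>x. - f' x"]) (use assms in \<open>auto intro: DERIV_minus\<close>)
  then show ?thesis by simp
qed

lemma exp_remainder_le_square:
  assumes "\<bar>y\<bar> \<le> (1::real)"
  shows "exp y - 1 - y \<le> y\<^sup>2"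
proof (cases "0 \<le> y")
  case True
  then show ?thesis using exp_bound[of y] assms by simp
next
  case False
  define f where "f = (\<lambda>x::real. 1 + x + x\<^sup>2 - exp x)"
  have "f 0 \<le> f y"
  proof (rule DERIV_nonpos_imp_nonincreasing[of y 0 f])
    show "y \<le> 0" using False by simp
    fix x assume x: "y \<le> x" "x \<le> 0"
    have "(f has_real_derivative 1 + 2 * x - exp x) (at x)"
      unfolding f_def by (auto intro!: derivative_eq_intros)
    moreover have "1 + 2 * x - exp x \<le> 0" using exp_ge_add_one_self[of x] x by linarith
    ultimately show "\<exists>z. (f has_real_derivative z) (at x) \<and> z \<le> 0" by blast
  qed
  then show ?thesis by (simp add: f_def)
qed

text \<open>A solution of the wave system with the right limits, of whatever size in between.\<close>

locale far_field_wave = nsp +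
  fixes np :: real and n P p :: "real \<Rightarrow> real"
  assumes np: "np \<in> near_states" and wave: "wave_sys np n P p"
    and n_pos: "\<And>t. 0 < n t" and P_pos: "\<And>t. 0 < P t"
    and lim: "(n \<longlongrightarrow> nm) at_bot" "(n \<longlongrightarrow> np) at_top" "(P \<longlongrightarrow> nm) at_bot" "(P \<longlongrightarrow> np) at_top"
      "(p \<longlongrightarrow> 0) at_bot" "(p \<longlongrightarrow> 0) at_top"
begin

lemma np_facts: "nm / 2 \<le> np" "np < nm" "0 < np"
  using np nm by (auto simp: near_states_def)

text \<open>
  \<open>R\<close> is the viscous stress, that is \<open>\<mu> flux n' / n\<^sup>2\<close>, and
  \<open>y\<close> the deviation from quasi-neutrality on a logarithmic scale. \<open>L\<close> is an
  energy that combines \<open>gf\<close>, \<open>exp y - 1 - y\<close> and the field energy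
  \<open>p\<^sup>2\<close>; its derivative is \<open>R\<^sup>2 / (\<mu> flux) = \<mu> flux (n' /
  n\<^sup>2)\<^sup>2\<close>, so that it would be conserved without viscosity. \<open>L\<close> enters
  in two ways, through the energy (\<open>energy_relation\<close>) and through the stress
  (\<open>momentum_relation\<close>).
\<close>

definition R where "R t = (T + 1) * (n t - nm) * (n t - np) / n t + (P t - n t) - l\<^sup>2 * (p t)\<^sup>2 / 2"
definition y where "y t = ln (P t) - ln (n t)"
definition kf where "kf x = (T + 1) * (nm * np / (2 * x\<^sup>2) + ln x)"
definition gf where "gf x = (T + 1) * (ln x - 1 + (nm + np) / x - nm * np / (2 * x\<^sup>2))"
definition L where "L t = kf (n t) + y t - R t / n t"

lemma muJ: "0 < \<mu> * flux np" using mu flux_bounds[OF np] by simp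

lemma P_deriv: "(P has_real_derivative P t * p t) (at t)"
  and p_deriv: "(p has_real_derivative (P t - n t) / l\<^sup>2) (at t)"
  using wave unfolding wave_sys_def by auto

lemma n_deriv: "(n has_real_derivative (n t)\<^sup>2 * R t / (\<mu> * flux np)) (at t)"
proof -
  have "(1 / (\<mu> * flux np)) * ((T + 1) * n t * (n t - nm) * (n t - np)
         + (n t)\<^sup>2 * (P t - n t) - l\<^sup>2 * (n t)\<^sup>2 * (p t)\<^sup>2 / 2) = (n t)\<^sup>2 * R t / (\<mu> * flux np)"
  proof -
    have "(T + 1) * n t * (n t - nm) * (n t - np) + (n t)\<^sup>2 * (P t - n t) - l\<^sup>2 * (n t)\<^sup>2 * (p t)\<^sup>2 / 2 = (n t)\<^sup>2 * R t"
      using n_pos[of t] unfolding R_def by (simp add: power2_eq_square field_simps)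
    then show ?thesis by simp
  qed
  then show ?thesis using wave unfolding wave_sys_def by metis
qed

lemma conts: "isCont n t" "isCont P t" "isCont p t"
  using n_deriv P_deriv p_deriv DERIV_isCont by blast+

lemma momentum_relation: "R t = n t * (kf (n t) + y t - L t)"
  using n_pos[of t] by (simp add: L_def)

lemma energy_relation: "l\<^sup>2 * (p t)\<^sup>2 / (2 * n t) = (exp (y t) - 1 - y t) + L t - gf (n t)"
proof -
  have e: "exp (y t) = P t / n t" unfolding y_def exp_diff using n_pos P_pos by simp
  show ?thesis unfolding L_def gf_def kf_def R_def e
    using n_pos[of t] by (simp add: field_simps power2_eq_square)
qed

lemma L_explicit: "L t = gf (n t) + 1 + ln (P t) - ln (n t) - P t / n t + l\<^sup>2 * (p t)\<^sup>2 / (2 * n t)"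
proof -
  have e: "exp (y t) = P t / n t" unfolding y_def exp_diff using n_pos P_pos by simp
  show ?thesis using energy_relation[of t] unfolding e unfolding y_def by linarith
qed

lemma gf_deriv:
  assumes "0 < x"
  shows "(gf has_real_derivative (T + 1) * (x - nm) * (x - np) / x ^ 3) (at x)"
proof -
  have "(gf has_real_derivative (T + 1) * (1 / x - (nm + np) / x\<^sup>2 + nm * np / x ^ 3)) (at x)"
    unfolding gf_def[abs_def] using assms
    by (auto intro!: derivative_eq_intros simp: field_simps power2_eq_square power3_eq_cube)
  moreover have "(T + 1) * (1 / x - (nm + np) / x\<^sup>2 + nm * np / x ^ 3) = (T + 1) * (x - nm) * (x - np) / x ^ 3"
    using assms by (simp add: field_simps power2_eq_square power3_eq_cube)
  ultimately show ?thesis by simp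
qed

lemma kf_deriv:
  assumes "0 < x"
  shows "(kf has_real_derivative (T + 1) * (x\<^sup>2 - nm * np) / x ^ 3) (at x)"
proof -
  have "(kf has_real_derivative (T + 1) * (1 / x - nm * np / x ^ 3)) (at x)"
    unfolding kf_def[abs_def] using assms
    by (auto intro!: derivative_eq_intros simp: field_simps power2_eq_square power3_eq_cube)
  moreover have "(T + 1) * (1 / x - nm * np / x ^ 3) = (T + 1) * (x\<^sup>2 - nm * np) / x ^ 3"
    using assms by (simp add: field_simps power2_eq_square power3_eq_cube)
  ultimately show ?thesis by simp
qed

lemma L_deriv: "(L has_real_derivative (R t)\<^sup>2 / (\<mu> * flux np)) (at t)"
proof -
  define a where "a = (n t)\<^sup>2 * R t / (\<mu> * flux np)"
  define F where "F = (\<lambda>t. gf (n t) + 1 + ln (P t) - ln (n t) - P t / n t + l\<^sup>2 * (p t)\<^sup>2 / (2 * n t))"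
  have l2: "l\<^sup>2 \<noteq> 0" using l by simp
  have g: "((\<lambda>t. gf (n t)) has_real_derivative (T + 1) * (n t - nm) * (n t - np) / (n t) ^ 3 * a) (at t)"
    unfolding a_def by (rule DERIV_chain2[OF gf_deriv[OF n_pos] n_deriv])
  have na: "(n has_real_derivative a) (at t)" unfolding a_def by (rule n_deriv)
  have p2: "((\<lambda>t. l\<^sup>2 * (p t)\<^sup>2) has_real_derivative 2 * p t * (P t - n t)) (at t)"
    by (rule DERIV_cong[OF DERIV_cmult[OF DERIV_power[OF p_deriv]]]) (use l in simp)
  have F': "(F has_real_derivative (T + 1) * (n t - nm) * (n t - np) / (n t) ^ 3 * a + 0 + P t * p t / P t - a / n t
       - (P t * p t * n t - P t * a) / (n t * n t)
       + (2 * p t * (P t - n t) * (2 * n t) - l\<^sup>2 * (p t)\<^sup>2 * (2 * a)) / ((2 * n t) * (2 * n t))) (at t)"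
    unfolding F_def
    by (intro DERIV_add DERIV_diff g DERIV_const DERIV_divide p2 DERIV_cmult na P_deriv
        DERIV_cong[OF DERIV_chain2[OF DERIV_ln_divide P_deriv]] DERIV_cong[OF DERIV_chain2[OF DERIV_ln_divide na]])
      (use n_pos[of t] P_pos[of t] in auto)
  have "(T + 1) * (n t - nm) * (n t - np) / (n t) ^ 3 * a + 0 + P t * p t / P t - a / n t
       - (P t * p t * n t - P t * a) / (n t * n t)
       + (2 * p t * (P t - n t) * (2 * n t) - l\<^sup>2 * (p t)\<^sup>2 * (2 * a)) / ((2 * n t) * (2 * n t))
     = a * R t / (n t)\<^sup>2"
    using n_pos[of t] P_pos[of t] unfolding R_def
    by (simp add: field_simps power2_eq_square power3_eq_cube)
  also have "\<dots> = (R t)\<^sup>2 / (\<mu> * flux np)" unfolding a_def using n_pos[of t] by (simp add: power2_eq_square)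
  finally have "(F has_real_derivative (R t)\<^sup>2 / (\<mu> * flux np)) (at t)" using F' by simp
  moreover have "L = F" by (auto simp: L_explicit F_def)
  ultimately show ?thesis by simp
qed

lemma L_mono: "s \<le> t \<Longrightarrow> L s \<le> L t"
  using has_deriv_nonneg_mono[OF L_deriv] muJ by simp

lemma gf_kf: "gf nm = kf nm" "gf np = kf np"
  unfolding gf_def kf_def using nm np_facts by (simp_all add: field_simps power2_eq_square)

lemma L_bounds: "kf nm \<le> L t" "L t \<le> kf np"
proof -
  have gc: "(gf \<longlongrightarrow> gf x) (at x)" if "0 < x" for x
    using DERIV_isCont[OF gf_deriv[OF that]] by (simp add: isCont_def)
  have gl: "((\<lambda>t. gf (n t)) \<longlongrightarrow> gf x) F" if "(n \<longlongrightarrow> x) F" "0 < x" for x F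
    by (rule isCont_tendsto_compose[OF DERIV_isCont[OF gf_deriv] that(1)]) (rule that(2))
  have lims: "(L \<longlongrightarrow> gf x + 1 + ln x - ln x - x / x + l\<^sup>2 * 0\<^sup>2 / (2 * x)) F"
    if "(n \<longlongrightarrow> x) F" "(P \<longlongrightarrow> x) F" "(p \<longlongrightarrow> 0) F" "0 < x" for x F
    unfolding L_explicit[abs_def] using that by (intro tendsto_intros gl) auto
  have lb: "(L \<longlongrightarrow> kf nm) at_bot" using lims[OF lim(1,3,5) nm] nm by (simp add: gf_kf)
  have lt: "(L \<longlongrightarrow> kf np) at_top" using lims[OF lim(2,4,6) np_facts(3)] np_facts by (simp add: gf_kf)
  show "kf nm \<le> L t"
    by (rule tendsto_upperbound[OF lb]) (auto intro: eventually_mono[OF eventually_le_at_bot[of t]] L_mono)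
  show "L t \<le> kf np"
    by (rule tendsto_lowerbound[OF lt]) (auto intro: eventually_mono[OF eventually_ge_at_top[of t]] L_mono)
qed

text \<open>
  The limits of \<open>L\<close> are \<open>kf nm\<close> and \<open>kf np\<close>, so this bounds how
  much dissipation is available to a wave.
\<close>

lemma total_variation_bound: "kf np - kf nm \<le> 2 * (T + 1) * (nm - np) / nm"
proof -
  have "kf np - kf nm = (T + 1) * ((nm - np) * ((nm + np) / (2 * nm * np)) + (ln np - ln nm))"
    unfolding kf_def using nm np_facts by (simp add: field_simps power2_eq_square)
  also have "\<dots> \<le> (T + 1) * ((nm - np) * (2 / nm) + 0)"
  proof (intro mult_left_mono add_mono)
    have "(nm + np) / (2 * nm * np) \<le> (2 * nm) / (2 * nm * (nm / 2))"
      using nm np_facts by (intro frac_le) auto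
    then show "(nm + np) / (2 * nm * np) \<le> 2 / nm" using nm by simp
  qed (use T np_facts nm in auto)
  finally show ?thesis by (simp add: field_simps)
qed

lemma rate_sign:
  "(n t)\<^sup>2 * R t / (\<mu> * flux np) \<le> 0 \<longleftrightarrow> R t \<le> 0" "0 \<le> (n t)\<^sup>2 * R t / (\<mu> * flux np) \<longleftrightarrow> 0 \<le> R t"
proof -
  define c where "c = (n t)\<^sup>2 / (\<mu> * flux np)"
  have c: "0 < c" using n_pos[of t] muJ by (simp add: c_def)
  have e: "(n t)\<^sup>2 * R t / (\<mu> * flux np) = c * R t" by (simp add: c_def)
  show "(n t)\<^sup>2 * R t / (\<mu> * flux np) \<le> 0 \<longleftrightarrow> R t \<le> 0" "0 \<le> (n t)\<^sup>2 * R t / (\<mu> * flux np) \<longleftrightarrow> 0 \<le> R t"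
    unfolding e using c by (simp_all add: mult_le_0_iff zero_le_mult_iff)
qed

lemma variation_small:
  assumes d: "0 < d" and \<epsilon>: "nm - np \<le> nm * d ^ 3 / 10000"
  shows "kf np - kf nm \<le> (T + 1) * d ^ 3 / 5000"
proof -
  have "2 * (T + 1) * (nm - np) / nm \<le> 2 * (T + 1) * (nm * d ^ 3 / 10000) / nm"
    using \<epsilon> nm T by (intro divide_right_mono mult_left_mono) auto
  also have "\<dots> = (T + 1) * d ^ 3 / 5000" using nm by simp
  finally show ?thesis using total_variation_bound by linarith
qed

lemma width_consequences:
  assumes d: "0 < d" "1000000 * (T + 1) * d \<le> 1"
  shows "d \<le> 1 / 1000000" "(T + 1) * d ^ 3 \<le> d\<^sup>2 / 1000000" "(T + 1)\<^sup>2 * d ^ 4 \<le> (T + 1) * d ^ 3 / 1000000"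
    "d ^ 3 \<le> d" "(T + 1) * d\<^sup>2 \<le> 1 / 1000000"
proof -
  have "1000000 * ((T + 1) * d) \<le> 1" using d(2) by (simp only: mult.assoc)
  then have Td: "(T + 1) * d \<le> 1 / 1000000" by linarith
  have "1 * d \<le> (T + 1) * d" using T d by (intro mult_right_mono) auto
  then show d1: "d \<le> 1 / 1000000" using Td by simp
  have "(T + 1) * d * d\<^sup>2 \<le> 1 / 1000000 * d\<^sup>2" by (intro mult_right_mono Td) auto
  then show "(T + 1) * d ^ 3 \<le> d\<^sup>2 / 1000000" by (simp add: power3_eq_cube power2_eq_square mult_ac)
  have "(T + 1) * d * ((T + 1) * d ^ 3) \<le> 1 / 1000000 * ((T + 1) * d ^ 3)"
    using T d by (intro mult_right_mono Td) auto
  then show "(T + 1)\<^sup>2 * d ^ 4 \<le> (T + 1) * d ^ 3 / 1000000"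
    by (simp add: power4_eq_xxxx power3_eq_cube power2_eq_square mult_ac)
  have "d ^ 3 \<le> d ^ 1" using d d1 by (intro power_decreasing) auto
  then show "d ^ 3 \<le> d" by simp
  have "(T + 1) * d * d \<le> 1 / 1000000 * 1" using d d1 by (intro mult_mono Td) auto
  then show "(T + 1) * d\<^sup>2 \<le> 1 / 1000000" by (simp add: power2_eq_square mult_ac)
qed

text \<open>
  Let \<open>\<delta> = nm * d\<close> and suppose that \<open>n\<close> rises from \<open>nm +
  \<delta> / 2\<close> to \<open>nm + \<delta>\<close>. Above \<open>nm\<close> the function
  \<open>gf\<close> increases, so that there it exceeds \<open>L\<close> by a multiple of
  \<open>d\<^sup>3\<close>; the energy relation then needs \<open>exp y - 1 - y\<close> to be at least
  that large, whence \<open>|y| \<ge> 16 (T + 1) d\<^sup>2\<close>. In the momentum relation nothing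
  can compensate this, so \<open>|R|\<close> is large during the whole rise and \<open>L\<close>
  increases by a multiple of \<open>d\<^sup>3\<close>, more than the total variation, which is a much
  smaller multiple of \<open>d\<^sup>3\<close> by the assumption on the shock strength. The numerical
  constants only have to be separated widely enough.
\<close>

lemma n_upper:
  assumes d: "0 < d" "1000000 * (T + 1) * d \<le> 1" and \<epsilon>: "nm - np \<le> nm * d ^ 3 / 10000"
  shows "n t \<le> nm + nm * d"
proof (rule ccontr)
  assume "\<not> n t \<le> nm + nm * d"
  then have "nm + nm * d < n t" by simp
  note dc = width_consequences[OF d]
  define \<delta> where "\<delta> = nm * d"
  have \<delta>: "0 < \<delta>" using d nm by (simp add: \<delta>_def)
  have big: "nm + \<delta> < n t" using \<open>nm + nm * d < n t\<close> by (simp add: \<delta>_def)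
  define Dv where "Dv = kf np - kf nm"
  have Dv: "Dv \<le> (T + 1) * d ^ 3 / 5000" unfolding Dv_def by (rule variation_small[OF d(1) \<epsilon>])
  have T0: "0 < T + 1" using T by simp
  have pos3: "0 < (T + 1) * d ^ 3" using T0 d by simp
  have \<epsilon>\<delta>: "nm - np \<le> \<delta>"
  proof -
    have "0 \<le> nm * d ^ 3" using nm d by simp
    then show ?thesis
      using \<epsilon> mult_left_mono[OF dc(4) less_imp_le[OF nm]] unfolding \<delta>_def by linarith
  qed
  obtain t0 where t0: "t0 < t" "n t0 < nm + \<delta> / 2"
  proof -
    have "eventually (\<lambda>s. n s < nm + \<delta> / 2) at_bot"
      using lim(1) \<delta> by (intro order_tendstoD(2)) auto
    then obtain A where "\<And>s. s \<le> A \<Longrightarrow> n s < nm + \<delta> / 2" by (auto simp: eventually_at_bot_linorder)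
    then show ?thesis using that[of "min A (t - 1)"] by simp
  qed
  obtain a where a: "t0 \<le> a" "a < t" "n a = nm + \<delta> / 2" "\<And>s. a < s \<Longrightarrow> s \<le> t \<Longrightarrow> nm + \<delta> / 2 < n s"
    using last_crossing[of n t0 t "nm + \<delta> / 2", OF conts(1)] t0 big \<delta> by auto
  obtain b where b: "a < b" "b \<le> t" "n b = nm + \<delta>" "\<And>s. a \<le> s \<Longrightarrow> s < b \<Longrightarrow> n s < nm + \<delta>"
    using first_crossing[of n a t "nm + \<delta>", OF conts(1)] a big \<delta> by auto
  have range: "nm + \<delta> / 2 \<le> n s" "n s \<le> nm + \<delta>" if "a \<le> s" "s \<le> b" for s
  proof -
    show "nm + \<delta> / 2 \<le> n s" using a(3) a(4)[of s] b(2) that by (cases "s = a") auto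
    show "n s \<le> nm + \<delta>" using b(3) b(4)[of s] that by (cases "s = b") auto
  qed
  have n2: "nm + \<delta> \<le> 2 * nm" using dc(1) nm mult_left_mono[of d 1 nm] by (simp add: \<delta>_def)
  \<comment> \<open>the size that the energy relation forces on y\<close>
  define sv where "sv = 16 * (T + 1) * d\<^sup>2"
  have sv: "0 < sv" "sv \<le> 1" using d T0 dc(5) unfolding sv_def mult.assoc by (simp, linarith)
  have slow: "sv / 2 \<le> \<bar>R s\<bar> / n s" if s: "a \<le> s" "s \<le> b" for s
  proof -
    note r = range[OF s]
    have f1: "0 * (nm + \<delta> / 4 - nm) \<le> gf (nm + \<delta> / 4) - gf nm"
    proof (rule increment_ge[OF _ gf_deriv])
      fix x assume "nm \<le> x" "x \<le> nm + \<delta> / 4"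
      then show "0 < x" "0 \<le> (T + 1) * (x - nm) * (x - np) / x ^ 3"
        using nm np_facts T0 by (auto intro!: divide_nonneg_nonneg mult_nonneg_nonneg)
    qed (use \<delta> in auto)
    have sl: "(T + 1) * (\<delta> / 4 * (\<delta> / 4)) / (2 * nm) ^ 3 * (n s - (nm + \<delta> / 4)) \<le> gf (n s) - gf (nm + \<delta> / 4)"
    proof (rule increment_ge[OF _ gf_deriv])
      fix x assume x: "nm + \<delta> / 4 \<le> x" "x \<le> n s"
      then show "0 < x" using nm \<delta> by linarith
      have "(T + 1) * (\<delta> / 4 * (\<delta> / 4)) / (2 * nm) ^ 3 \<le> (T + 1) * ((x - nm) * (x - np)) / x ^ 3"
        using x r n2 nm np_facts \<delta> T0
        by (intro frac_le mult_left_mono mult_mono power_mono mult_nonneg_nonneg zero_less_power) auto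
      then show "(T + 1) * (\<delta> / 4 * (\<delta> / 4)) / (2 * nm) ^ 3 \<le> (T + 1) * (x - nm) * (x - np) / x ^ 3"
        by (simp add: mult.assoc)
    qed (use r \<delta> in auto)
    have "(T + 1) * d ^ 3 / 512 \<le> (T + 1) * (\<delta> / 4 * (\<delta> / 4)) / (2 * nm) ^ 3 * (n s - (nm + \<delta> / 4))"
    proof -
      have "(T + 1) * d ^ 3 / 512 = (T + 1) * (\<delta> / 4 * (\<delta> / 4)) / (2 * nm) ^ 3 * (\<delta> / 4)"
        using nm by (simp add: \<delta>_def power3_eq_cube field_simps)
      also have "\<dots> \<le> (T + 1) * (\<delta> / 4 * (\<delta> / 4)) / (2 * nm) ^ 3 * (n s - (nm + \<delta> / 4))"
        using r nm T0 \<delta> by (intro mult_left_mono divide_nonneg_nonneg mult_nonneg_nonneg) auto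
      finally show ?thesis .
    qed
    from order_trans[OF this sl] have "(T + 1) * d ^ 3 / 512 \<le> gf (n s) - gf (nm + \<delta> / 4)" .
    then have G: "(T + 1) * d ^ 3 / 1024 \<le> gf (n s) - L s"
      using f1 L_bounds(2)[of s] Dv pos3 gf_kf unfolding Dv_def by linarith
    have "0 \<le> l\<^sup>2 * (p s)\<^sup>2 / (2 * n s)" using n_pos[of s] by simp
    then have E: "(T + 1) * d ^ 3 / 1024 \<le> exp (y s) - 1 - y s" using energy_relation[of s] G by linarith
    have ys: "sv \<le> \<bar>y s\<bar>"
    proof (rule ccontr)
      assume "\<not> sv \<le> \<bar>y s\<bar>"
      then have lt: "\<bar>y s\<bar> < sv" by simp
      then have "exp (y s) - 1 - y s \<le> (y s)\<^sup>2" using sv by (intro exp_remainder_le_square) simp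
      also have "(y s)\<^sup>2 \<le> sv\<^sup>2" using lt by (simp add: abs_le_square_iff[symmetric])
      also have "sv\<^sup>2 = 256 * ((T + 1)\<^sup>2 * d ^ 4)" by (simp add: sv_def power2_eq_square power4_eq_xxxx algebra_simps)
      finally show False using E dc(3) pos3 by linarith
    qed
    have kub: "kf (n s) - kf nm \<le> 4 * (T + 1) * \<delta> / nm\<^sup>2 * (n s - nm)"
    proof (rule increment_le[OF _ kf_deriv])
      fix x assume x: "nm \<le> x" "x \<le> n s"
      then show x0: "0 < x" using nm by linarith
      have "x\<^sup>2 - nm * np = (x - nm) * (x + nm) + nm * (nm - np)" by (simp add: power2_eq_square algebra_simps)
      also have "\<dots> \<le> \<delta> * (3 * nm) + nm * \<delta>"
        using x r n2 nm \<epsilon>\<delta> \<delta> np_facts by (intro add_mono mult_mono) auto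
      finally have "(T + 1) * (x\<^sup>2 - nm * np) / x ^ 3 \<le> (T + 1) * (\<delta> * (3 * nm) + nm * \<delta>) / x ^ 3"
        using x0 T0 by (intro divide_right_mono mult_left_mono) auto
      also have "\<dots> \<le> (T + 1) * (\<delta> * (3 * nm) + nm * \<delta>) / nm ^ 3"
        using x nm T0 \<delta> by (intro divide_left_mono power_mono mult_nonneg_nonneg) auto
      also have "\<dots> = 4 * (T + 1) * \<delta> / nm\<^sup>2" using nm by (simp add: power3_eq_cube power2_eq_square field_simps)
      finally show "(T + 1) * (x\<^sup>2 - nm * np) / x ^ 3 \<le> 4 * (T + 1) * \<delta> / nm\<^sup>2" .
    qed (use r \<delta> in auto)
    also have "\<dots> \<le> 4 * (T + 1) * \<delta> / nm\<^sup>2 * \<delta>"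
      using r T0 \<delta> by (intro mult_left_mono) auto
    also have "\<dots> = sv / 4" using nm by (simp add: sv_def \<delta>_def power2_eq_square)
    finally have k1: "kf (n s) - kf nm \<le> sv / 4" .
    have k2: "0 * (n s - nm) \<le> kf (n s) - kf nm"
    proof (rule increment_ge[OF _ kf_deriv])
      fix x assume x: "nm \<le> x" "x \<le> n s"
      then show x0: "0 < x" using nm by linarith
      have "nm * np \<le> x * x" using x nm np_facts by (intro mult_mono) auto
      then show "0 \<le> (T + 1) * (x\<^sup>2 - nm * np) / x ^ 3" using T0 x0 by (simp add: power2_eq_square)
    qed (use r \<delta> in auto)
    have "Dv \<le> sv / 4"
    proof -
      have "(T + 1) * d ^ 3 \<le> d\<^sup>2" using dc(2) zero_le_power2[of d] by linarith
      also have "d\<^sup>2 \<le> (T + 1) * d\<^sup>2" using T by (simp add: distrib_right)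
      moreover have "sv / 4 = 4 * ((T + 1) * d\<^sup>2)" by (simp add: sv_def)
      ultimately show ?thesis using Dv pos3 by linarith
    qed
    then have "\<bar>kf (n s) - L s\<bar> \<le> sv / 4" using k1 k2 L_bounds[of s] unfolding Dv_def by linarith
    then have "sv / 2 \<le> \<bar>kf (n s) + y s - L s\<bar>" using ys sv by linarith
    moreover have "\<bar>R s\<bar> / n s = \<bar>kf (n s) + y s - L s\<bar>"
      unfolding momentum_relation[of s] using n_pos[of s] by (simp add: abs_mult)
    ultimately show ?thesis by simp
  qed
  \<comment> \<open>L - cc * n is nondecreasing where |R| is large, which converts the rise of n into a rise of L\<close>
  define cc where "cc = sv / (4 * nm)"
  have "L a - cc * n a \<le> L b - cc * n b"
  proof (rule DERIV_nonneg_imp_nondecreasing[of a b])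
    fix s assume s: "a \<le> s" "s \<le> b"
    have D: "((\<lambda>s. L s - cc * n s) has_real_derivative (R s)\<^sup>2 / (\<mu> * flux np) - cc * ((n s)\<^sup>2 * R s / (\<mu> * flux np))) (at s)"
      by (intro DERIV_diff DERIV_cmult L_deriv n_deriv)
    have "cc * (n s)\<^sup>2 \<le> \<bar>R s\<bar>"
    proof -
      have "cc * n s \<le> sv / (4 * nm) * (2 * nm)"
        unfolding cc_def using range[OF s] n2 sv nm by (intro mult_left_mono) auto
      then have "cc * n s \<le> sv / 2" using nm by simp
      then have "cc * n s \<le> \<bar>R s\<bar> / n s" using slow[OF s] by linarith
      then show ?thesis using n_pos[of s] by (simp add: field_simps power2_eq_square)
    qed
    then have "0 \<le> (\<bar>R s\<bar> - cc * (n s)\<^sup>2) * \<bar>R s\<bar>" by (intro mult_nonneg_nonneg) auto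
    also have "\<dots> \<le> (R s)\<^sup>2 - cc * (n s)\<^sup>2 * R s"
    proof -
      have "cc * (n s)\<^sup>2 * R s \<le> cc * (n s)\<^sup>2 * \<bar>R s\<bar>"
        unfolding cc_def using sv nm by (intro mult_left_mono) auto
      then show ?thesis by (simp add: left_diff_distrib power2_eq_square)
    qed
    finally have "0 \<le> ((R s)\<^sup>2 - cc * (n s)\<^sup>2 * R s) / (\<mu> * flux np)" using muJ by simp
    then have "0 \<le> (R s)\<^sup>2 / (\<mu> * flux np) - cc * ((n s)\<^sup>2 * R s / (\<mu> * flux np))"
      by (simp add: diff_divide_distrib mult.assoc)
    then show "\<exists>z. ((\<lambda>s. L s - cc * n s) has_real_derivative z) (at s) \<and> 0 \<le> z" using D by blast
  qed (use b in simp)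
  then have "cc * (\<delta> / 2) \<le> L b - L a" using a(3) b(3) by (simp add: algebra_simps)
  also have "\<dots> \<le> Dv" using L_bounds[of a] L_bounds[of b] by (simp add: Dv_def)
  finally have "cc * (\<delta> / 2) \<le> Dv" .
  moreover have "cc * (\<delta> / 2) = 2 * ((T + 1) * d ^ 3)"
    using nm by (simp add: cc_def sv_def \<delta>_def power2_eq_square power3_eq_cube)
  ultimately show False using Dv pos3 by linarith
qed

text \<open>
  Let \<open>v1 > v2 > v3\<close> be the levels at distance \<open>\<delta> / 2\<close>, \<open>3/4 *
  \<delta>\<close> and \<open>\<delta>\<close> below \<open>nm\<close>, where \<open>\<delta> = nm *
  d\<close>; they are below \<open>np\<close>. From \<open>v1\<close> downwards \<open>gf\<close> lies
  below \<open>L\<close>, and the energy relation forces \<open>p \<noteq> 0\<close> on every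
  excursion below \<open>v1\<close>. The density enters the excursion with \<open>R \<le> 0\<close>
  and leaves it at the same level with \<open>R \<ge> 0\<close>, so the momentum relation makes
  \<open>y\<close>, and with it \<open>P\<close>, at least as large at the exit as at the entry;
  therefore \<open>p > 0\<close> throughout and \<open>P\<close> increases. While \<open>n\<close>
  falls from \<open>v1\<close> to \<open>v2\<close>, the potential is thus below the value that it has
  when \<open>n\<close> arrives at \<open>v3\<close>, and this makes \<open>R\<close> so negative that
  \<open>L\<close> would increase by a multiple of \<open>d\<^sup>2\<close>, which exceeds its total
  variation.
\<close>

lemma n_lower:
  assumes d: "0 < d" "1000000 * (T + 1) * d \<le> 1" and \<epsilon>: "nm - np \<le> nm * d ^ 3 / 10000"
  shows "nm - nm * d \<le> n t"
proof (rule ccontr)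
  assume "\<not> nm - nm * d \<le> n t"
  then have low: "n t < nm - nm * d" by simp
  note dc = width_consequences[OF d]
  define \<delta> where "\<delta> = nm * d"
  have \<delta>: "0 < \<delta>" using d nm by (simp add: \<delta>_def)
  have \<delta>nm: "\<delta> \<le> nm / 1000000" using dc(1) nm mult_left_mono[OF dc(1), of nm] by (simp add: \<delta>_def)
  define Dv where "Dv = kf np - kf nm"
  have Dv: "Dv \<le> (T + 1) * d ^ 3 / 5000" unfolding Dv_def by (rule variation_small[OF d(1) \<epsilon>])
  have T0: "0 < T + 1" using T by simp
  have pos3: "0 < (T + 1) * d ^ 3" using T0 d by simp
  have \<epsilon>\<delta>: "nm - np \<le> \<delta> / 8"
  proof -
    have "0 \<le> nm * d ^ 3" using nm d by simp
    then show ?thesis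
      using \<epsilon> mult_left_mono[OF dc(4) less_imp_le[OF nm]] unfolding \<delta>_def by linarith
  qed
  define v1 v2 v3 where "v1 = nm - \<delta> / 2" and "v2 = nm - 3/4 * \<delta>" and "v3 = nm - \<delta>"
  have v: "0 < v3" "v3 < v2" "v2 < v1" "v1 < np" using \<delta> \<delta>nm nm \<epsilon>\<delta> by (auto simp: v1_def v2_def v3_def)
  have p_nz: "p s \<noteq> 0" if s: "n s \<le> v1" for s
  proof -
    have f1: "0 * (v1 - n s) \<le> gf v1 - gf (n s)"
    proof (rule increment_ge[OF s gf_deriv])
      fix x assume x: "n s \<le> x" "x \<le> v1"
      then show x0: "0 < x" using n_pos[of s] by linarith
      have "0 \<le> (nm - x) * (np - x)" using x v np_facts by (intro mult_nonneg_nonneg) auto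
      then have "0 \<le> (T + 1) * ((nm - x) * (np - x)) / x ^ 3" using x0 T0 by simp
      then show "0 \<le> (T + 1) * (x - nm) * (x - np) / x ^ 3" by (simp add: algebra_simps)
    qed
    have f2: "0 * (np - (nm - \<delta> / 4)) \<le> gf np - gf (nm - \<delta> / 4)"
    proof (rule increment_ge[OF _ gf_deriv])
      fix x assume x: "nm - \<delta> / 4 \<le> x" "x \<le> np"
      then show x0: "0 < x" using \<delta>nm nm by linarith
      have "0 \<le> (nm - x) * (np - x)" using x np_facts by (intro mult_nonneg_nonneg) auto
      then have "0 \<le> (T + 1) * ((nm - x) * (np - x)) / x ^ 3" using x0 T0 by simp
      then show "0 \<le> (T + 1) * (x - nm) * (x - np) / x ^ 3" by (simp add: algebra_simps)
    qed (use \<epsilon>\<delta> \<delta> in auto)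
    have sl: "(T + 1) * (\<delta> / 4 * (\<delta> / 8)) / nm ^ 3 * ((nm - \<delta> / 4) - v1) \<le> gf (nm - \<delta> / 4) - gf v1"
    proof (rule increment_ge[OF _ gf_deriv])
      fix x assume x: "v1 \<le> x" "x \<le> nm - \<delta> / 4"
      then show x0: "0 < x" using v by linarith
      have "(T + 1) * (\<delta> / 4 * (\<delta> / 8)) / nm ^ 3 \<le> (T + 1) * ((nm - x) * (np - x)) / x ^ 3"
        using x x0 nm \<epsilon>\<delta> \<delta> T0
        by (intro frac_le mult_left_mono mult_mono power_mono mult_nonneg_nonneg zero_less_power) auto
      then show "(T + 1) * (\<delta> / 4 * (\<delta> / 8)) / nm ^ 3 \<le> (T + 1) * (x - nm) * (x - np) / x ^ 3"
        by (simp add: algebra_simps)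
    qed (use \<delta> in \<open>auto simp: v1_def\<close>)
    have sle: "(T + 1) * (\<delta> / 4 * (\<delta> / 8)) / nm ^ 3 * ((nm - \<delta> / 4) - v1) = (T + 1) * d ^ 3 / 128"
      using nm by (simp add: \<delta>_def v1_def power3_eq_cube field_simps)
    have "gf (n s) < L s"
      using f1 f2 sl[unfolded sle] L_bounds(1)[of s] Dv pos3 gf_kf unfolding Dv_def by linarith
    moreover have "0 \<le> exp (y s) - 1 - y s" using exp_ge_add_one_self[of "y s"] by linarith
    ultimately have "0 < l\<^sup>2 * (p s)\<^sup>2 / (2 * n s)" using energy_relation[of s] by linarith
    then show ?thesis by auto
  qed
  \<comment> \<open>the excursion below level v1 that contains t\<close>
  have nc: "isCont (\<lambda>s. - n s) s" for s by (intro isCont_minus conts)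
  obtain t0 where t0: "t0 < t" "v1 < n t0"
  proof -
    have "eventually (\<lambda>s. v1 < n s) at_bot"
      using lim(1) \<delta> by (intro order_tendstoD(1)) (auto simp: v1_def)
    then obtain A where "\<And>s. s \<le> A \<Longrightarrow> v1 < n s" by (auto simp: eventually_at_bot_linorder)
    then show ?thesis using that[of "min A (t - 1)"] by simp
  qed
  obtain t2 where t2: "t < t2" "v1 < n t2"
  proof -
    have "eventually (\<lambda>s. v1 < n s) at_top"
      using lim(2) v by (intro order_tendstoD(1)) auto
    then obtain A where "\<And>s. A \<le> s \<Longrightarrow> v1 < n s" by (auto simp: eventually_at_top_linorder)
    then show ?thesis using that[of "max A (t + 1)"] by simp
  qed
  have nt: "n t < v3" using low by (simp add: v3_def \<delta>_def)
  obtain a where a: "t0 \<le> a" "a < t" "n a = v1" "\<And>s. a < s \<Longrightarrow> s \<le> t \<Longrightarrow> n s < v1"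
    using last_crossing[of "\<lambda>s. - n s" t0 t "- v1", OF nc] t0 nt v by auto
  obtain c where c: "t < c" "c \<le> t2" "n c = v1" "\<And>s. t \<le> s \<Longrightarrow> s < c \<Longrightarrow> n s < v1"
    using first_crossing[of n t t2 v1, OF conts(1)] t2 nt v by auto
  have below: "n s \<le> v1" if "a \<le> s" "s \<le> c" for s
    using that a(3) a(4)[of s] c(3) c(4)[of s] by (cases "s \<le> t"; cases "s = a"; cases "s = c") auto
  have Ra: "R a \<le> 0"
  proof -
    have "0 \<le> - ((n a)\<^sup>2 * R a / (\<mu> * flux np))"
      by (rule deriv_nonneg_leaving[OF DERIV_minus[OF n_deriv] a(2)]) (use a in \<open>auto simp: less_imp_le\<close>)
    then have "(n a)\<^sup>2 * R a / (\<mu> * flux np) \<le> 0" by linarith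
    then show ?thesis unfolding rate_sign .
  qed
  have Rc: "0 \<le> R c"
  proof -
    have "- ((n c)\<^sup>2 * R c / (\<mu> * flux np)) \<le> 0"
      by (rule deriv_nonpos_entering[OF DERIV_minus[OF n_deriv] c(1)]) (use c in \<open>auto simp: less_imp_le\<close>)
    then have "0 \<le> (n c)\<^sup>2 * R c / (\<mu> * flux np)" by linarith
    then show ?thesis unfolding rate_sign .
  qed
  have rel: "R s \<le> 0 \<Longrightarrow> kf (n s) + y s \<le> L s" "0 \<le> R s \<Longrightarrow> L s \<le> kf (n s) + y s" for s
    using momentum_relation[of s] n_pos[of s] by (simp_all add: mult_le_0_iff zero_le_mult_iff)
  have yac: "y a \<le> y c" using rel(1)[OF Ra] rel(2)[OF Rc] a c L_mono[of a c] by simp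
  have lnP: "((\<lambda>s. ln (P s)) has_real_derivative p s) (at s)" for s
    by (rule DERIV_cong[OF DERIV_chain2[OF DERIV_ln_divide P_deriv]]) (use P_pos[of s] in auto)
  \<comment> \<open>otherwise P would be smaller at the exit c than at the entry a\<close>
  have "\<not> (\<forall>s. a \<le> s \<and> s \<le> c \<longrightarrow> p s < 0)"
  proof
    assume neg: "\<forall>s. a \<le> s \<and> s \<le> c \<longrightarrow> p s < 0"
    have "ln (P c) < ln (P a)"
      by (rule DERIV_neg_imp_decreasing[of a c "\<lambda>s. ln (P s)"]) (use a c neg lnP in \<open>auto, blast\<close>)
    then show False using yac a c by (simp add: y_def)
  qed
  then obtain s0 where s0: "a \<le> s0" "s0 \<le> c" "0 \<le> p s0" by force
  have ppos: "0 < p s" if s: "a \<le> s" "s \<le> c" for s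
  proof (rule ccontr)
    assume "\<not> 0 < p s"
    then have le: "p s \<le> 0" by simp
    obtain x where "a \<le> x" "x \<le> c" "p x = 0"
    proof (cases "s \<le> s0")
      case True
      then obtain x where "s \<le> x" "x \<le> s0" "p x = 0" using IVT[of p s 0 s0] le s0 conts(3) by auto
      then show ?thesis using that[of x] s s0 by linarith
    next
      case False
      then obtain x where "s0 \<le> x" "x \<le> s" "p x = 0" using IVT2[of p s 0 s0] le s0 conts(3) by auto
      then show ?thesis using that[of x] s s0 by linarith
    qed
    then show False using p_nz below by blast
  qed
  obtain b where b: "a < b" "b \<le> t" "n b = v3" "\<And>s. a \<le> s \<Longrightarrow> s < b \<Longrightarrow> v3 < n s"
    using first_return[of n a t v3, OF conts(1)] a nt v by auto
  have Rb: "R b \<le> 0"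
  proof -
    have "(n b)\<^sup>2 * R b / (\<mu> * flux np) \<le> 0"
      by (rule deriv_nonpos_entering[OF n_deriv b(1)]) (use b in \<open>auto simp: less_imp_le\<close>)
    then show ?thesis unfolding rate_sign .
  qed
  obtain b2 where b2: "a < b2" "b2 \<le> b" "n b2 = v2" "\<And>s. a \<le> s \<Longrightarrow> s < b2 \<Longrightarrow> v2 < n s"
    using first_return[of n a b v2, OF conts(1)] a b v by auto
  \<comment> \<open>R in the slab between the levels v1 and v2, by comparison with the time b at which n reaches v3\<close>
  have fall: "R s / n s \<le> - d / 8" if s: "a \<le> s" "s \<le> b2" for s
  proof -
    have ns: "v2 \<le> n s" "n s \<le> v1" using s b2 below[of s] b c a by (cases "s = b2"; force)+
    have "ln (P s) \<le> ln (P b)"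
    proof (rule DERIV_nonneg_imp_nondecreasing[of s b "\<lambda>s. ln (P s)"])
      fix x assume "s \<le> x" "x \<le> b"
      then have "0 < p x" using s b b2 c by (intro ppos) auto
      then show "\<exists>z. ((\<lambda>s. ln (P s)) has_real_derivative z) (at x) \<and> 0 \<le> z"
        using lnP[of x] by (auto intro: less_imp_le)
    qed (use s b2 in auto)
    then have ys: "y s \<le> y b + ln v3 - ln (n s)" unfolding y_def b(3) by linarith
    have "kf (n s) - kf v3 \<le> 0 * (n s - v3)"
    proof (rule increment_le[OF _ kf_deriv])
      fix x assume x: "v3 \<le> x" "x \<le> n s"
      then show x0: "0 < x" using v by linarith
      have "x * x \<le> nm * np" using x x0 ns v np_facts by (intro mult_mono) auto
      then have "(T + 1) * (x\<^sup>2 - nm * np) \<le> 0" using T0 by (simp add: power2_eq_square mult_le_0_iff)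
      then show "(T + 1) * (x\<^sup>2 - nm * np) / x ^ 3 \<le> 0" using x0 by (simp add: divide_le_0_iff)
    qed (use ns v in auto)
    then have Rs: "R s / n s \<le> Dv + ln v3 - ln (n s)"
      using ys rel(1)[OF Rb] b(3) L_bounds[of b] L_bounds[of s] momentum_relation[of s] n_pos[of s]
      unfolding Dv_def by simp
    have nv: "ln v3 - ln (n s) \<le> ln v3 - ln v2" using ns v by simp
    have "ln v3 - ln v2 \<le> - d / 4"
    proof -
      have "ln v3 - ln v2 = ln (v3 / v2)" using v by (simp add: ln_div)
      also have "\<dots> \<le> v3 / v2 - 1" using v by (intro ln_le_minus_one) auto
      also have "\<dots> = - (\<delta> / 4) / v2" using v by (simp add: v3_def v2_def field_simps)
      also have "\<dots> \<le> - (\<delta> / 4) / nm"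
        using v \<delta> nm np_facts by (simp add: v2_def frac_le)
      finally show ?thesis using nm by (simp add: \<delta>_def)
    qed
    then have "R s / n s \<le> Dv - d / 4" using Rs nv by linarith
    moreover have "Dv \<le> d / 8"
    proof -
      have "d\<^sup>2 \<le> d" using d dc(1) by (simp add: power2_eq_square mult_left_le)
      then show ?thesis using Dv dc(2) d by linarith
    qed
    ultimately show ?thesis by linarith
  qed
  define cc where "cc = d / (8 * nm)"
  have "L a + cc * n a \<le> L b2 + cc * n b2"
  proof (rule DERIV_nonneg_imp_nondecreasing[of a b2])
    fix s assume s: "a \<le> s" "s \<le> b2"
    have D: "((\<lambda>s. L s + cc * n s) has_real_derivative (R s)\<^sup>2 / (\<mu> * flux np) + cc * ((n s)\<^sup>2 * R s / (\<mu> * flux np))) (at s)"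
      by (intro DERIV_add DERIV_cmult L_deriv n_deriv)
    have "n s \<le> nm" using below[of s] s b2 b c v np_facts by auto
    then have "cc * n s \<le> cc * nm" unfolding cc_def using d nm by (intro mult_left_mono) auto
    then have "cc * n s \<le> d / 8" using nm by (simp add: cc_def)
    then have "R s / n s + cc * n s \<le> 0" using fall[OF s] by linarith
    then have "R s + cc * (n s)\<^sup>2 \<le> 0" using n_pos[of s] by (simp add: field_simps power2_eq_square)
    moreover have "R s \<le> 0"
    proof -
      have "R s / n s \<le> 0" using fall[OF s] d by linarith
      then show ?thesis using n_pos[of s] by (simp add: divide_le_0_iff)
    qed
    ultimately have "0 \<le> (R s + cc * (n s)\<^sup>2) * R s" by (intro mult_nonpos_nonpos)
    then have "0 \<le> ((R s + cc * (n s)\<^sup>2) * R s) / (\<mu> * flux np)" using muJ by simp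
    then have "0 \<le> (R s)\<^sup>2 / (\<mu> * flux np) + cc * ((n s)\<^sup>2 * R s / (\<mu> * flux np))"
      by (simp add: add_divide_distrib distrib_right power2_eq_square mult.assoc)
    then show "\<exists>z. ((\<lambda>s. L s + cc * n s) has_real_derivative z) (at s) \<and> 0 \<le> z" using D by blast
  qed (use b2 in simp)
  then have "cc * (v1 - v2) \<le> L b2 - L a" using a(3) b2(3) by (simp add: algebra_simps)
  also have "\<dots> \<le> Dv" using L_bounds[of a] L_bounds[of b2] by (simp add: Dv_def)
  finally have "cc * (v1 - v2) \<le> Dv" .
  moreover have "cc * (v1 - v2) = d\<^sup>2 / 32"
    using nm by (simp add: cc_def v1_def v2_def \<delta>_def power2_eq_square)
  moreover have "0 < d\<^sup>2" using d by simp
  ultimately show False using Dv dc(2) by linarith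
qed

end

section \<open>Confinement of all waves and uniqueness\<close>

context nsp
begin

text \<open>
  \<open>width\<close> is the number \<open>d\<close> for which \<open>n_upper\<close> and
  \<open>n_lower\<close> are applied; \<open>conf_const\<close> collects the bounds on \<open>n -
  nm\<close>, \<open>P - n\<close> and \<open>p\<close> in units of \<open>width\<close>, which must
  not exceed \<open>max_radius\<close>.
\<close>

definition conf_const where "conf_const = 2 * nm + 4 + 2 * nm / l\<^sup>2"
definition width where "width = min (1 / (1000000 * (T + 1))) (max_radius / conf_const)"

lemma width: "0 < width" "1000000 * (T + 1) * width \<le> 1" "conf_const * width \<le> max_radius" "0 < conf_const"
proof -
  have "0 \<le> 2 * nm / l\<^sup>2" using nm by simp
  then show conf_const: "0 < conf_const" unfolding conf_const_def using nm by linarith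
  show "0 < width" unfolding width_def using conf_const max_radius T by simp
  have T1: "0 < 1000000 * (T + 1)" using T by simp
  have "width \<le> 1 / (1000000 * (T + 1))" by (simp add: width_def)
  then show "1000000 * (T + 1) * width \<le> 1" unfolding pos_le_divide_eq[OF T1] by (simp add: mult.commute)
  have "width \<le> max_radius / conf_const" by (simp add: width_def)
  then show "conf_const * width \<le> max_radius" unfolding pos_le_divide_eq[OF conf_const] by (simp add: mult.commute)
qed

end

context far_field_wave
begin

text \<open>
  At a maximum of \<open>P\<close> above all values of \<open>n\<close> one would have \<open>p =
  0\<close> and \<open>p' > 0\<close>, so that \<open>P\<close> increases further.
\<close>

lemma P_upper:
  assumes M: "\<And>t. n t \<le> M" and nmM: "nm \<le> M"
  shows "P t \<le> M"
proof (rule ccontr)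
  assume "\<not> P t \<le> M"
  then have big: "M < P t" by simp
  obtain s where s: "\<And>r. P r \<le> P s"
    using attains_max_above_limits[of P nm np t, OF conts(2) lim(3,4)] big nmM np_facts by auto
  have "P s * p s = 0"
    by (rule DERIV_local_max[OF P_deriv, of 1]) (use s in auto)
  then have p0: "p s = 0" using P_pos[of s] by simp
  have "0 < (P s - n s) / l\<^sup>2" using s[of t] big M[of s] l by simp
  then obtain d where d: "0 < d" "\<And>h. 0 < h \<Longrightarrow> h < d \<Longrightarrow> p s < p (s + h)"
    using DERIV_pos_inc_right[OF p_deriv] by blast
  have "P s < P (s + d / 2)"
  proof -
    obtain x where x: "s < x" "x < s + d / 2" "P (s + d / 2) - P s = (s + d / 2 - s) * (P x * p x)"
      using MVT2[of s "s + d / 2" P "\<lambda>x. P x * p x"] d(1) P_deriv by auto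
    have "0 < p x" using d(2)[of "x - s"] x p0 d(1) by simp
    then have "0 < (s + d / 2 - s) * (P x * p x)" using d(1) P_pos[of x] by simp
    then show ?thesis using x(3) by linarith
  qed
  then show False using s[of "s + d / 2"] by simp
qed

lemma P_lower:
  assumes M: "\<And>t. M \<le> n t" and nmM: "M \<le> np"
  shows "M \<le> P t"
proof (rule ccontr)
  assume "\<not> M \<le> P t"
  then have big: "P t < M" by simp
  obtain s where s: "\<And>r. - P r \<le> - P s"
    using attains_max_above_limits[of "\<lambda>t. - P t" "- nm" "- np" t] conts(2) lim(3,4) big nmM np_facts
    by (auto intro: tendsto_minus)
  have "P s * p s = 0"
    by (rule DERIV_local_min[OF P_deriv, of 1]) (use s in auto)
  then have p0: "p s = 0" using P_pos[of s] by simp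
  have "(P s - n s) / l\<^sup>2 < 0" using s[of t] big M[of s] l by (simp add: divide_less_0_iff)
  then obtain d where d: "0 < d" "\<And>h. 0 < h \<Longrightarrow> h < d \<Longrightarrow> p (s + h) < p s"
    using DERIV_neg_dec_right[OF p_deriv] by blast
  have "P (s + d / 2) < P s"
  proof -
    obtain x where x: "s < x" "x < s + d / 2" "P (s + d / 2) - P s = (s + d / 2 - s) * (P x * p x)"
      using MVT2[of s "s + d / 2" P "\<lambda>x. P x * p x"] d(1) P_deriv by auto
    have "p x < 0" using d(2)[of "x - s"] x p0 d(1) by simp
    then have "(s + d / 2 - s) * (P x * p x) < 0" using d(1) P_pos[of x] by (simp add: mult_less_0_iff)
    then show ?thesis using x(3) by linarith
  qed
  then show False using s[of "s + d / 2"] by simp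
qed

text \<open>
  Since \<open>ln P\<close> changes by at most \<open>4 * width\<close> over a unit interval,
  \<open>p\<close> is that small somewhere in it; over the interval \<open>p\<close> changes only by a
  multiple of \<open>P - n\<close>.
\<close>

lemma confined:
  assumes \<epsilon>: "nm - np \<le> nm * width ^ 3 / 10000"
  shows "\<bar>n t - nm\<bar> \<le> max_radius" "\<bar>P t - n t\<bar> \<le> max_radius" "\<bar>p t\<bar> \<le> max_radius"
proof -
  note dc = width_consequences[OF width(1,2)]
  have n: "nm - nm * width \<le> n t" "n t \<le> nm + nm * width" for t
    using n_lower[OF width(1,2) \<epsilon>] n_upper[OF width(1,2) \<epsilon>] by auto
  have "nm * width ^ 3 \<le> nm * width" "0 \<le> nm * width ^ 3" using dc(4) nm width(1) by (auto intro: mult_left_mono)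
  then have "nm - nm * width \<le> np" using \<epsilon> by linarith
  then have P: "nm - nm * width \<le> P t" "P t \<le> nm + nm * width" for t
    using P_lower[OF n(1)] P_upper[OF n(2)] nm width(1) by auto
  have e: "\<bar>P t - n t\<bar> \<le> 2 * nm * width" for t using n[of t] P[of t] by linarith
  have conf_const: "conf_const * width = 2 * nm * width + 4 * width + 2 * nm * width / l\<^sup>2" by (simp add: conf_const_def algebra_simps)
  have pos: "0 \<le> nm * width" "0 \<le> 2 * nm * width / l\<^sup>2" using nm width(1) by simp_all
  show "\<bar>n t - nm\<bar> \<le> max_radius" "\<bar>P t - n t\<bar> \<le> max_radius"
    using n[of t] e[of t] width(1,3) conf_const pos by linarith+
  have lnP: "((\<lambda>s. ln (P s)) has_real_derivative p s) (at s)" for s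
    by (rule DERIV_cong[OF DERIV_chain2[OF DERIV_ln_divide P_deriv]]) (use P_pos[of s] in auto)
  obtain x where x: "t < x" "x < t + 1" "ln (P (t + 1)) - ln (P t) = (t + 1 - t) * p x"
    using MVT2[of t "t + 1" "\<lambda>s. ln (P s)" p] lnP by auto
  have lnd: "ln a - ln b \<le> 4 * width" if "nm - nm * width \<le> b" "a \<le> nm + nm * width" "0 < a" for a b
  proof -
    have dh: "width \<le> 1/2" using dc(1) by simp
    have "nm * width \<le> nm * (1/2)" using dh nm by (intro mult_left_mono) auto
    then have b2: "nm / 2 \<le> b" "0 < b" using that nm by linarith+
    have "ln a - ln b = ln (a / b)" using that b2 by (simp add: ln_div)
    also have "\<dots> \<le> a / b - 1" using that b2 by (intro ln_le_minus_one) auto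
    also have "\<dots> = (a - b) / b" using b2 by (simp add: field_simps)
    also have "\<dots> \<le> (2 * nm * width) / b" using that b2 by (intro divide_right_mono) auto
    also have "\<dots> \<le> (2 * nm * width) / (nm / 2)" using b2 nm width(1) by (intro divide_left_mono) auto
    also have "\<dots> = 4 * width" using nm by simp
    finally show ?thesis .
  qed
  have px: "\<bar>p x\<bar> \<le> 4 * width"
    using lnd[OF P(1)[of t] P(2)[of "t + 1"] P_pos] lnd[OF P(1)[of "t + 1"] P(2)[of t] P_pos] x(3) by simp
  obtain r where r: "t < r" "r < x" "p x - p t = (x - t) * ((P r - n r) / l\<^sup>2)"
    using MVT2[of t x p "\<lambda>r. (P r - n r) / l\<^sup>2"] x p_deriv by auto
  have "\<bar>(x - t) * ((P r - n r) / l\<^sup>2)\<bar> \<le> 1 * (2 * nm * width / l\<^sup>2)"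
    unfolding abs_mult using x e[of r] l by (intro mult_mono) (auto simp: divide_right_mono)
  then show "\<bar>p t\<bar> \<le> max_radius" using px r(3) width(3) conf_const pos by linarith
qed

text \<open>
  The central coordinate of the wave runs from \<open>0\<close> to \<open>- \<epsilon>\<close> and
  takes the value \<open>- \<epsilon> / 2\<close> at some time. Moving that time to \<open>0\<close>
  makes the comparison estimate for small solutions trivial.
\<close>

lemma unique_up_to_shift:
  assumes \<epsilon>: "nm - np \<le> nm * width ^ 3 / 10000" "nm - np \<le> max_radius"
    and X: "normal_sys np z g h" "ball max_radius z g h" and z0: "z 0 = - (nm - np) / 2"
  obtains r where "\<And>t. n t = nm + al (z (t + r)) (g (t + r)) (h (t + r))"
    "\<And>t. P t = nm + al (z (t + r)) (g (t + r)) (h (t + r)) + el (g (t + r)) (h (t + r))"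
proof -
  define z' where "z' = (\<lambda>t. (n t - nm) - c0 * l\<^sup>2 * p t)"
  define g' where "g' = (\<lambda>t. (P t - n t) + l\<^sup>2 * (r1 + c0) * p t)"
  define h' where "h' = (\<lambda>t. (P t - n t) + l\<^sup>2 * (r2 + c0) * p t)"
  have sys: "normal_sys np z' g' h'" unfolding z'_def g'_def h'_def by (rule wave_imp_normal[OF wave np])
  have inv: "al (z' t) (g' t) (h' t) = n t - nm" "el (g' t) (h' t) = P t - n t" "psi (g' t) (h' t) = p t" for t
    unfolding z'_def g'_def h'_def by (rule coordinates_inverse)+
  have b: "ball max_radius z' g' h'" unfolding ball_def inv using confined[OF \<epsilon>(1)] by blast
  have zc: "isCont z' t" for t unfolding z'_def by (intro continuous_intros conts)
  have zl: "(z' \<longlongrightarrow> (nm - nm) - c0 * l\<^sup>2 * 0) at_bot" "(z' \<longlongrightarrow> (np - nm) - c0 * l\<^sup>2 * 0) at_top"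
    unfolding z'_def by (intro tendsto_intros lim)+
  have "eventually (\<lambda>t. - (nm - np) / 2 < z' t) at_bot"
    using np_facts by (intro order_tendstoD(1)[OF zl(1)]) auto
  then obtain A where A: "- (nm - np) / 2 < z' A" by (auto simp: eventually_at_bot_linorder)
  have "eventually (\<lambda>t. z' t < - (nm - np) / 2) at_top"
    using np_facts by (intro order_tendstoD(2)[OF zl(2)]) auto
  then obtain B where B: "z' B < - (nm - np) / 2" by (auto simp: eventually_at_top_linorder)
  obtain s where s: "z' s = - (nm - np) / 2"
    using intermediate_value[of z' B "- (nm - np) / 2" A, OF zc] A B by auto
  have eq: "\<bar>z' (t + s) - z t\<bar> + \<bar>g' (t + s) - g t\<bar> + \<bar>h' (t + s) - h t\<bar> \<le> 0" for t
    using small_solutions_compare(1)[OF np \<epsilon>(2) order.refl normal_sys_shift[OF sys, of s] ball_shift[OF b, of s] X, of t]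
      s z0 by simp
  have zgh: "z' t = z (t + - s)" "g' t = g (t + - s)" "h' t = h (t + - s)" for t
  proof -
    have "t + - s + s = t" by simp
    then have e: "\<bar>z' t - z (t + - s)\<bar> + \<bar>g' t - g (t + - s)\<bar> + \<bar>h' t - h (t + - s)\<bar> \<le> 0"
      using eq[of "t + - s"] by metis
    show "z' t = z (t + - s)" "g' t = g (t + - s)" "h' t = h (t + - s)" using e by linarith+
  qed
  show ?thesis
  proof (rule that)
    show "n t = nm + al (z (t + - s)) (g (t + - s)) (h (t + - s))" for t
      using inv(1)[of t] unfolding zgh by simp
    show "P t = nm + al (z (t + - s)) (g (t + - s)) (h (t + - s)) + el (g (t + - s)) (h (t + - s))" for t
      using inv(1,2)[of t] unfolding zgh by simp
  qed
qed

end

section \<open>Integration of the travelling wave equations\<close>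

context nsp
begin

text \<open>
  Eliminating the velocities leaves \<open>(nm * (s - um))\<^sup>2 = (T + 1) * nm * np\<close>; the
  second characteristic family, \<open>s > um\<close>, selects the positive root.
\<close>

lemma rankine_hugoniot_facts:
  assumes rh: "rankine_hugoniot T s nm um np up" and s: "um < s" and np: "np \<in> near_states"
  shows "nm * (s - um) = flux np" "um = s - flux np / nm" "up = s - flux np / np"
proof -
  have np0: "0 < np" "np < nm" using np flux_bounds(5)[OF np] by (auto simp: near_states_def)
  define j where "j = nm * (s - um)"
  have j: "0 < j" using s nm by (simp add: j_def)
  have e1: "np * (s - up) = j" using rh unfolding rankine_hugoniot_def j_def by (simp add: algebra_simps)
  have um: "um = s - j / nm" using nm by (simp add: j_def field_simps)
  have up: "up = s - j / np" unfolding e1[symmetric] using np0 by (simp add: field_simps)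
  have "- s * (np * up - nm * um) + np * up\<^sup>2 - nm * um\<^sup>2 = - (np * (s - up)) * up + (nm * (s - um)) * um"
    by (simp add: power2_eq_square algebra_simps)
  also have "\<dots> = - j * (up - um)" unfolding e1 j_def[symmetric] by (simp add: algebra_simps)
  finally have m: "- j * (up - um) + (T + 1) * (np - nm) = 0" using rh unfolding rankine_hugoniot_def by simp
  define q where "q = j / (nm * np)"
  have d: "up - um = q * (np - nm)" unfolding um up q_def using nm np0 by (simp add: field_simps)
  have "(np - nm) * (T + 1 - j * q) = 0" using m unfolding d by (simp add: algebra_simps)
  then have "j * q = T + 1" using np0 by simp
  then have "j\<^sup>2 = (flux np)\<^sup>2" unfolding flux_bounds(4)[OF np] q_def using nm np0
    by (simp add: field_simps power2_eq_square)
  then have jJ: "j = flux np" using j flux_bounds(2)[OF np] by (simp add: power2_eq_iff_nonneg)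
  show "nm * (s - um) = flux np" using jJ by (simp add: j_def)
  show "um = s - flux np / nm" "up = s - flux np / np" using um up jJ by simp_all
qed

lemma constant_of_zero_deriv:
  fixes F :: "real \<Rightarrow> real"
  assumes "\<And>t. (F has_real_derivative 0) (at t)" "(F \<longlongrightarrow> c) at_bot"
  shows "F t = c"
proof -
  have "F x = F t" for x using DERIV_isconst_all[of F x t] assms(1) by blast
  then have "(F \<longlongrightarrow> F t) at_bot" by (simp add: tendsto_eventually)
  then show ?thesis using tendsto_unique[OF trivial_limit_at_bot_linorder _ assms(2)] by blast
qed

text \<open>
  Two combinations have derivative zero: \<open>n (u - s)\<close>, and the momentum flux together with
  \<open>P - l\<^sup>2 p\<^sup>2 / 2 - \<mu> u'\<close>, by Poisson's equation. Their values are found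
  at minus infinity, where the first derivatives vanish.
\<close>

lemma travelling_wave_first_order:
  assumes tw: "travelling_wave T \<mu> l s nm um np up n u \<phi>"
    and rh: "rankine_hugoniot T s nm um np up" and s: "um < s" and np: "np \<in> near_states"
  shows "far_field_wave T \<mu> l nm np n (\<lambda>t. exp (\<phi> t)) (deriv \<phi>)" "\<And>t. u t = s - flux np / n t"
proof -
  note rf = rankine_hugoniot_facts[OF rh s np]
  note Jb = flux_bounds[OF np]
  have sm: "smooth n" "smooth u" "smooth \<phi>" and n0: "0 < n t"
    and ode: "travelling_wave_ode T \<mu> l s n u \<phi>"
    and con: "connects n nm np" "connects u um up" "connects \<phi> (ln nm) (ln np)" for t
    using tw unfolding travelling_wave_def by auto
  have lim: "(n \<longlongrightarrow> nm) at_bot" "(n \<longlongrightarrow> np) at_top" "(u \<longlongrightarrow> um) at_bot"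
    "(\<phi> \<longlongrightarrow> ln nm) at_bot" "(\<phi> \<longlongrightarrow> ln np) at_top" "(deriv u \<longlongrightarrow> 0) at_bot"
    "(deriv \<phi> \<longlongrightarrow> 0) at_bot" "(deriv \<phi> \<longlongrightarrow> 0) at_top"
    using con unfolding connects_def by auto
  note D = smooth_has_derivative
  have dn: "(n has_real_derivative deriv n t) (at t)" and du: "(u has_real_derivative deriv u t) (at t)"
    and d\<phi>: "(\<phi> has_real_derivative deriv \<phi> t) (at t)"
    and du2: "(deriv u has_real_derivative (deriv ^^ 2) u t) (at t)"
    and d\<phi>2: "(deriv \<phi> has_real_derivative (deriv ^^ 2) \<phi> t) (at t)" for t
    using D[OF sm(1)] D[OF sm(2)] D[OF sm(3)] D[OF smooth_deriv[OF sm(2)]] D[OF smooth_deriv[OF sm(3)]]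
    by (auto simp: numeral_2_eq_2)
  have dnu: "((\<lambda>y. n y * u y) has_real_derivative deriv (\<lambda>y. n y * u y) t) (at t)" for t
    by (intro D smooth_mult sm)
  have dnu2: "((\<lambda>y. n y * (u y)\<^sup>2 + T * n y) has_real_derivative deriv (\<lambda>y. n y * (u y)\<^sup>2 + T * n y) t) (at t)" for t
    unfolding power2_eq_square by (intro D smooth_mult smooth_add smooth_const sm)
  have o1: "- s * deriv n t + deriv (\<lambda>y. n y * u y) t = 0"
    and o2: "- s * deriv (\<lambda>y. n y * u y) t + deriv (\<lambda>y. n y * (u y)\<^sup>2 + T * n y) t
       = \<mu> * (deriv ^^ 2) u t - n t * deriv \<phi> t"
    and o3: "- l\<^sup>2 * (deriv ^^ 2) \<phi> t = n t - exp (\<phi> t)" for t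
    using ode unfolding travelling_wave_ode_def by blast+
  have "((\<lambda>y. - s * n y + n y * u y) has_real_derivative 0) (at t)" for t
    using DERIV_add[OF DERIV_cmult[OF dn, of "- s"] dnu, of t] o1[of t] by simp
  then have m1: "- s * n t + n t * u t = - s * nm + nm * um" for t
    by (rule constant_of_zero_deriv) (intro tendsto_intros lim)
  have m2: "- s * nm + nm * um = - flux np" using rf(1) by (simp add: algebra_simps)
  have mass: "n t * (s - u t) = flux np" for t
    using m1[of t] unfolding m2 by (simp add: algebra_simps)
  show u: "u t = s - flux np / n t" for t using mass[of t] n0[of t] by (simp add: field_simps)
  have p2: "((\<lambda>y. (deriv \<phi> y)\<^sup>2) has_real_derivative 2 * deriv \<phi> t * (deriv ^^ 2) \<phi> t) (at t)" for t
    by (rule DERIV_cong[OF DERIV_power[OF d\<phi>2]]) simp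
  \<comment> \<open>the integrated momentum equation\<close>
  define F where "F = (\<lambda>y. - s * (n y * u y) + (n y * (u y)\<^sup>2 + T * n y) + exp (\<phi> y) - l\<^sup>2 / 2 * (deriv \<phi> y)\<^sup>2 - \<mu> * deriv u y)"
  have "(F has_real_derivative 0) (at t)" for t
  proof -
    have "(F has_real_derivative - s * deriv (\<lambda>y. n y * u y) t + deriv (\<lambda>y. n y * (u y)\<^sup>2 + T * n y) t
        + exp (\<phi> t) * deriv \<phi> t - l\<^sup>2 / 2 * (2 * deriv \<phi> t * (deriv ^^ 2) \<phi> t) - \<mu> * (deriv ^^ 2) u t) (at t)"
      unfolding F_def
      by (intro DERIV_diff DERIV_add DERIV_cmult dnu dnu2 du2 p2 DERIV_chain2[OF DERIV_exp d\<phi>])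
    moreover have "- s * deriv (\<lambda>y. n y * u y) t + deriv (\<lambda>y. n y * (u y)\<^sup>2 + T * n y) t
        + exp (\<phi> t) * deriv \<phi> t - l\<^sup>2 / 2 * (2 * deriv \<phi> t * (deriv ^^ 2) \<phi> t) - \<mu> * (deriv ^^ 2) u t
        = deriv \<phi> t * (exp (\<phi> t) - n t + - l\<^sup>2 * (deriv ^^ 2) \<phi> t)"
      unfolding o2 by (simp add: algebra_simps)
    ultimately show ?thesis unfolding o3 by simp
  qed
  then have "F t = - s * (nm * um) + (nm * um\<^sup>2 + T * nm) + exp (ln nm) - l\<^sup>2 / 2 * 0\<^sup>2 - \<mu> * 0" for t
    by (rule constant_of_zero_deriv) (unfold F_def, intro tendsto_intros lim)
  then have mom: "F t = - um * (nm * (s - um)) + (T + 1) * nm" for t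
    using nm by (simp add: power2_eq_square algebra_simps)
  have nJ: "deriv n t = (n t)\<^sup>2 * deriv u t / flux np" for t
  proof -
    have "((\<lambda>y. s - flux np / n y) has_real_derivative 0 - (0 * n t - flux np * deriv n t) / (n t * n t)) (at t)"
      by (intro DERIV_diff DERIV_const DERIV_divide dn) (use n0[of t] in simp)
    moreover have "u = (\<lambda>y. s - flux np / n y)" using u by auto
    ultimately have "deriv u t = flux np * deriv n t / (n t * n t)" by (auto intro!: DERIV_imp_deriv)
    then show ?thesis using n0[of t] Jb(2) by (simp add: field_simps power2_eq_square)
  qed
  have main: "deriv n t = (1 / (\<mu> * flux np)) * ((T + 1) * n t * (n t - nm) * (n t - np)
         + (n t)\<^sup>2 * (exp (\<phi> t) - n t) - l\<^sup>2 * (n t)\<^sup>2 * (deriv \<phi> t)\<^sup>2 / 2)" for t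
  proof -
    have "- s * (n t * u t) + n t * (u t)\<^sup>2 = - u t * (n t * (s - u t))" by (simp add: power2_eq_square algebra_simps)
    also have "\<dots> = - u t * flux np" unfolding mass ..
    finally have "\<mu> * deriv u t = (um - u t) * flux np + T * n t + exp (\<phi> t) - (T + 1) * nm - l\<^sup>2 / 2 * (deriv \<phi> t)\<^sup>2"
      using mom[of t] unfolding F_def rf(1) by (simp add: algebra_simps)
    also have "(um - u t) * flux np = (flux np)\<^sup>2 * (1 / n t - 1 / nm)"
      unfolding u rf(2) by (simp add: power2_eq_square algebra_simps)
    also have "(flux np)\<^sup>2 * (1 / n t - 1 / nm) = (T + 1) * np * (nm - n t) / n t"
      unfolding Jb(4) using n0[of t] nm by (simp add: field_simps)
    finally have \<mu>: "\<mu> * deriv u t = (T + 1) * np * (nm - n t) / n t + T * n t + exp (\<phi> t) - (T + 1) * nm - l\<^sup>2 / 2 * (deriv \<phi> t)\<^sup>2" .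
    have "\<mu> * flux np * deriv n t = (n t)\<^sup>2 * (\<mu> * deriv u t)" unfolding nJ using Jb(2) by simp
    also have "\<dots> = (T + 1) * n t * (n t - nm) * (n t - np)
         + (n t)\<^sup>2 * (exp (\<phi> t) - n t) - l\<^sup>2 * (n t)\<^sup>2 * (deriv \<phi> t)\<^sup>2 / 2"
      unfolding \<mu> using n0[of t] by (simp add: field_simps power2_eq_square)
    finally show ?thesis using mu Jb(2) by (simp add: field_simps)
  qed
  have \<phi>2: "(deriv ^^ 2) \<phi> t = (exp (\<phi> t) - n t) / l\<^sup>2" for t using o3[of t] l by (simp add: field_simps)
  have w: "wave_sys np n (\<lambda>t. exp (\<phi> t)) (deriv \<phi>)"
    unfolding wave_sys_def main[symmetric] \<phi>2[symmetric]
    using dn d\<phi>2 DERIV_chain2[OF DERIV_exp d\<phi>] by blast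
  show "far_field_wave T \<mu> l nm np n (\<lambda>t. exp (\<phi> t)) (deriv \<phi>)"
  proof
    have "((\<lambda>t. exp (\<phi> t)) \<longlongrightarrow> exp (ln nm)) at_bot" "((\<lambda>t. exp (\<phi> t)) \<longlongrightarrow> exp (ln np)) at_top"
      by (intro tendsto_intros lim)+
    then show "((\<lambda>t. exp (\<phi> t)) \<longlongrightarrow> nm) at_bot" "((\<lambda>t. exp (\<phi> t)) \<longlongrightarrow> np) at_top" using nm Jb(5) by simp_all
  qed (use np w n0 lim in auto)
qed

end

section \<open>Small profiles are travelling waves\<close>

lemma deriv_shift_fun: "deriv (\<lambda>x. f (x + c)) = (\<lambda>x::real. deriv f (x + c))"
  unfolding deriv_def DERIV_shift by simp

lemma funpow_deriv_shift: "(deriv ^^ k) (\<lambda>x. f (x + c)) = (\<lambda>x::real. (deriv ^^ k) f (x + c))"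
  by (induction k) (simp_all add: deriv_shift_fun)

lemma deriv_at_time: "deriv (at_time s t f) x = deriv f (x - s * t)"
  using fun_cong[OF deriv_shift_fun[of f "- (s * t)"], of x] by (simp add: at_time_def)

lemma deviation_at_time:
  "deviation_deriv_norm k (at_time s t n) (at_time s t u) (at_time s t \<phi>) a b c x
    = deviation_deriv_norm k n u \<phi> a b c (x - s * t)"
proof -
  have "(deriv ^^ k) (\<lambda>y. at_time s t f y - d) x = (deriv ^^ k) (\<lambda>y. f y - d) (x - s * t)" for f d
    using fun_cong[OF funpow_deriv_shift[of k "\<lambda>y. f y - d" "- (s * t)"], of x] by (simp add: at_time_def)
  then show ?thesis by (simp add: deviation_deriv_norm_def)
qed

lemma norm_triple_le: "norm (a, b, c) \<le> \<bar>a\<bar> + \<bar>b\<bar> + \<bar>c::real\<bar>" for a b :: real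
  using norm_Pair_le[of a "(b, c)"] norm_Pair_le[of b c] by simp

context small_profile
begin

lemma weight_tendsto_0:
  "((\<lambda>t. exp (- (decay_rate / 4) * \<epsilon> * \<bar>t\<bar>)) \<longlongrightarrow> 0) at_top"
  "((\<lambda>t. exp (- (decay_rate / 4) * \<epsilon> * \<bar>t\<bar>)) \<longlongrightarrow> 0) at_bot"
proof -
  have c: "- (decay_rate / 4) * \<epsilon> < 0" using consts_pos eps by (simp add: mult_neg_pos)
  have "filterlim (\<lambda>t. - (decay_rate / 4) * \<epsilon> * \<bar>t\<bar>) at_bot at_top"
    by (rule filterlim_tendsto_neg_mult_at_bot[OF tendsto_const c filterlim_abs_real])
  from filterlim_compose[OF exp_at_bot this] show t: "((\<lambda>t. exp (- (decay_rate / 4) * \<epsilon> * \<bar>t\<bar>)) \<longlongrightarrow> 0) at_top" .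
  then show "((\<lambda>t. exp (- (decay_rate / 4) * \<epsilon> * \<bar>t\<bar>)) \<longlongrightarrow> 0) at_bot"
    unfolding filterlim_at_bot_mirror[where f = "\<lambda>t. exp (- (decay_rate / 4) * \<epsilon> * \<bar>t\<bar>)"] by simp
qed

lemma tendsto_0_of_le_w:
  assumes "\<And>t. \<bar>f t\<bar> \<le> C * w t"
  shows "(f \<longlongrightarrow> 0) at_top" "(f \<longlongrightarrow> 0) at_bot"
proof -
  have w: "w t \<le> slope_const * \<epsilon>\<^sup>2 * exp (- (decay_rate / 4) * \<epsilon> * \<bar>t\<bar>)" for t by (rule w_decay)
  have b: "norm (f t) \<le> (\<bar>C\<bar> * (slope_const * \<epsilon>\<^sup>2)) * exp (- (decay_rate / 4) * \<epsilon> * \<bar>t\<bar>)" for t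
  proof -
    have "\<bar>f t\<bar> \<le> \<bar>C\<bar> * w t"
      using assms[of t] mult_right_mono[OF abs_ge_self w_nonneg, of C t] by linarith
    also have "\<dots> \<le> \<bar>C\<bar> * (slope_const * \<epsilon>\<^sup>2 * exp (- (decay_rate / 4) * \<epsilon> * \<bar>t\<bar>))"
      by (intro mult_left_mono w) simp
    finally show ?thesis by simp
  qed
  show "(f \<longlongrightarrow> 0) at_top"
    by (rule Lim_null_comparison[OF always_eventually[rule_format, OF b] tendsto_mult_right_zero[OF weight_tendsto_0(1)]])
  show "(f \<longlongrightarrow> 0) at_bot"
    by (rule Lim_null_comparison[OF always_eventually[rule_format, OF b] tendsto_mult_right_zero[OF weight_tendsto_0(2)]])
qed

lemma decay:
  "0 \<le> t \<Longrightarrow> \<bar>n t - np\<bar> \<le> \<epsilon> * exp (- (decay_rate / 4) * \<epsilon> * \<bar>t\<bar>)"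
  "t \<le> 0 \<Longrightarrow> \<bar>n t - nm\<bar> \<le> \<epsilon> * exp (- (decay_rate / 4) * \<epsilon> * \<bar>t\<bar>)"
proof -
  show "\<bar>n t - np\<bar> \<le> \<epsilon> * exp (- (decay_rate / 4) * \<epsilon> * \<bar>t\<bar>)" if "0 \<le> t"
    using decay_right[OF that] n_between(1)[of t] that by (simp only: abs_of_nonneg abs_of_pos diff_gt_0_iff_gt)
  have "decay_rate / 4 * \<epsilon> * t = - (decay_rate / 4) * \<epsilon> * \<bar>t\<bar>" if "t \<le> 0" using that by simp
  then show "\<bar>n t - nm\<bar> \<le> \<epsilon> * exp (- (decay_rate / 4) * \<epsilon> * \<bar>t\<bar>)" if "t \<le> 0"
    using decay_left[OF that] n_between(2)[of t] that by (simp only: abs_of_neg diff_less_0_iff_less minus_diff_eq)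
qed

lemma n_limits: "(n \<longlongrightarrow> np) at_top" "(n \<longlongrightarrow> nm) at_bot"
proof -
  have "((\<lambda>t. n t - np) \<longlongrightarrow> 0) at_top"
    by (rule Lim_null_comparison[OF _ tendsto_mult_right_zero[OF weight_tendsto_0(1), of \<epsilon>]])
      (use decay(1) in \<open>auto intro!: eventually_mono[OF eventually_ge_at_top[of 0]]\<close>)
  then show "(n \<longlongrightarrow> np) at_top" by (simp add: LIM_zero_iff)
  have "((\<lambda>t. n t - nm) \<longlongrightarrow> 0) at_bot"
    by (rule Lim_null_comparison[OF _ tendsto_mult_right_zero[OF weight_tendsto_0(2), of \<epsilon>]])
      (use decay(2) in \<open>auto intro!: eventually_mono[OF eventually_le_at_bot[of 0]]\<close>)
  then show "(n \<longlongrightarrow> nm) at_bot" by (simp add: LIM_zero_iff)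
qed

lemma P_minus_n: "\<bar>P t - n t\<bar> \<le> l\<^sup>2 * slave_const * \<epsilon> * w t"
proof -
  have "deriv p t = (P t - n t) / l\<^sup>2" using wave unfolding wave_sys_def by (auto intro: DERIV_imp_deriv)
  then have "P t - n t = l\<^sup>2 * deriv p t" using l by simp
  then have "\<bar>P t - n t\<bar> = l\<^sup>2 * \<bar>deriv p t\<bar>" by (simp add: abs_mult)
  also have "\<dots> \<le> l\<^sup>2 * (slave_const * \<epsilon> * w t)" using slaved(2)[of t] by (intro mult_left_mono) auto
  finally show ?thesis by (simp add: mult.assoc)
qed

lemma P_limits: "(P \<longlongrightarrow> np) at_top" "(P \<longlongrightarrow> nm) at_bot"
proof -
  note d = tendsto_0_of_le_w[OF P_minus_n]
  show "(P \<longlongrightarrow> np) at_top" using tendsto_add[OF d(1) n_limits(1)] by simp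
  show "(P \<longlongrightarrow> nm) at_bot" using tendsto_add[OF d(2) n_limits(2)] by simp
qed

lemma profile_smooth: "smooth n" "smooth P" "smooth p"
proof -
  note s = normal_sys_smooth[OF sys]
  have p: "smooth (\<lambda>t. psi (g t) (h t))" unfolding psi_def divide_inverse by (intro smooth_intros s)
  then show "smooth p" unfolding p_def[abs_def] .
  show n: "smooth n" unfolding n_def[abs_def] al_def by (intro smooth_intros s p)
  have "smooth (\<lambda>t. el (g t) (h t))" unfolding el_def by (intro smooth_intros s p)
  then have "smooth (\<lambda>t. n t + el (g t) (h t))" by (intro smooth_add n)
  then show "smooth P" unfolding P_def[abs_def] n_def[abs_def] .
qed

lemma np_pos: "0 < np" using np nm by (simp add: near_states_def)

lemma phi_deriv: "((\<lambda>t. ln (P t)) has_real_derivative p t) (at t)"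
  by (rule DERIV_cong[OF DERIV_chain2[OF DERIV_ln_divide P_deriv]]) (use nP_bounds(6)[of t] in auto)

lemma u_deriv: "((\<lambda>t. s - flux np / n t) has_real_derivative flux np * deriv n t / (n t)\<^sup>2) (at t)"
proof -
  have "((\<lambda>t. s - flux np / n t) has_real_derivative 0 - (0 * n t - flux np * deriv n t) / (n t * n t)) (at t)"
    by (intro DERIV_diff DERIV_const DERIV_divide has_real_derivative_deriv[OF n_deriv]) (use nP_bounds(5)[of t] in simp)
  then show ?thesis by (simp add: power2_eq_square)
qed

text \<open>
  The converse of \<open>travelling_wave_first_order\<close>: differentiating the integrated momentum
  equation gives back the original one.
\<close>

lemma is_travelling_wave:
  assumes um: "um = s - flux np / nm" and up: "up = s - flux np / np"
  shows "travelling_wave T \<mu> l s nm um np up n (\<lambda>t. s - flux np / n t) (\<lambda>t. ln (P t))"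
proof -
  let ?u = "\<lambda>t. s - flux np / n t" and ?\<phi> = "\<lambda>t. ln (P t)"
  note Jb = flux_bounds[OF np]
  have n0: "n t \<noteq> 0" for t using nP_bounds(5)[of t] by simp
  have dn: "(n has_real_derivative deriv n t) (at t)" for t by (rule has_real_derivative_deriv[OF n_deriv])
  have du: "deriv ?u = (\<lambda>t. flux np * deriv n t / (n t)\<^sup>2)" by (rule deriv_eqI[OF u_deriv])
  have d\<phi>: "deriv ?\<phi> = p" by (rule deriv_eqI[OF phi_deriv])
  have dp: "(p has_real_derivative (P t - n t) / l\<^sup>2) (at t)" for t using wave unfolding wave_sys_def by blast
  have su: "smooth ?u"
  proof -
    have "smooth (\<lambda>t. s - flux np * inverse (n t))" by (intro smooth_intros smooth_inverse profile_smooth n0)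
    then show ?thesis by (simp add: divide_inverse)
  qed
  have s\<phi>: "smooth ?\<phi>" by (rule smoothI[OF phi_deriv profile_smooth(3)])
  have main: "deriv n t = (1 / (\<mu> * flux np)) * ((T + 1) * n t * (n t - nm) * (n t - np)
         + (n t)\<^sup>2 * (P t - n t) - l\<^sup>2 * (n t)\<^sup>2 * (p t)\<^sup>2 / 2)" for t
    using wave unfolding wave_sys_def by (auto intro!: DERIV_imp_deriv)
  have ueq: "deriv ?u t = 1 / \<mu> * ((flux np)\<^sup>2 / n t - (T + 1) * (np + nm) + T * n t + P t - l\<^sup>2 / 2 * (p t)\<^sup>2)" for t
  proof -
    have gen: "a * (1 / (m * a) * X) / d = 1 / m * (X / d)" if "a \<noteq> 0" for a m X d :: real
      using that by simp
    have "deriv ?u t = 1 / \<mu> * (((T + 1) * n t * (n t - nm) * (n t - np)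
         + (n t)\<^sup>2 * (P t - n t) - l\<^sup>2 * (n t)\<^sup>2 * (p t)\<^sup>2 / 2) / (n t)\<^sup>2)"
      unfolding du main by (rule gen) (use Jb(2) in simp)
    also have "((T + 1) * n t * (n t - nm) * (n t - np)
         + (n t)\<^sup>2 * (P t - n t) - l\<^sup>2 * (n t)\<^sup>2 * (p t)\<^sup>2 / 2) / (n t)\<^sup>2
        = (flux np)\<^sup>2 / n t - (T + 1) * (np + nm) + T * n t + P t - l\<^sup>2 / 2 * (p t)\<^sup>2"
      unfolding Jb(4) using n0[of t] by (simp add: field_simps power2_eq_square)
    finally show ?thesis .
  qed
  have u2: "(deriv ^^ 2) ?u t = 1 / \<mu> * (- ((flux np)\<^sup>2 * deriv n t / (n t)\<^sup>2) + T * deriv n t + n t * p t)" for t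
  proof -
    have i: "((\<lambda>t. (flux np)\<^sup>2 / n t) has_real_derivative (0 * n t - (flux np)\<^sup>2 * deriv n t) / (n t * n t)) (at t)"
      by (intro DERIV_divide DERIV_const dn n0)
    have p2: "((\<lambda>t. (p t)\<^sup>2) has_real_derivative 2 * p t * ((P t - n t) / l\<^sup>2)) (at t)"
      by (rule DERIV_cong[OF DERIV_power[OF dp]]) simp
    have "((\<lambda>t. 1 / \<mu> * ((flux np)\<^sup>2 / n t - (T + 1) * (np + nm) + T * n t + P t - l\<^sup>2 / 2 * (p t)\<^sup>2)) has_real_derivative
       1 / \<mu> * ((0 * n t - (flux np)\<^sup>2 * deriv n t) / (n t * n t) - 0 + T * deriv n t + P t * p t
          - l\<^sup>2 / 2 * (2 * p t * ((P t - n t) / l\<^sup>2)))) (at t)"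
      by (intro DERIV_cmult DERIV_diff DERIV_add DERIV_const i dn P_deriv p2)
    moreover have "l\<^sup>2 / 2 * (2 * p t * ((P t - n t) / l\<^sup>2)) = p t * (P t - n t)" using l by simp
    moreover have "(deriv ^^ 2) ?u t = deriv (\<lambda>t. 1 / \<mu> * ((flux np)\<^sup>2 / n t - (T + 1) * (np + nm) + T * n t + P t - l\<^sup>2 / 2 * (p t)\<^sup>2)) t"
    proof -
      have "(deriv ^^ 2) f = deriv (deriv f)" for f :: "real \<Rightarrow> real" by (simp add: numeral_2_eq_2)
      moreover have "deriv ?u = (\<lambda>t. 1 / \<mu> * ((flux np)\<^sup>2 / n t - (T + 1) * (np + nm) + T * n t + P t - l\<^sup>2 / 2 * (p t)\<^sup>2))"
        by (rule ext) (rule ueq)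
      ultimately show ?thesis by (simp only:)
    qed
    ultimately have "(deriv ^^ 2) ?u t = 1 / \<mu> * ((0 * n t - (flux np)\<^sup>2 * deriv n t) / (n t * n t) - 0 + T * deriv n t + P t * p t
          - p t * (P t - n t))" using DERIV_imp_deriv by simp
    then show ?thesis by (simp add: power2_eq_square algebra_simps)
  qed
  have \<phi>2: "(deriv ^^ 2) ?\<phi> t = (P t - n t) / l\<^sup>2" for t
    using DERIV_imp_deriv[OF dp] by (simp add: numeral_2_eq_2 d\<phi>)
  have nu: "(\<lambda>y. n y * ?u y) = (\<lambda>y. s * n y - flux np)" using n0 by (auto simp: field_simps)
  have dnu: "deriv (\<lambda>y. n y * ?u y) t = s * deriv n t" for t
    unfolding nu by (rule DERIV_imp_deriv) (auto intro!: derivative_eq_intros dn)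
  have nu2: "(\<lambda>y. n y * (?u y)\<^sup>2 + T * n y) = (\<lambda>y. s\<^sup>2 * n y - 2 * s * flux np + (flux np)\<^sup>2 / n y + T * n y)"
    using n0 by (auto simp: power2_eq_square field_simps)
  have dnu2: "deriv (\<lambda>y. n y * (?u y)\<^sup>2 + T * n y) t = s\<^sup>2 * deriv n t - (flux np)\<^sup>2 * deriv n t / (n t)\<^sup>2 + T * deriv n t" for t
  proof -
    have i: "((\<lambda>t. (flux np)\<^sup>2 / n t) has_real_derivative (0 * n t - (flux np)\<^sup>2 * deriv n t) / (n t * n t)) (at t)"
      by (intro DERIV_divide DERIV_const dn n0)
    have "((\<lambda>y. s\<^sup>2 * n y - 2 * s * flux np + (flux np)\<^sup>2 / n y + T * n y) has_real_derivative
        s\<^sup>2 * deriv n t - 0 + (0 * n t - (flux np)\<^sup>2 * deriv n t) / (n t * n t) + T * deriv n t) (at t)"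
      by (intro DERIV_add DERIV_diff DERIV_cmult DERIV_const i dn)
    then show ?thesis unfolding nu2 by (intro DERIV_imp_deriv) (simp add: power2_eq_square)
  qed
  have ode: "travelling_wave_ode T \<mu> l s n ?u ?\<phi>"
    unfolding travelling_wave_ode_def dnu dnu2 u2 \<phi>2 d\<phi>
  proof (intro allI conjI)
    fix t
    show "- s * deriv n t + s * deriv n t = 0" by simp
    show "- s * (s * deriv n t) + (s\<^sup>2 * deriv n t - (flux np)\<^sup>2 * deriv n t / (n t)\<^sup>2 + T * deriv n t)
       = \<mu> * (1 / \<mu> * (- ((flux np)\<^sup>2 * deriv n t / (n t)\<^sup>2) + T * deriv n t + n t * p t)) - n t * p t"
      using mu by (simp add: power2_eq_square)
    show "- l\<^sup>2 * ((P t - n t) / l\<^sup>2) = n t - exp (ln (P t))"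
      using l nP_bounds(6)[of t] by simp
  qed
  have nb: "\<bar>deriv n t\<bar> \<le> 2 * w t" for t using n_p_comparable(1,2)[of t] w_nonneg[of t] by linarith
  have ub: "\<bar>deriv ?u t\<bar> \<le> flux np * 2 / (nm / 2)\<^sup>2 * w t" for t
  proof -
    have "(nm / 2)\<^sup>2 \<le> (n t)\<^sup>2" using nP_bounds(1)[of t] nm by (intro power_mono) auto
    then have "flux np * \<bar>deriv n t\<bar> / (n t)\<^sup>2 \<le> flux np * (2 * w t) / (nm / 2)\<^sup>2"
      using nb[of t] Jb(2) nm w_nonneg[of t] by (intro frac_le mult_left_mono) auto
    then show ?thesis using Jb(2) by (simp add: du abs_mult)
  qed
  have "connects n nm np" unfolding connects_def using n_limits tendsto_0_of_le_w[OF nb] by blast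
  moreover have "connects ?u um up" unfolding connects_def um up
    using tendsto_0_of_le_w[OF ub] nm np_pos
    by (auto intro!: tendsto_intros n_limits)
  moreover have "connects ?\<phi> (ln nm) (ln np)" unfolding connects_def d\<phi>
    using tendsto_0_of_le_w[OF p_bounds] nm np_pos by (auto intro!: tendsto_intros P_limits)
  ultimately show ?thesis unfolding travelling_wave_def
    using profile_smooth su s\<phi> ode nP_bounds(5) by blast
qed

text \<open>
  Both \<open>- n'\<close> and \<open>- \<phi>' = - p\<close> lie between fixed multiples of
  \<open>w\<close> (\<open>n_p_comparable\<close>). As these derivatives are negative, the lower bound
  for \<open>\<phi>'\<close> has the larger constant.
\<close>

lemma slope_relations:
  "deriv n t = (n t)\<^sup>2 * deriv (\<lambda>t. s - flux np / n t) t / flux np"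
  "6 / nm * deriv n t \<le> deriv (\<lambda>t. ln (P t)) t"
  "deriv (\<lambda>t. ln (P t)) t \<le> 1 / (8 * nm) * deriv n t" "1 / (8 * nm) * deriv n t < 0"
proof -
  show "deriv n t = (n t)\<^sup>2 * deriv (\<lambda>t. s - flux np / n t) t / flux np"
    using DERIV_imp_deriv[OF u_deriv, of s t] nP_bounds(5)[of t] flux_bounds(2)[OF np] by simp
  note c = n_p_comparable[of t]
  have "- p t \<le> 3 / nm * (2 * - deriv n t)"
    by (rule order_trans[OF c(4) mult_left_mono]) (use c(1) nm in auto)
  then show "6 / nm * deriv n t \<le> deriv (\<lambda>t. ln (P t)) t" unfolding DERIV_imp_deriv[OF phi_deriv] by simp
  have "- deriv n t / (8 * nm) \<le> (2 * w t) / (8 * nm)" using c(2) nm by (intro divide_right_mono) auto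
  then have "- deriv n t / (8 * nm) \<le> - p t" using c(3) by simp
  then show "deriv (\<lambda>t. ln (P t)) t \<le> 1 / (8 * nm) * deriv n t" unfolding DERIV_imp_deriv[OF phi_deriv] by simp
  have "deriv n t < 0" using c(1) w_pos[of t] by linarith
  then show "1 / (8 * nm) * deriv n t < 0" using nm by (simp add: divide_less_0_iff)
qed

end

section \<open>Decay of all derivatives, uniformly in the shock strength\<close>

context profile_family
begin

definition nF where "nF i t = nm + AL i t"
definition \<phi>F where "\<phi>F i t = ln (nm + AL i t + EL i t)"
definition decay_weight where "decay_weight i t = exp (- (decay_rate / 4) * (nm - i) * \<bar>t\<bar>)"

lemma W_le: assumes "i \<in> I" shows "W i t \<le> slope_const * decay_weight i t"
proof -
  interpret p: small_profile T \<mu> l nm i "Z i" "G i" "H i" by (rule prof[OF assms])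
  show ?thesis using p.w_decay[of t] p.eps(1)
    unfolding p.w_def p.\<epsilon>_def decay_weight_def by (simp add: pos_divide_le_eq mult_ac)
qed

text \<open>
  The bounds on derivatives say nothing about the distance to the far fields. For \<open>n\<close> it
  is controlled by \<open>decay\<close>; \<open>u\<close> is a function of \<open>n\<close>, and
  \<open>P - n = l\<^sup>2 p'\<close> is slaved.
\<close>

lemma zero_order_bound:
  assumes i: "i \<in> I" and x: "nm / 2 \<le> x" and close: "\<bar>nF i t - x\<bar> \<le> (nm - i) * decay_weight i t"
  shows "norm (nF i t - x, (s - flux i / nF i t) - (s - flux i / x), \<phi>F i t - ln x)
    \<le> (1 + 4 * sound / nm + 2 / nm * (l\<^sup>2 * slave_const * slope_const + 1)) * ((nm - i) * decay_weight i t)"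
proof -
  interpret p: small_profile T \<mu> l nm i "Z i" "G i" "H i" by (rule prof[OF i])
  define B where "B = (nm - i) * decay_weight i t"
  have n_eq: "nF i t = p.n t" by (simp add: nF_def p.n_def AL_def)
  have P_eq: "nm + AL i t + EL i t = p.P t" by (simp add: p.P_def AL_def EL_def)
  note nb = p.nP_bounds[of t] and Jb = flux_bounds[OF member(1)[OF i]]
  have x0: "0 < x" using x nm by linarith
  have B0: "0 \<le> B" using member(2)[OF i] by (simp add: B_def decay_weight_def)
  have c: "\<bar>p.n t - x\<bar> \<le> B" using close unfolding n_eq B_def .
  have "(s - flux i / p.n t) - (s - flux i / x) = flux i * (p.n t - x) / (x * p.n t)"
    using x0 nb(5) by (simp add: field_simps)
  then have "\<bar>(s - flux i / p.n t) - (s - flux i / x)\<bar> = flux i * \<bar>p.n t - x\<bar> / (x * p.n t)"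
    using x0 nb(5) Jb(2) by (simp add: abs_mult)
  also have "\<dots> \<le> (sound * nm) * B / (nm / 2 * (nm / 2))"
    using Jb c x nb nm sound B0 x0 by (intro frac_le mult_mono) auto
  also have "\<dots> = 4 * sound / nm * B" using nm by (simp add: field_simps)
  finally have u: "\<bar>(s - flux i / p.n t) - (s - flux i / x)\<bar> \<le> 4 * sound / nm * B" .
  have Pn: "\<bar>p.P t - p.n t\<bar> \<le> l\<^sup>2 * slave_const * slope_const * B"
  proof -
    have e1: "p.\<epsilon>\<^sup>2 \<le> 1" using member(2,3)[OF i] unfolding p.\<epsilon>_def by (simp add: power_le_one)
    have "p.w t \<le> slope_const * p.\<epsilon>\<^sup>2 * decay_weight i t" using p.w_decay[of t] unfolding p.\<epsilon>_def decay_weight_def .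
    also have "\<dots> \<le> slope_const * 1 * decay_weight i t"
      using e1 consts_pos by (intro mult_right_mono mult_left_mono) (auto simp: decay_weight_def)
    finally have "l\<^sup>2 * slave_const * p.\<epsilon> * p.w t \<le> l\<^sup>2 * slave_const * p.\<epsilon> * (slope_const * decay_weight i t)"
      using consts_pos p.eps(1) by (intro mult_left_mono) auto
    then show ?thesis using p.P_minus_n[of t] by (simp add: B_def p.\<epsilon>_def mult_ac)
  qed
  have lnd: "\<bar>ln a - ln b\<bar> \<le> 2 / nm * \<bar>a - b\<bar>" if "nm / 2 \<le> a" "nm / 2 \<le> b" for a b
  proof -
    have one: "ln a - ln b \<le> 2 / nm * \<bar>a - b\<bar>" if ab: "nm / 2 \<le> a" "nm / 2 \<le> b" for a b
    proof -
      have p: "0 < a" "0 < b" using ab nm by linarith+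
      have "ln a - ln b = ln (a / b)" using p by (simp add: ln_div)
      also have "\<dots> \<le> a / b - 1" using p by (intro ln_le_minus_one) auto
      also have "\<dots> = (a - b) / b" using p by (simp add: field_simps)
      also have "\<dots> \<le> \<bar>a - b\<bar> / b" using p by (intro divide_right_mono) auto
      also have "\<dots> \<le> \<bar>a - b\<bar> / (nm / 2)" using p ab nm by (intro divide_left_mono) auto
      finally show ?thesis by (simp add: mult.commute)
    qed
    show ?thesis using one[OF that] one[OF that(2,1)] by (simp add: abs_minus_commute abs_le_iff)
  qed
  have "\<bar>ln (p.P t) - ln x\<bar> \<le> 2 / nm * \<bar>p.P t - x\<bar>" by (rule lnd[OF nb(3) x])
  also have "\<dots> \<le> 2 / nm * ((l\<^sup>2 * slave_const * slope_const + 1) * B)"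
    using Pn c nm by (intro mult_left_mono) (auto simp: distrib_right)
  finally have f: "\<bar>ln (p.P t) - ln x\<bar> \<le> 2 / nm * (l\<^sup>2 * slave_const * slope_const + 1) * B" by (simp only: mult.assoc)
  show ?thesis unfolding \<phi>F_def P_eq n_eq B_def[symmetric] distrib_right
    by (rule order_trans[OF norm_triple_le]) (use c u f in simp)
qed

text \<open>
  Up to constants, the derivatives are those of \<open>n\<close>, of \<open>1 / n\<close> and of
  \<open>p\<close>, bounded by \<open>family_bounds\<close>.
\<close>

lemma higher_order_bound:
  obtains C where "0 \<le> C"
    "\<And>i t s a b c. i \<in> I \<Longrightarrow> deviation_deriv_norm (Suc k) (nF i) (\<lambda>t. s - flux i / nF i t) (\<phi>F i) a b c t
      \<le> C * ((nm - i) ^ Suc (Suc k) * decay_weight i t)"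
proof -
  obtain C1 where C1: "0 \<le> C1" "\<And>i t. i \<in> I \<Longrightarrow> \<bar>(deriv ^^ Suc k) (AL i) t\<bar> \<le> C1 * (nm - i) ^ Suc (Suc k) * W i t"
    using family_bounds(1)[of k] by (rule weighted_orderE) (rule that; assumption)
  obtain C2 where C2: "0 \<le> C2" "\<And>i t. i \<in> I \<Longrightarrow> \<bar>(deriv ^^ k) (PS i) t\<bar> \<le> C2 * (nm - i) ^ Suc (Suc k) * W i t"
    using family_bounds(2)[of k] by (rule weighted_orderE) (rule that; assumption)
  obtain C3 where C3: "0 \<le> C3" "\<And>i t. i \<in> I \<Longrightarrow> \<bar>(deriv ^^ Suc k) (\<lambda>t. inverse (nm + AL i t)) t\<bar> \<le> C3 * (nm - i) ^ Suc (Suc k) * W i t"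
    using family_bounds(3)[of k] by (rule weighted_orderE) (rule that; assumption)
  show ?thesis
  proof (rule that[of "(C1 + sound * nm * C3 + C2) * slope_const"])
    show "0 \<le> (C1 + sound * nm * C3 + C2) * slope_const" using C1 C2 C3 sound nm consts_pos by simp
    fix i t s a b c assume i: "i \<in> I"
    interpret p: small_profile T \<mu> l nm i "Z i" "G i" "H i" by (rule prof[OF i])
    have n_eq: "nF i = p.n" by (auto simp: nF_def p.n_def AL_def)
    have P_eq: "\<phi>F i = (\<lambda>t. ln (p.P t))" by (auto simp: \<phi>F_def p.P_def AL_def EL_def)
    have p_eq: "PS i = p.p" by (auto simp: PS_def p.p_def)
    have sA: "smooth (AL i)"
    proof -
      have "AL i = (\<lambda>t. p.n t - nm)" by (auto simp: p.n_def AL_def)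
      then show ?thesis using p.profile_smooth(1) by (simp add: smooth_diff smooth_const)
    qed
    have sI: "smooth (\<lambda>t. inverse (nm + AL i t))"
    proof -
      have "p.n t \<noteq> 0" for t using p.nP_bounds(5)[of t] by simp
      then have "smooth (\<lambda>t. inverse (p.n t))" by (intro smooth_inverse p.profile_smooth)
      then show ?thesis unfolding n_eq[symmetric] nF_def .
    qed
    have 1: "(deriv ^^ Suc k) (\<lambda>y. nF i y - a) = (deriv ^^ Suc k) (AL i)"
    proof -
      have "deriv (\<lambda>y. nF i y - a) = deriv (AL i)" unfolding nF_def
        by (rule deriv_eqI) (auto intro!: derivative_eq_intros smooth_has_derivative[OF sA])
      then show ?thesis unfolding funpow_Suc_right comp_apply by simp
    qed
    have 2: "(deriv ^^ Suc k) (\<lambda>y. (s - flux i / nF i y) - b) = (\<lambda>t. - flux i * (deriv ^^ Suc k) (\<lambda>t. inverse (nm + AL i t)) t)"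
    proof -
      have "deriv (\<lambda>y. (s - flux i / nF i y) - b) = (\<lambda>t. - flux i * deriv (\<lambda>t. inverse (nm + AL i t)) t)"
        unfolding nF_def divide_inverse
        by (rule deriv_eqI, rule DERIV_cong[OF DERIV_diff[OF DERIV_diff[OF DERIV_const
              DERIV_cmult[OF smooth_has_derivative[OF sI]]] DERIV_const]]) simp
      then show ?thesis unfolding funpow_Suc_right comp_apply
        by (simp add: funpow_deriv_cmult[OF smooth_deriv[OF sI], of k "- flux i", simplified])
    qed
    have 3: "(deriv ^^ Suc k) (\<lambda>y. \<phi>F i y - c) = (deriv ^^ k) (PS i)"
    proof -
      have "deriv (\<lambda>y. \<phi>F i y - c) = PS i" unfolding P_eq p_eq
        by (rule deriv_eqI, rule DERIV_cong[OF DERIV_diff[OF p.phi_deriv DERIV_const]]) simp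
      then show ?thesis unfolding funpow_Suc_right comp_apply by simp
    qed
    define X where "X = (nm - i) ^ Suc (Suc k) * W i t"
    have X0: "0 \<le> X" using member(2)[OF i] by (simp add: X_def)
    have flux: "\<bar>- flux i\<bar> \<le> sound * nm" using flux_bounds(2,3)[OF member(1)[OF i]] by simp
    have "deviation_deriv_norm (Suc k) (nF i) (\<lambda>t. s - flux i / nF i t) (\<phi>F i) a b c t
      \<le> \<bar>(deriv ^^ Suc k) (AL i) t\<bar> + \<bar>- flux i * (deriv ^^ Suc k) (\<lambda>t. inverse (nm + AL i t)) t\<bar> + \<bar>(deriv ^^ k) (PS i) t\<bar>"
      unfolding deviation_deriv_norm_def 1 2 3 by (rule norm_triple_le)
    also have "\<dots> \<le> C1 * X + (sound * nm) * (C3 * X) + C2 * X"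
    proof (intro add_mono)
      show "\<bar>(deriv ^^ Suc k) (AL i) t\<bar> \<le> C1 * X" "\<bar>(deriv ^^ k) (PS i) t\<bar> \<le> C2 * X"
        using C1(2)[OF i, of t] C2(2)[OF i, of t] by (simp_all add: X_def mult.assoc del: funpow.simps)
      have "\<bar>(deriv ^^ Suc k) (\<lambda>t. inverse (nm + AL i t)) t\<bar> \<le> C3 * X"
        using C3(2)[OF i, of t] by (simp add: X_def mult.assoc del: funpow.simps)
      then show "\<bar>- flux i * (deriv ^^ Suc k) (\<lambda>t. inverse (nm + AL i t)) t\<bar> \<le> (sound * nm) * (C3 * X)"
        unfolding abs_mult[of "- flux i"] by (intro mult_mono flux) (use sound nm in auto)
    qed
    also have "\<dots> = (C1 + sound * nm * C3 + C2) * X" by (simp add: algebra_simps)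
    also have "\<dots> \<le> (C1 + sound * nm * C3 + C2) * ((nm - i) ^ Suc (Suc k) * (slope_const * decay_weight i t))"
      unfolding X_def using W_le[OF i, of t] C1(1) C2(1) C3(1) sound nm member(2)[OF i]
      by (intro mult_left_mono) auto
    finally show "deviation_deriv_norm (Suc k) (nF i) (\<lambda>t. s - flux i / nF i t) (\<phi>F i) a b c t
      \<le> (C1 + sound * nm * C3 + C2) * slope_const * ((nm - i) ^ Suc (Suc k) * decay_weight i t)" by (simp add: mult_ac)
  qed
qed

lemma deviation_bound:
  obtains C where "0 < C"
    "\<And>i t s. i \<in> I \<Longrightarrow> t < 0 \<Longrightarrow>
      deviation_deriv_norm k (nF i) (\<lambda>t. s - flux i / nF i t) (\<phi>F i) nm (s - flux i / nm) (ln nm) t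
        \<le> C * ((nm - i) ^ (k + 1) * decay_weight i t)"
    "\<And>i t s. i \<in> I \<Longrightarrow> 0 < t \<Longrightarrow>
      deviation_deriv_norm k (nF i) (\<lambda>t. s - flux i / nF i t) (\<phi>F i) i (s - flux i / i) (ln i) t
        \<le> C * ((nm - i) ^ (k + 1) * decay_weight i t)"
proof (cases k)
  case 0
  define C where "C = 1 + 4 * sound / nm + 2 / nm * (l\<^sup>2 * slave_const * slope_const + 1)"
  have C: "0 < C" unfolding C_def using sound nm consts_pos by (intro add_pos_nonneg) auto
  have close: "t < 0 \<Longrightarrow> \<bar>nF i t - nm\<bar> \<le> (nm - i) * decay_weight i t" "0 < t \<Longrightarrow> \<bar>nF i t - i\<bar> \<le> (nm - i) * decay_weight i t"
    if i: "i \<in> I" for i t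
  proof -
    interpret p: small_profile T \<mu> l nm i "Z i" "G i" "H i" by (rule prof[OF i])
    have n_eq: "nF i t = p.n t" by (simp add: nF_def p.n_def AL_def)
    show "t < 0 \<Longrightarrow> \<bar>nF i t - nm\<bar> \<le> (nm - i) * decay_weight i t" "0 < t \<Longrightarrow> \<bar>nF i t - i\<bar> \<le> (nm - i) * decay_weight i t"
      using p.decay[of t] unfolding n_eq p.\<epsilon>_def decay_weight_def by auto
  qed
  show ?thesis
  proof (rule that[OF C])
    fix i t s assume i: "i \<in> I"
    have x: "nm / 2 \<le> nm" "nm / 2 \<le> i" using member(1)[OF i] nm by (auto simp: near_states_def)
    show "t < 0 \<Longrightarrow> deviation_deriv_norm k (nF i) (\<lambda>t. s - flux i / nF i t) (\<phi>F i) nm (s - flux i / nm) (ln nm) t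
        \<le> C * ((nm - i) ^ (k + 1) * decay_weight i t)"
      using zero_order_bound[OF i x(1) close(1)[OF i], of t s] unfolding 0 C_def deviation_deriv_norm_def by simp
    show "0 < t \<Longrightarrow> deviation_deriv_norm k (nF i) (\<lambda>t. s - flux i / nF i t) (\<phi>F i) i (s - flux i / i) (ln i) t
        \<le> C * ((nm - i) ^ (k + 1) * decay_weight i t)"
      using zero_order_bound[OF i x(2) close(2)[OF i], of t s] unfolding 0 C_def deviation_deriv_norm_def by simp
  qed
next
  case (Suc j)
  obtain C where C: "0 \<le> C"
    "\<And>i t s a b c. i \<in> I \<Longrightarrow> deviation_deriv_norm (Suc j) (nF i) (\<lambda>t. s - flux i / nF i t) (\<phi>F i) a b c t
      \<le> C * ((nm - i) ^ Suc (Suc j) * decay_weight i t)"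
    by (rule higher_order_bound[of j]) (rule that; assumption)
  have le: "deviation_deriv_norm k (nF i) (\<lambda>t. s - flux i / nF i t) (\<phi>F i) a b c t
      \<le> (C + 1) * ((nm - i) ^ (k + 1) * decay_weight i t)" if i: "i \<in> I" for i t s a b c
  proof -
    have "0 \<le> (nm - i) ^ (k + 1) * decay_weight i t" using member(2)[OF i] by (simp add: decay_weight_def)
    then show ?thesis using C(2)[OF i, of s a b c t] unfolding Suc distrib_right by simp
  qed
  show ?thesis by (rule that[of "C + 1"]) (use C(1) le in auto)
qed

end

section \<open>Existence, uniqueness and decay of shock profiles\<close>

context nsp
begin

text \<open>
  The first five bounds are the smallness conditions of \<open>small_profile\<close>; the bound with
  \<open>width ^ 3\<close> confines every wave; the last one keeps \<open>np\<close> above \<open>nm /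
  2\<close>.
\<close>

definition max_jump where
  "max_jump = min (max_radius / (2 * coord_const)) (min (nm / (8 * coord_const)) (min (1 / (8 * slave_const)) (min (visc_min / (2 * slow_const))
     (min (nm / (64 * c0 * l\<^sup>2 * nonlin_const * coord_const\<^sup>2)) (min (nm * width ^ 3 / 10000) (nm / 2))))))"

lemma max_jump_pos: "0 < max_jump"
proof -
  have K: "0 < coord_const" using coord_const_ge_1 by simp
  show ?thesis unfolding max_jump_def min_less_iff_conj
    by (intro conjI divide_pos_pos mult_pos_pos zero_less_power consts_pos max_radius(1) K nm c0 l nonlin_const_pos width(1)) simp_all
qed

lemma max_jump_bounds:
  assumes "nm - np \<le> max_jump"
  shows "nm - np \<le> max_radius / (2 * coord_const)" "2 * coord_const * (nm - np) \<le> max_radius" "8 * coord_const * (nm - np) \<le> nm" "8 * slave_const * (nm - np) \<le> 1"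
      "2 * slow_const * (nm - np) \<le> visc_min" "64 * c0 * l\<^sup>2 * nonlin_const * coord_const\<^sup>2 * (nm - np) \<le> nm"
      "nm - np \<le> nm * width ^ 3 / 10000" "nm / 2 \<le> np"
proof -
  have b: "nm - np \<le> max_radius / (2 * coord_const)" "nm - np \<le> nm / (8 * coord_const)" "nm - np \<le> 1 / (8 * slave_const)" "nm - np \<le> visc_min / (2 * slow_const)"
    "nm - np \<le> nm / (64 * c0 * l\<^sup>2 * nonlin_const * coord_const\<^sup>2)" "nm - np \<le> nm * width ^ 3 / 10000" "nm - np \<le> nm / 2"
    using assms unfolding max_jump_def min.bounded_iff by blast+
  have q: "x \<le> y / k \<Longrightarrow> 0 < k \<Longrightarrow> k * x \<le> y" for x y k :: real by (simp add: pos_le_divide_eq mult.commute)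
  show "nm - np \<le> max_radius / (2 * coord_const)" "nm - np \<le> nm * width ^ 3 / 10000" "nm / 2 \<le> np" using b by auto
  show "2 * coord_const * (nm - np) \<le> max_radius" by (rule q[OF b(1)]) (use coord_const_ge_1 in simp)
  show "8 * coord_const * (nm - np) \<le> nm" by (rule q[OF b(2)]) (use coord_const_ge_1 in simp)
  show "8 * slave_const * (nm - np) \<le> 1" by (rule q[OF b(3)]) (use consts_pos in simp)
  show "2 * slow_const * (nm - np) \<le> visc_min" by (rule q[OF b(4)]) (use consts_pos in simp)
  show "64 * c0 * l\<^sup>2 * nonlin_const * coord_const\<^sup>2 * (nm - np) \<le> nm"
    by (rule q[OF b(5)]) (use c0 l nonlin_const_pos coord_const_ge_1 in simp)
qed

definition shocks where "shocks = {np. np < nm \<and> nm - np \<le> max_jump}"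

lemma profile_family_exists:
  obtains Z G H where "profile_family T \<mu> l nm shocks Z G H"
proof -
  have "\<exists>z g h. small_profile T \<mu> l nm np z g h" if "np \<in> shocks" for np
  proof -
    have e: "np < nm" "nm - np \<le> max_jump" using that by (auto simp: shocks_def)
    note b = max_jump_bounds[OF e(2)]
    have p: "np \<in> near_states" using b(8) e(1) by (simp add: near_states_def)
    obtain z g h where "normal_sys np z g h" "z 0 = - (nm - np) / 2" "ball (2 * coord_const * (nm - np)) z g h"
      by (rule small_profile_exists[OF p b(1)])
    then have "small_profile T \<mu> l nm np z g h"
      using p b by unfold_locales auto
    then show ?thesis by blast
  qed
  then obtain Z G H where "\<And>np. np \<in> shocks \<Longrightarrow> small_profile T \<mu> l nm np (Z np) (G np) (H np)"
    by metis
  then have "profile_family T \<mu> l nm shocks Z G H"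
    by (intro profile_family.intro profile_family_axioms.intro nsp_axioms)
  then show ?thesis by (rule that)
qed

end

theorem theorem1p1:
  fixes T \<mu> l nm um :: real
  assumes "T \<ge> 0" and "\<mu> > 0" and "l > 0" and "nm > 0"
  shows "\<exists>\<epsilon>0 Cup Clow \<theta> :: real. \<exists>C :: nat \<Rightarrow> real.
    \<epsilon>0 > 0 \<and> Cup > 0 \<and> Clow > 0 \<and> \<theta> > 0 \<and> (\<forall>k. C k > 0) \<and>
    (\<forall>np up s :: real.
       rankine_hugoniot T s nm um np up \<and> s > um \<and> np < nm \<and> \<bar>np - nm\<bar> \<le> \<epsilon>0 \<longrightarrow>
       (\<exists>n u \<phi> :: real \<Rightarrow> real.
          travelling_wave T \<mu> l s nm um np up n u \<phi> \<and>
          (\<forall>n' u' \<phi>'. travelling_wave T \<mu> l s nm um np up n' u' \<phi>' \<longrightarrow>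
             (\<exists>h. \<forall>\<xi>. n' \<xi> = n (\<xi> + h) \<and> u' \<xi> = u (\<xi> + h) \<and> \<phi>' \<xi> = \<phi> (\<xi> + h))) \<and>
          (\<forall>x t. t > 0 \<longrightarrow>
             deriv (at_time s t n) x
               = (at_time s t n x)\<^sup>2 * deriv (at_time s t u) x / (nm * \<bar>um - s\<bar>) \<and>
             Clow * deriv (at_time s t n) x \<le> deriv (at_time s t \<phi>) x \<and>
             deriv (at_time s t \<phi>) x \<le> Cup * deriv (at_time s t n) x \<and>
             Cup * deriv (at_time s t n) x < 0) \<and>
          (\<forall>k x t. t > 0 \<longrightarrow>
             (x - s * t < 0 \<longrightarrow>
                deviation_deriv_norm k (at_time s t n) (at_time s t u) (at_time s t \<phi>)
                    nm um (ln nm) x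
                  \<le> C k * \<bar>np - nm\<bar> ^ (k + 1) * exp (- \<theta> * \<bar>np - nm\<bar> * \<bar>x - s * t\<bar>)) \<and>
             (x - s * t > 0 \<longrightarrow>
                deviation_deriv_norm k (at_time s t n) (at_time s t u) (at_time s t \<phi>)
                    np up (ln np) x
                  \<le> C k * \<bar>np - nm\<bar> ^ (k + 1) * exp (- \<theta> * \<bar>np - nm\<bar> * \<bar>x - s * t\<bar>)))))"
proof -
  interpret nsp T \<mu> l nm by unfold_locales (use assms in auto)
  obtain Z G H where "profile_family T \<mu> l nm shocks Z G H" by (rule profile_family_exists)
  then interpret F: profile_family T \<mu> l nm shocks Z G H .
  \<comment> \<open>the constants of decay are chosen for the whole family, before a shock is given\<close>
  have "\<exists>C. 0 < C \<and>
    (\<forall>i t s. i \<in> shocks \<longrightarrow> t < 0 \<longrightarrow>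
      deviation_deriv_norm k (F.nF i) (\<lambda>t. s - flux i / F.nF i t) (F.\<phi>F i) nm (s - flux i / nm) (ln nm) t
        \<le> C * ((nm - i) ^ (k + 1) * F.decay_weight i t)) \<and>
    (\<forall>i t s. i \<in> shocks \<longrightarrow> 0 < t \<longrightarrow>
      deviation_deriv_norm k (F.nF i) (\<lambda>t. s - flux i / F.nF i t) (F.\<phi>F i) i (s - flux i / i) (ln i) t
        \<le> C * ((nm - i) ^ (k + 1) * F.decay_weight i t))" for k
    by (rule F.deviation_bound[of k]) blast
  then obtain C where C: "\<And>k. 0 < C k" and
    Cm: "\<And>k i t s. i \<in> shocks \<Longrightarrow> t < 0 \<Longrightarrow>
      deviation_deriv_norm k (F.nF i) (\<lambda>t. s - flux i / F.nF i t) (F.\<phi>F i) nm (s - flux i / nm) (ln nm) t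
        \<le> C k * ((nm - i) ^ (k + 1) * F.decay_weight i t)" and
    Cp: "\<And>k i t s. i \<in> shocks \<Longrightarrow> 0 < t \<Longrightarrow>
      deviation_deriv_norm k (F.nF i) (\<lambda>t. s - flux i / F.nF i t) (F.\<phi>F i) i (s - flux i / i) (ln i) t
        \<le> C k * ((nm - i) ^ (k + 1) * F.decay_weight i t)"
    by metis
  show ?thesis
  proof (rule exI[of _ max_jump], rule exI[of _ "1 / (8 * nm)"], rule exI[of _ "6 / nm"], rule exI[of _ "decay_rate / 4"],
      rule exI[of _ C], intro conjI allI impI; (elim conjE)?)
    show "0 < max_jump" by (rule max_jump_pos)
    show "0 < 1 / (8 * nm)" "0 < 6 / nm" using assms(4) by simp_all
    show "0 < decay_rate / 4" using consts_pos by simp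
    show "0 < C k" for k by (rule C)
    fix np up s
    assume rh: "rankine_hugoniot T s nm um np up" and s: "um < s" and np: "np < nm" and \<epsilon>: "\<bar>np - nm\<bar> \<le> max_jump"
    have abs: "\<bar>np - nm\<bar> = nm - np" using np by simp
    have i: "np \<in> shocks" using np \<epsilon> by (simp add: shocks_def)
    interpret p: small_profile T \<mu> l nm np "Z np" "G np" "H np" by (rule F.prof[OF i])
    note rf = rankine_hugoniot_facts[OF rh s p.np]
    define n where "n = F.nF np"
    define u where "u = (\<lambda>t. s - flux np / F.nF np t)"
    define \<phi> where "\<phi> = F.\<phi>F np"
    have n_eq: "n = p.n" by (auto simp: n_def F.nF_def p.n_def F.AL_def)
    have u_eq: "u = (\<lambda>t. s - flux np / p.n t)" by (auto simp: u_def F.nF_def p.n_def F.AL_def)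
    have \<phi>_eq: "\<phi> = (\<lambda>t. ln (p.P t))" by (auto simp: \<phi>_def F.\<phi>F_def p.P_def F.AL_def F.EL_def)
    have jump: "nm * \<bar>um - s\<bar> = flux np" using rf(1) s by simp
    have tw: "travelling_wave T \<mu> l s nm um np up n u \<phi>"
      unfolding n_eq u_eq \<phi>_eq by (rule p.is_travelling_wave[OF rf(2,3)])
    have uniq: "\<exists>h. \<forall>\<xi>. n' \<xi> = n (\<xi> + h) \<and> u' \<xi> = u (\<xi> + h) \<and> \<phi>' \<xi> = \<phi> (\<xi> + h)"
      if tw': "travelling_wave T \<mu> l s nm um np up n' u' \<phi>'" for n' u' \<phi>'
    proof -
      interpret w: far_field_wave T \<mu> l nm np n' "\<lambda>t. exp (\<phi>' t)" "deriv \<phi>'"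
        by (rule travelling_wave_first_order(1)[OF tw' rh s p.np])
      have small: "nm - np \<le> nm * width ^ 3 / 10000" "nm - np \<le> max_radius"
        using max_jump_bounds(7)[of np] \<epsilon> abs p.eps_ball p.ball_le by auto
      have ball: "ball max_radius (Z np) (G np) (H np)"
        using p.small_ball p.small(1) unfolding ball_def by (meson order_trans)
      obtain r where r: "\<And>t. n' t = p.n (t + r)" "\<And>t. exp (\<phi>' t) = p.P (t + r)"
        using w.unique_up_to_shift[OF small p.sys ball p.z0] unfolding p.n_def p.P_def by blast
      have "\<phi>' t = \<phi> (t + r)" for t using r(2)[of t] unfolding \<phi>_eq by (metis ln_exp)
      moreover have "u' t = u (t + r)" for t
        using travelling_wave_first_order(2)[OF tw' rh s p.np, of t] unfolding r(1) u_eq .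
      ultimately show ?thesis using r(1) n_eq by blast
    qed
    have slopes: "deriv (at_time s t n) x = (at_time s t n x)\<^sup>2 * deriv (at_time s t u) x / (nm * \<bar>um - s\<bar>) \<and>
             6 / nm * deriv (at_time s t n) x \<le> deriv (at_time s t \<phi>) x \<and>
             deriv (at_time s t \<phi>) x \<le> 1 / (8 * nm) * deriv (at_time s t n) x \<and>
             1 / (8 * nm) * deriv (at_time s t n) x < 0" for x t
      unfolding deriv_at_time jump unfolding at_time_def n_eq u_eq \<phi>_eq
      by (intro conjI p.slope_relations)
    have bounds: "(x - s * t < 0 \<longrightarrow>
                deviation_deriv_norm k (at_time s t n) (at_time s t u) (at_time s t \<phi>) nm um (ln nm) x
                  \<le> C k * \<bar>np - nm\<bar> ^ (k + 1) * exp (- (decay_rate / 4) * \<bar>np - nm\<bar> * \<bar>x - s * t\<bar>)) \<and>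
             (x - s * t > 0 \<longrightarrow>
                deviation_deriv_norm k (at_time s t n) (at_time s t u) (at_time s t \<phi>) np up (ln np) x
                  \<le> C k * \<bar>np - nm\<bar> ^ (k + 1) * exp (- (decay_rate / 4) * \<bar>np - nm\<bar> * \<bar>x - s * t\<bar>))" for k x t
      using Cm[OF i, of "x - s * t" k s] Cp[OF i, of "x - s * t" k s]
      unfolding deviation_at_time abs n_def u_def \<phi>_def rf(2)[symmetric] rf(3)[symmetric] F.decay_weight_def
      unfolding mult.assoc by blast
    show "\<exists>n u \<phi>. travelling_wave T \<mu> l s nm um np up n u \<phi> \<and>
          (\<forall>n' u' \<phi>'. travelling_wave T \<mu> l s nm um np up n' u' \<phi>' \<longrightarrow>
             (\<exists>h. \<forall>\<xi>. n' \<xi> = n (\<xi> + h) \<and> u' \<xi> = u (\<xi> + h) \<and> \<phi>' \<xi> = \<phi> (\<xi> + h))) \<and>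
          (\<forall>x t. t > 0 \<longrightarrow>
             deriv (at_time s t n) x
               = (at_time s t n x)\<^sup>2 * deriv (at_time s t u) x / (nm * \<bar>um - s\<bar>) \<and>
             6 / nm * deriv (at_time s t n) x \<le> deriv (at_time s t \<phi>) x \<and>
             deriv (at_time s t \<phi>) x \<le> 1 / (8 * nm) * deriv (at_time s t n) x \<and>
             1 / (8 * nm) * deriv (at_time s t n) x < 0) \<and>
          (\<forall>k x t. t > 0 \<longrightarrow>
             (x - s * t < 0 \<longrightarrow>
                deviation_deriv_norm k (at_time s t n) (at_time s t u) (at_time s t \<phi>)
                    nm um (ln nm) x
                  \<le> C k * \<bar>np - nm\<bar> ^ (k + 1) * exp (- (decay_rate / 4) * \<bar>np - nm\<bar> * \<bar>x - s * t\<bar>)) \<and>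
             (x - s * t > 0 \<longrightarrow>
                deviation_deriv_norm k (at_time s t n) (at_time s t u) (at_time s t \<phi>)
                    np up (ln np) x
                  \<le> C k * \<bar>np - nm\<bar> ^ (k + 1) * exp (- (decay_rate / 4) * \<bar>np - nm\<bar> * \<bar>x - s * t\<bar>)))"
      by (rule exI[of _ n], rule exI[of _ u], rule exI[of _ \<phi>], rule conjI[OF tw], rule conjI,
          intro allI impI, erule uniq, rule conjI, intro allI impI, rule slopes, intro allI impI, rule bounds)
  qed
qed

end
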